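(* Let $q$ be an odd prime power, $A_{q^2}=\bigoplus_{n\ge0}\mathcal C(\mathfrak{gl}(n,\mathbb F_{q^2}))$ and $B_{q^2}=\bigoplus_{n\ge0}\mathcal C(\mathfrak u(2n,\mathbb F_{q^2}))$. The map $\widetilde\nabla:A_{q^2}\otimes B_{q^2}\to B_{q^2}$ makes $B_{q^2}$ into a graded $A_{q^2}$-module and the map $\widetilde\Delta:B_{q^2}\to A_{q^2}\otimes B_{q^2}$ makes it into a graded $A_{q^2}$-comodule. In other words: (a) The maps $\widetilde\nabla$, $\widetilde\Delta$ preserve grading. (b) For any $a,a'\in A_{q^2}$, $b\in B_{q^2}$, $$\widetilde\nabla(\nabla\otimes\mathrm{id})(a\otimes a'\otimes b)=\widetilde\nabla(\mathrm{id}\otimes\widetilde\nabla)(a\otimes a'\otimes b).$$ (c) For any $b\in B_{q^2}$, $$(\Delta\otimes\mathrm{id})\widetilde\Delta(b)=(\mathrm{id}\otimes\widetilde\Delta)\widetilde\Delta(b).$$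
   Context: Notation. For a matrix $A=(a_{rs})$ over $\mathbb F_{q^2}$, $A^*$ is the transpose of $(a_{rs}^q)$. $J_m$ is the $m\times m$ matrix with $1$'s on the antidiagonal and $0$ elsewhere. $\mathrm U(2n,\mathbb F_{q^2})=\{g\in\mathrm{GL}(2n,\mathbb F_{q^2}):g^*J_{2n}g=J_{2n}\}$ and $\mathfrak u(2n,\mathbb F_{q^2})=\{X\in\mathfrak{gl}(2n,\mathbb F_{q^2}):X^*J_{2n}+J_{2n}X=0\}$. $\mathcal C(\cdot)$ denotes the real vector space of real-valued functions on a matrix Lie algebra invariant under conjugation by the corresponding group ($\mathrm{GL}(n,\mathbb F_{q^2})$ for $\mathfrak{gl}(n,\mathbb F_{q^2})$, $\mathrm U(2n,\mathbb F_{q^2})$ for $\mathfrak u(2n,\mathbb F_{q^2})$); for $n=0$ it is $\mathbb R$. $\mathcal C(\mathfrak{gl}(n,\mathbb F_{q^2}))$ and $\mathcal C(\mathfrak u(2n,\mathbb F_{q^2}))$ are the $n$-th graded parts of $A_{q^2}$ and $B_{q^2}$. Parabolic restriction and induction. For a finite matrix group $G$ with Lie algebra $\mathcal G$ and a parabolic subgroup $P=LU$ with Lie algebra $\mathcal P=\mathcal L\oplus\mathcal U$ (Levi part, nilradical): $(\downarrow^{\mathcal G}_{\mathcal L}\Psi)(Y)=|\mathcal U|^{-1}\sum_{Z\in\mathcal U}\Psi(Y+Z)$ for $\Psi\in\mathcal C(\mathcal G)$, $Y\in\mathcal L$; and $(\uparrow^{\mathcal G}_{\mathcal L}\Phi)(X)=\sum_{g\in[G/P]}\Phi'(g^{-1}Xg)$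 for $\Phi\in\mathcal C(\mathcal L)$, $X\in\mathcal G$, where the sum is over representatives of left cosets, $\Phi'$ equals $\Phi$ composed with the projection $\mathcal P\to\mathcal L$ on $\mathcal P$, and $\Phi'=0$ outside $\mathcal P$. The maps $\nabla$, $\Delta$ on $A_{q^2}$. For $i+j=n$, $i,j\ge0$, take $G=\mathrm{GL}(n,\mathbb F_{q^2})$ and $P_{i,j}$ = invertible block upper triangular matrices with respect to $n=i+j$, with Levi Lie algebra $\{\mathrm{diag}(A,B)\}\cong\mathfrak{gl}(i,\mathbb F_{q^2})\oplus\mathfrak{gl}(j,\mathbb F_{q^2})$ and nilradical the strictly block upper triangular matrices. $\nabla:A_{q^2}\otimes A_{q^2}\to A_{q^2}$ is the sum of the resulting parabolic inductions $\mathcal C(\mathfrak{gl}(i,\mathbb F_{q^2}))\otimes\mathcal C(\mathfrak{gl}(j,\mathbb F_{q^2}))\to\mathcal C(\mathfrak{gl}(i+j,\mathbb F_{q^2}))$, and $\Delta:A_{q^2}\to A_{q^2}\otimes A_{q^2}$ restricted to degree $n$ is the sum over $i+j=n$ of the parabolic restrictions. With these maps, and with unit and counit the inclusion of and projection onto the degree-$0$ part $\mathbb R$, $A_{q^2}$ is a graded commutative and cocommutative bialgebra. The maps $\widetilde\nabla$, $\widetilde\Delta$. For $i+j=n$, $i,j\ge0$, take $G=\mathrm U(2n,\mathbb F_{q^2})$ and $\widetilde P_{i,j}$ = the subgroup of matrices in $\mathrm U(2n,\mathbb F_{q^2})$ that are block upper triangular with respect to $2n=i+2j+i$. Its Levi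 subgroup is $\{\mathrm{diag}(A,B,J_i(A^* )^{-1}J_i):A\in\mathrm{GL}(i,\mathbb F_{q^2}),B\in\mathrm U(2j,\mathbb F_{q^2})\}$, with Lie algebra $\{\mathrm{diag}(A,B,-J_iA^*J_i)\}\cong\mathfrak{gl}(i,\mathbb F_{q^2})\oplus\mathfrak u(2j,\mathbb F_{q^2})$ via $(A,B)$; the nilradical is the set of strictly block upper triangular matrices in $\mathfrak u(2n,\mathbb F_{q^2})$. $\widetilde\nabla:A_{q^2}\otimes B_{q^2}\to B_{q^2}$ is the sum of the parabolic inductions $\mathcal C(\mathfrak{gl}(i,\mathbb F_{q^2}))\otimes\mathcal C(\mathfrak u(2j,\mathbb F_{q^2}))\to\mathcal C(\mathfrak u(2(i+j),\mathbb F_{q^2}))$, and $\widetilde\Delta:B_{q^2}\to A_{q^2}\otimes B_{q^2}$ restricted to degree $n$ is the sum over $i+j=n$ of the parabolic restrictions. *)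

theory Defs
  imports
    "HOL-Library.Function_Algebras"
    "HOL-Library.FuncSet"
    "HOL-Number_Theory.Prime_Powers"
    "Jordan_Normal_Form.Gauss_Jordan_Elimination"
begin

section \<open>Real vector spaces of functions and their tensor products\<close>

instantiation "fun" :: (type, real_vector) real_vector
begin

definition scaleR_fun :: "real \<Rightarrow> ('a \<Rightarrow> 'b) \<Rightarrow> 'a \<Rightarrow> 'b" where
  "scaleR_fun c f = (\<lambda>x. c *\<^sub>R f x)"

instance
  by standard (simp_all add: scaleR_fun_def fun_eq_iff scaleR_add_left scaleR_add_right)

end

definition linear_map ::
  "'v::real_vector set \<Rightarrow> 'w::real_vector set \<Rightarrow> ('v \<Rightarrow> 'w) \<Rightarrow> bool" where
  "linear_map V W F \<longleftrightarrow> F \<in> V \<rightarrow> W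
     \<and> (\<forall>v\<in>V. \<forall>v'\<in>V. F (v + v') = F v + F v')
     \<and> (\<forall>c. \<forall>v\<in>V. F (c *\<^sub>R v) = c *\<^sub>R F v)"

text \<open>
  For subspaces \<open>V\<close>, \<open>W\<close> of the spaces of real functions on \<open>'x\<close>, \<open>'y\<close>, the map sending
  \<open>v \<otimes> w\<close> to the function \<open>(x, y) \<mapsto> v x * w y\<close> identifies the algebraic tensor product of
  \<open>V\<close> and \<open>W\<close> with a space of functions on \<open>'x \<times> 'y\<close>
  (injectivity is lemma \<open>pure_tensor_independent\<close>).
\<close>

definition pure_tensor :: "('x \<Rightarrow> real) \<Rightarrow> ('y \<Rightarrow> real) \<Rightarrow> 'x \<times> 'y \<Rightarrow> real" where
  "pure_tensor v w = (\<lambda>(x, y). v x * w y)"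

definition tensor ::
  "('x \<Rightarrow> real) set \<Rightarrow> ('y \<Rightarrow> real) set \<Rightarrow> ('x \<times> 'y \<Rightarrow> real) set" where
  "tensor V W = span {pure_tensor v w | v w. v \<in> V \<and> w \<in> W}"

text \<open>
  The tensor product of two linear maps: apply \<open>G\<close> in the second variable and \<open>F\<close> in the first.
  Lemmas \<open>tensor_map_pure_tensor\<close> and \<open>linear_map_tensor_map\<close> show that it is the linear map
  determined by \<open>v \<otimes> w \<mapsto> F v \<otimes> G w\<close>.
\<close>

definition tensor_map ::
  "(('x \<Rightarrow> real) \<Rightarrow> 'x' \<Rightarrow> real) \<Rightarrow> (('y \<Rightarrow> real) \<Rightarrow> 'y' \<Rightarrow> real) \<Rightarrow>
   ('x \<times> 'y \<Rightarrow> real) \<Rightarrow> 'x' \<times> 'y' \<Rightarrow> real" where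
  "tensor_map F G T = (\<lambda>(x', y'). F (\<lambda>x. G (\<lambda>y. T (x, y)) y') x')"

text \<open>The canonical isomorphism from \<open>(U \<otimes> V) \<otimes> W\<close> to \<open>U \<otimes> (V \<otimes> W)\<close>.\<close>

definition tensor_assoc :: "(('x \<times> 'y) \<times> 'z \<Rightarrow> real) \<Rightarrow> 'x \<times> 'y \<times> 'z \<Rightarrow> real" where
  "tensor_assoc T = (\<lambda>(x, y, z). T ((x, y), z))"

lemma pure_tensor_independent:
  fixes v :: "'a \<Rightarrow> 'x \<Rightarrow> real" and w :: "'a \<Rightarrow> 'y \<Rightarrow> real"
  assumes "finite I"
    and indep: "\<And>c. (\<Sum>i\<in>I. c i *\<^sub>R v i) = 0 \<Longrightarrow> \<forall>i\<in>I. c i = 0"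
    and zero: "(\<Sum>i\<in>I. pure_tensor (v i) (w i)) = 0"
  shows "\<forall>i\<in>I. w i = 0"
proof -
  have sum_apply: "(\<Sum>i\<in>I. f i) z = (\<Sum>i\<in>I. f i z)" 
    for f :: "'a \<Rightarrow> 'd \<Rightarrow> real" and z
    using \<open>finite I\<close> by (induction I rule: finite_induct) auto
  have "\<forall>i\<in>I. w i y = 0" for y
  proof (rule indep, rule ext)
    fix x
    have "(\<Sum>i\<in>I. pure_tensor (v i) (w i)) (x, y) = 0"
      by (simp add: zero)
    then show "(\<Sum>i\<in>I. w i y *\<^sub>R v i) x = 0 x"
      by (simp add: sum_apply pure_tensor_def scaleR_fun_def mult.commute)
  qed
  then show ?thesis by (auto simp: fun_eq_iff)
qed

lemma tensor_map_pure_tensor: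
  assumes F: "linear_map V V' F" and G: "linear_map W W' G" and v: "v \<in> V" and w: "w \<in> W"
  shows "tensor_map F G (pure_tensor v w) = pure_tensor (F v) (G w)"
proof -
  have G': "G (\<lambda>y. v x * w y) y' = v x * G w y'" for x y'
  proof -
    have "(\<lambda>y. v x * w y) = v x *\<^sub>R w" by (simp add: scaleR_fun_def)
    then show ?thesis using G w by (simp add: linear_map_def scaleR_fun_def)
  qed
  have F': "F (\<lambda>x. v x * c) x' = F v x' * c" for c x'
  proof -
    have "(\<lambda>x. v x * c) = c *\<^sub>R v" by (simp add: scaleR_fun_def mult.commute)
    then show ?thesis using F v by (simp add: linear_map_def scaleR_fun_def)
  qed
  show ?thesis by (auto simp: tensor_map_def pure_tensor_def G' F')
qed

lemma linear_map_tensor_map: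
  fixes V :: "('x \<Rightarrow> real) set" and W :: "('y \<Rightarrow> real) set"
  assumes F: "linear_map V V' F" and G: "linear_map W W' G" and V: "subspace V" and W: "subspace W"
  shows "linear_map (tensor V W) (tensor V' W') (tensor_map F G)"
proof -
  let ?S = "{pure_tensor v w | v w. v \<in> V \<and> w \<in> W}"
  have slice: "(\<lambda>y. T (x, y)) \<in> W" if "T \<in> tensor V W" for T x
    using that unfolding tensor_def
  proof (induction rule: span_induct)
    case base
    show ?case using W unfolding subspace_def
      by (auto simp: plus_fun_def scaleR_fun_def zero_fun_def)
  next
    case (step T)
    then obtain v w where "T = pure_tensor v w" "w \<in> W" by auto
    then have "(\<lambda>y. T (x, y)) = v x *\<^sub>R w" by (simp add: pure_tensor_def scaleR_fun_def)
    then show ?case using W \<open>w \<in> W\<close> by (simp add: subspace_scale)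
  qed
  have add: "G (\<lambda>y. (T + T') (x, y)) = G (\<lambda>y. T (x, y)) + G (\<lambda>y. T' (x, y))"
    if "T \<in> tensor V W" "T' \<in> tensor V W" for T T' x
    using G slice[OF that(1), of x] slice[OF that(2), of x] unfolding linear_map_def
    by (simp add: plus_fun_def)
  have scale: "G (\<lambda>y. (c *\<^sub>R T) (x, y)) = c *\<^sub>R G (\<lambda>y. T (x, y))"
    if "T \<in> tensor V W" for T c x
    using G slice[OF that(1), of x] unfolding linear_map_def by (simp add: scaleR_fun_def)
  have V0: "(\<lambda>x. G (\<lambda>y. T (x, y)) y') \<in> V" if "T \<in> tensor V W" for T y'
  proof -
    have "T \<in> tensor V W \<and> (\<lambda>x. G (\<lambda>y. T (x, y)) y') \<in> V"
      using that unfolding tensor_def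
    proof (induction rule: span_induct_alt)
      case base
      have "(\<lambda>y::'y. 0::real) \<in> W" using subspace_0[OF W] by (simp add: zero_fun_def)
      then have "G (0 *\<^sub>R (\<lambda>y. 0)) = 0 *\<^sub>R G (\<lambda>y. 0)" using G unfolding linear_map_def by blast
      then have "G (\<lambda>y. 0) = 0" by (simp add: scaleR_fun_def zero_fun_def)
      then have "(\<lambda>x. G (\<lambda>y. (0 :: 'x \<times> 'y \<Rightarrow> real) (x, y)) y') = 0"
        by (simp add: zero_fun_def)
      moreover have "(0 :: 'x \<times> 'y \<Rightarrow> real) \<in> span ?S" by (rule span_zero)
      ultimately show ?case using subspace_0[OF V] by (metis (no_types, lifting))
    next
      case (step c S T)
      then obtain v w where S: "S = pure_tensor v w" "v \<in> V" "w \<in> W" by auto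
      have S': "S \<in> tensor V W" using S unfolding tensor_def by (auto intro: span_base)
      have T': "T \<in> tensor V W" using step unfolding tensor_def by blast
      have cS: "c *\<^sub>R S \<in> tensor V W" using S' unfolding tensor_def by (rule span_scale)
      have "G (\<lambda>y. S (x, y)) = v x *\<^sub>R G w" for x
      proof -
        have "(\<lambda>y. S (x, y)) = v x *\<^sub>R w" by (simp add: S pure_tensor_def scaleR_fun_def)
        then show ?thesis using G S by (simp add: linear_map_def)
      qed
      then have "(\<lambda>x. G (\<lambda>y. (c *\<^sub>R S + T) (x, y)) y')
          = (c * G w y') *\<^sub>R v + (\<lambda>x. G (\<lambda>y. T (x, y)) y')"
        unfolding add[OF cS T'] scale[OF S']
        by (auto simp: scaleR_fun_def plus_fun_def)
      moreover have "\<dots> \<in> V" using step S V by (intro subspace_add subspace_scale) auto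
      moreover have "c *\<^sub>R S + T \<in> tensor V W"
        using cS T' unfolding tensor_def by (rule span_add)
      ultimately show ?case unfolding tensor_def by (metis (no_types, lifting))
    qed
    then show ?thesis by simp
  qed
  have Fadd: "F (\<lambda>x. f x + g x) = F f + F g" if "f \<in> V" "g \<in> V" for f g
    using F that unfolding linear_map_def by (simp add: plus_fun_def)
  have Fscale: "F (\<lambda>x. c * f x) = c *\<^sub>R F f" if "f \<in> V" for c f
  proof -
    have "F (c *\<^sub>R f) = c *\<^sub>R F f" using F that unfolding linear_map_def by blast
    then show ?thesis by (simp add: scaleR_fun_def)
  qed
  have madd: "tensor_map F G (T + T') = tensor_map F G T + tensor_map F G T'"
    if "T \<in> tensor V W" "T' \<in> tensor V W" for T T'
    unfolding tensor_map_def add[OF that]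
    using Fadd[OF V0[OF that(1)] V0[OF that(2)]] by (auto simp: plus_fun_def)
  have mscale: "tensor_map F G (c *\<^sub>R T) = c *\<^sub>R tensor_map F G T"
    if "T \<in> tensor V W" for T c
    unfolding tensor_map_def scale[OF that]
    using Fscale[OF V0[OF that]] by (auto simp: scaleR_fun_def)
  have "tensor_map F G T \<in> tensor V' W'" if "T \<in> tensor V W" for T
  proof -
    have "T \<in> tensor V W \<and> tensor_map F G T \<in> tensor V' W'"
      using that unfolding tensor_def
    proof (induction rule: span_induct_alt)
      case base
      have "0 \<in> tensor V W" unfolding tensor_def by (rule span_zero)
      then have "tensor_map F G 0 = 0" using mscale[of 0 0] by simp
      then show ?case using span_zero by (metis (no_types, lifting))
    next
      case (step c S T)
      then obtain v w where S: "S = pure_tensor v w" "v \<in> V" "w \<in> W" by auto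
      have S': "S \<in> tensor V W" using S unfolding tensor_def by (auto intro: span_base)
      have T': "T \<in> tensor V W" using step unfolding tensor_def by blast
      have cS: "c *\<^sub>R S \<in> tensor V W" using S' unfolding tensor_def by (rule span_scale)
      have "F v \<in> V'" "G w \<in> W'" using F G S by (auto simp: linear_map_def)
      then have "tensor_map F G S \<in> tensor V' W'"
        unfolding S(1) tensor_map_pure_tensor[OF F G S(2,3)] tensor_def
        by (auto intro: span_base)
      then have "tensor_map F G (c *\<^sub>R S + T) \<in> tensor V' W'"
        unfolding madd[OF cS T'] mscale[OF S'] using step
        unfolding tensor_def by (intro span_add span_scale) auto
      moreover have "c *\<^sub>R S + T \<in> tensor V W"
        using cS T' unfolding tensor_def by (rule span_add)
      ultimately show ?case unfolding tensor_def by (metis (no_types, lifting))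
    qed
    then show ?thesis by simp
  qed
  then show ?thesis using madd mscale unfolding linear_map_def by auto
qed

section \<open>Graded spaces, modules and comodules\<close>

text \<open>
  For subspaces \<open>V n\<close> of a space of functions on \<open>'x\<close>, an element \<open>(a\<^sub>n)\<^sub>n\<close> of the direct
  sum of the \<open>V n\<close> is represented by the function \<open>(n, x) \<mapsto> a\<^sub>n x\<close>.
\<close>

definition direct_sum :: "(nat \<Rightarrow> ('x \<Rightarrow> real) set) \<Rightarrow> (nat \<times> 'x \<Rightarrow> real) set" where
  "direct_sum V = {a. (\<forall>n. (\<lambda>x. a (n, x)) \<in> V n) \<and> finite {n. \<exists>x. a (n, x) \<noteq> 0}}"

definition graded_part :: "(nat \<Rightarrow> ('x \<Rightarrow> real) set) \<Rightarrow> nat \<Rightarrow> (nat \<times> 'x \<Rightarrow> real) set" where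
  "graded_part V n = {a \<in> direct_sum V. \<forall>m x. m \<noteq> n \<longrightarrow> a (m, x) = 0}"

definition tensor_graded_part ::
  "(nat \<Rightarrow> ('x \<Rightarrow> real) set) \<Rightarrow> (nat \<Rightarrow> ('y \<Rightarrow> real) set) \<Rightarrow> nat \<Rightarrow>
   ((nat \<times> 'x) \<times> (nat \<times> 'y) \<Rightarrow> real) set" where
  "tensor_graded_part V W n =
     span (\<Union>(i, j)\<in>{(i, j). i + j = n}. tensor (graded_part V i) (graded_part W j))"

definition graded_module ::
  "(nat \<Rightarrow> ('x \<Rightarrow> real) set) \<Rightarrow>
   (((nat \<times> 'x) \<times> (nat \<times> 'x) \<Rightarrow> real) \<Rightarrow> nat \<times> 'x \<Rightarrow> real) \<Rightarrow>
   (nat \<times> 'x \<Rightarrow> real) \<Rightarrow>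
   (nat \<Rightarrow> ('y \<Rightarrow> real) set) \<Rightarrow>
   (((nat \<times> 'x) \<times> (nat \<times> 'y) \<Rightarrow> real) \<Rightarrow> nat \<times> 'y \<Rightarrow> real) \<Rightarrow> bool" where
  "graded_module V mul e W act \<longleftrightarrow>
     linear_map (tensor (direct_sum V) (direct_sum W)) (direct_sum W) act
     \<and> (\<forall>n. act ` tensor_graded_part V W n \<subseteq> graded_part W n)
     \<and> (\<forall>a\<in>direct_sum V. \<forall>a'\<in>direct_sum V. \<forall>b\<in>direct_sum W.
          act (tensor_map mul id (pure_tensor (pure_tensor a a') b))
            = act (tensor_map id act (pure_tensor a (pure_tensor a' b))))
     \<and> (\<forall>b\<in>direct_sum W. act (pure_tensor e b) = b)"

text \<open>
  In the counit law, \<open>\<lambda>y. counit (\<lambda>x. T (x, y))\<close> is the image of \<open>T\<close> under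
  \<open>counit \<otimes> id\<close> followed by the canonical isomorphism from \<open>\<real> \<otimes> B\<close> to \<open>B\<close>.
\<close>

definition graded_comodule ::
  "(nat \<Rightarrow> ('x \<Rightarrow> real) set) \<Rightarrow>
   ((nat \<times> 'x \<Rightarrow> real) \<Rightarrow> (nat \<times> 'x) \<times> (nat \<times> 'x) \<Rightarrow> real) \<Rightarrow>
   ((nat \<times> 'x \<Rightarrow> real) \<Rightarrow> real) \<Rightarrow>
   (nat \<Rightarrow> ('y \<Rightarrow> real) set) \<Rightarrow>
   ((nat \<times> 'y \<Rightarrow> real) \<Rightarrow> (nat \<times> 'x) \<times> (nat \<times> 'y) \<Rightarrow> real) \<Rightarrow> bool" where
  "graded_comodule V comult counit W coact \<longleftrightarrow>
     linear_map (direct_sum W) (tensor (direct_sum V) (direct_sum W)) coact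
     \<and> (\<forall>n. coact ` graded_part W n \<subseteq> tensor_graded_part V W n)
     \<and> (\<forall>b\<in>direct_sum W.
          tensor_assoc (tensor_map comult id (coact b)) = tensor_map id coact (coact b))
     \<and> (\<forall>b\<in>direct_sum W. (\<lambda>y. counit (\<lambda>x. coact b (x, y))) = b)"

section \<open>Matrix groups and their Lie algebras\<close>

definition adj :: "nat \<Rightarrow> 'a::field mat \<Rightarrow> 'a mat" where
  "adj q A = mat (dim_col A) (dim_row A) (\<lambda>(r, s). (A $$ (s, r)) ^ q)"

definition J :: "nat \<Rightarrow> 'a::field mat" where
  "J m = mat m m (\<lambda>(r, s). if r + s + 1 = m then 1 else 0)"

definition GL :: "nat \<Rightarrow> 'a::field mat set" where
  "GL n = {g \<in> carrier_mat n n. invertible_mat g}"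

definition gl :: "nat \<Rightarrow> 'a::field mat set" where
  "gl n = carrier_mat n n"

text \<open>
  \<open>m\<close> is the size of the matrices and the field is meant to have \<open>q\<^sup>2\<close> elements:
  \<open>U q (2 * n)\<close> and \<open>\<uu> q (2 * n)\<close> are the groups and Lie algebras of interest.
\<close>

definition U :: "nat \<Rightarrow> nat \<Rightarrow> 'a::field mat set" where
  "U q m = {g \<in> GL m. adj q g * J m * g = J m}"

definition \<uu> :: "nat \<Rightarrow> nat \<Rightarrow> 'a::field mat set" where
  "\<uu> q m = {X \<in> gl m. adj q X * J m + J m * X = 0\<^sub>m m m}"

definition conjugate_by :: "'a::field mat \<Rightarrow> 'a mat \<Rightarrow> 'a mat" where
  "conjugate_by g X = the (mat_inverse g) * X * g"

text \<open>Functions on a Lie algebra are extended by zero to all matrices.\<close>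

definition class_functions :: "'a::field mat set \<Rightarrow> 'a mat set \<Rightarrow> ('a mat \<Rightarrow> real) set" where
  "class_functions G \<G> =
     {f. (\<forall>X. X \<notin> \<G> \<longrightarrow> f X = 0) \<and> (\<forall>g\<in>G. \<forall>X\<in>\<G>. f (conjugate_by g X) = f X)}"

definition Agr :: "nat \<Rightarrow> ('a::field mat \<Rightarrow> real) set" where
  "Agr n = class_functions (GL n) (gl n)"

definition Bgr :: "nat \<Rightarrow> nat \<Rightarrow> ('a::field mat \<Rightarrow> real) set" where
  "Bgr q n = class_functions (U q (2 * n)) (\<uu> q (2 * n))"

section \<open>Parabolic restriction and induction\<close>

text \<open>
  \<open>\<G>\<close> is the Lie algebra of \<open>G\<close>, \<open>P\<close> the parabolic subgroup, \<open>\<L>\<close> the Levi part and \<open>\<U>\<close>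
  the nilradical of the Lie algebra of \<open>P\<close>. The sum over representatives of left cosets in
  \<open>par_ind\<close> uses the representative picked by \<open>SOME\<close>; the choice is irrelevant when \<open>\<Phi>\<close> is
  invariant under the Levi subgroup.
\<close>

definition par_res ::
  "'a::field mat set \<Rightarrow> 'a mat set \<Rightarrow> ('a mat \<Rightarrow> real) \<Rightarrow> 'a mat \<Rightarrow> real" where
  "par_res \<L> \<U> \<Psi> =
     (\<lambda>Y. if Y \<in> \<L> then (\<Sum>Z\<in>\<U>. \<Psi> (Y + Z)) / real (card \<U>) else 0)"

definition inflate ::
  "'a::field mat set \<Rightarrow> 'a mat set \<Rightarrow> ('a mat \<Rightarrow> real) \<Rightarrow> 'a mat \<Rightarrow> real" where
  "inflate \<L> \<U> \<Phi> X =
     (if \<exists>Y\<in>\<L>. \<exists>Z\<in>\<U>. X = Y + Z then \<Phi> (THE Y. Y \<in> \<L> \<and> (\<exists>Z\<in>\<U>. X = Y + Z)) else 0)"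

definition left_cosets :: "'a::field mat set \<Rightarrow> 'a mat set \<Rightarrow> 'a mat set set" where
  "left_cosets G P = (\<lambda>g. (\<lambda>p. g * p) ` P) ` G"

definition par_ind ::
  "'a::field mat set \<Rightarrow> 'a mat set \<Rightarrow> 'a mat set \<Rightarrow> 'a mat set \<Rightarrow> 'a mat set \<Rightarrow>
   ('a mat \<Rightarrow> real) \<Rightarrow> 'a mat \<Rightarrow> real" where
  "par_ind G P \<G> \<L> \<U> \<Phi> =
     (\<lambda>X. if X \<in> \<G>
          then (\<Sum>C\<in>left_cosets G P. inflate \<L> \<U> \<Phi> (conjugate_by (SOME g. g \<in> C) X))
          else 0)"

text \<open>
  \<open>block_index ns r\<close> is the index of the block containing the row (or column) \<open>r\<close>, for blocks
  of sizes \<open>ns\<close> (which may be zero).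
\<close>

fun block_index :: "nat list \<Rightarrow> nat \<Rightarrow> nat" where
  "block_index [] r = 0"
| "block_index (m # ms) r = (if r < m then 0 else Suc (block_index ms (r - m)))"

definition block_upper :: "nat list \<Rightarrow> 'a::field mat \<Rightarrow> bool" where
  "block_upper ns M \<longleftrightarrow> (\<forall>r<dim_row M. \<forall>s<dim_col M.
     block_index ns s < block_index ns r \<longrightarrow> M $$ (r, s) = 0)"

definition strictly_block_upper :: "nat list \<Rightarrow> 'a::field mat \<Rightarrow> bool" where
  "strictly_block_upper ns M \<longleftrightarrow> (\<forall>r<dim_row M. \<forall>s<dim_col M.
     block_index ns s \<le> block_index ns r \<longrightarrow> M $$ (r, s) = 0)"

text \<open>Transport of functions along a bijection from \<open>S\<close> onto its image.\<close>

definition pull :: "'x set \<Rightarrow> ('x \<Rightarrow> 'y) \<Rightarrow> ('y \<Rightarrow> real) \<Rightarrow> 'x \<Rightarrow> real" where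
  "pull S \<iota> \<Phi> = (\<lambda>x. if x \<in> S then \<Phi> (\<iota> x) else 0)"

definition push :: "'x set \<Rightarrow> ('x \<Rightarrow> 'y) \<Rightarrow> ('x \<Rightarrow> real) \<Rightarrow> 'y \<Rightarrow> real" where
  "push S \<iota> T = (\<lambda>y. if y \<in> \<iota> ` S then T (the_inv_into S \<iota> y) else 0)"

section \<open>The bialgebra structure maps of \<open>A\<close>\<close>

definition P_gl :: "nat \<Rightarrow> nat \<Rightarrow> 'a::field mat set" where
  "P_gl i j = {g \<in> GL (i + j). block_upper [i, j] g}"

definition nil_gl :: "nat \<Rightarrow> nat \<Rightarrow> 'a::field mat set" where
  "nil_gl i j = {Z \<in> gl (i + j). strictly_block_upper [i, j] Z}"

definition embed_gl :: "'a::field mat \<times> 'a mat \<Rightarrow> 'a mat" where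
  "embed_gl = (\<lambda>(A, B). diag_block_mat [A, B])"

definition levi_gl :: "nat \<Rightarrow> nat \<Rightarrow> 'a::field mat set" where
  "levi_gl i j = embed_gl ` (gl i \<times> gl j)"

definition ind_gl ::
  "nat \<Rightarrow> nat \<Rightarrow> ('a::field mat \<times> 'a mat \<Rightarrow> real) \<Rightarrow> 'a mat \<Rightarrow> real" where
  "ind_gl i j T =
     par_ind (GL (i + j)) (P_gl i j) (gl (i + j)) (levi_gl i j) (nil_gl i j)
       (push (gl i \<times> gl j) embed_gl T)"

definition res_gl ::
  "nat \<Rightarrow> nat \<Rightarrow> ('a::field mat \<Rightarrow> real) \<Rightarrow> 'a mat \<times> 'a mat \<Rightarrow> real" where
  "res_gl i j \<Psi> = pull (gl i \<times> gl j) embed_gl (par_res (levi_gl i j) (nil_gl i j) \<Psi>)"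

definition nabla ::
  "((nat \<times> 'a::field mat) \<times> (nat \<times> 'a mat) \<Rightarrow> real) \<Rightarrow> nat \<times> 'a mat \<Rightarrow> real" where
  "nabla T = (\<lambda>(n, X). \<Sum>(i, j)\<in>{(i, j). i + j = n}.
     ind_gl i j (\<lambda>(A, B). T ((i, A), (j, B))) X)"

definition Delta ::
  "(nat \<times> 'a::field mat \<Rightarrow> real) \<Rightarrow> (nat \<times> 'a mat) \<times> (nat \<times> 'a mat) \<Rightarrow> real" where
  "Delta a = (\<lambda>((i, A), (j, B)). res_gl i j (\<lambda>X. a (i + j, X)) (A, B))"

text \<open>\<open>gl 0\<close> consists of the empty matrix only.\<close>

definition unit_A :: "nat \<times> 'a::field mat \<Rightarrow> real" where
  "unit_A = (\<lambda>(n, X). if n = 0 \<and> X \<in> gl 0 then 1 else 0)"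

definition counit_A :: "(nat \<times> 'a::field mat \<Rightarrow> real) \<Rightarrow> real" where
  "counit_A a = a (0, 0\<^sub>m 0 0)"

section \<open>The action and coaction on \<open>B\<close>\<close>

definition P_u :: "nat \<Rightarrow> nat \<Rightarrow> nat \<Rightarrow> 'a::field mat set" where
  "P_u q i j = {g \<in> U q (2 * (i + j)). block_upper [i, 2 * j, i] g}"

definition nil_u :: "nat \<Rightarrow> nat \<Rightarrow> nat \<Rightarrow> 'a::field mat set" where
  "nil_u q i j = {Z \<in> \<uu> q (2 * (i + j)). strictly_block_upper [i, 2 * j, i] Z}"

definition embed_u :: "nat \<Rightarrow> nat \<Rightarrow> 'a::field mat \<times> 'a mat \<Rightarrow> 'a mat" where
  "embed_u q i = (\<lambda>(A, B). diag_block_mat [A, B, - (J i * adj q A * J i)])"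

definition levi_u :: "nat \<Rightarrow> nat \<Rightarrow> nat \<Rightarrow> 'a::field mat set" where
  "levi_u q i j = embed_u q i ` (gl i \<times> \<uu> q (2 * j))"

definition ind_u ::
  "nat \<Rightarrow> nat \<Rightarrow> nat \<Rightarrow> ('a::field mat \<times> 'a mat \<Rightarrow> real) \<Rightarrow> 'a mat \<Rightarrow> real" where
  "ind_u q i j T =
     par_ind (U q (2 * (i + j))) (P_u q i j) (\<uu> q (2 * (i + j))) (levi_u q i j) (nil_u q i j)
       (push (gl i \<times> \<uu> q (2 * j)) (embed_u q i) T)"

definition res_u ::
  "nat \<Rightarrow> nat \<Rightarrow> nat \<Rightarrow> ('a::field mat \<Rightarrow> real) \<Rightarrow> 'a mat \<times> 'a mat \<Rightarrow> real" where
  "res_u q i j \<Psi> =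
     pull (gl i \<times> \<uu> q (2 * j)) (embed_u q i) (par_res (levi_u q i j) (nil_u q i j) \<Psi>)"

definition nabla_u ::
  "nat \<Rightarrow> ((nat \<times> 'a::field mat) \<times> (nat \<times> 'a mat) \<Rightarrow> real) \<Rightarrow> nat \<times> 'a mat \<Rightarrow> real" where
  "nabla_u q T = (\<lambda>(n, X). \<Sum>(i, j)\<in>{(i, j). i + j = n}.
     ind_u q i j (\<lambda>(A, B). T ((i, A), (j, B))) X)"

definition Delta_u ::
  "nat \<Rightarrow> (nat \<times> 'a::field mat \<Rightarrow> real) \<Rightarrow> (nat \<times> 'a mat) \<times> (nat \<times> 'a mat) \<Rightarrow> real" where
  "Delta_u q b = (\<lambda>((i, A), (j, B)). res_u q i j (\<lambda>X. b (i + j, X)) (A, B))"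

end

theory Submission
  imports Defs "HOL-Number_Theory.Residues" "Jordan_Normal_Form.Determinant"
begin

text \<open>
  Associativity and coassociativity hold because each of the four composites is an induction or a
  restriction for one and the same finer parabolic subgroup, namely the subgroup of
  \<open>U q (2 * (i + j + k))\<close> that is block upper triangular for the block sizes \<open>i, j, 2 * k, j, i\<close>.
  To see this, the representatives and embeddings in the definitions are first removed.

  A diagonal block of a matrix is called a window. On block upper triangular matrices the passage
  to a window is multiplicative (\<open>window_mult\<close>), and so it commutes with conjugation. In a unitary
  group and its Lie algebra the adjoint \<open>J M\<^sup>* J\<close> reflects a matrix in its antidiagonal. Therefore
  the block boundaries of a matrix are symmetric, being block upper triangular for the sizes
  \<open>i, 2 * j, i\<close> is the single condition \<open>upper_at i\<close>, and the third diagonal block is determined by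
  the first. With this, the parabolic subgroups of the general linear and the unitary groups both
  become instances of one locale \<open>parabolic\<close>, where the Levi components are the two windows at
  \<open>0\<close> and \<open>i\<close>.

  In this setting the restriction of \<open>f\<close> at \<open>(A, B)\<close> is the mean of \<open>f\<close> over all block upper
  triangular matrices with the windows \<open>A\<close> and \<open>B\<close> (\<open>restriction_eq\<close>). A mean over equally large
  fibres of means is again a mean, and the two ways of restricting in stages are means over the same
  set (\<open>res_coassociative\<close>).

  The induction of an invariant function \<open>T\<close> at \<open>X\<close> is the sum of \<open>T\<close> at the windows of
  \<open>g\<^sup>-\<^sup>1 X g\<close>, extended by zero, over all \<open>g\<close> in the group, divided by the order of the
  parabolic subgroup (\<open>ind_eq\<close>). An inner sum over a Levi factor can be lifted to the parabolic
  subgroup and absorbed by translating the outer variable (\<open>sum_spread_average_left\<close>,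
  \<open>sum_spread_average_right\<close>). What is left on both sides of the associativity law is a sum over
  the whole unitary group, and the normalising factors agree by counting preimages under the
  projections to the Levi factors (\<open>card_window_0\<close>, \<open>card_window_i\<close>).

  Finally, the coaction takes its values in the algebraic tensor product because a function that
  is a class function in each of two variables is a finite combination of products of orbit averages
  (\<open>graded_tensor_expansion\<close>). The grading and the unit laws are read off from the components.
\<close>

section \<open>The Frobenius automorphism\<close>

text \<open>
  Multiplication by \<open>x \<noteq> 0\<close> permutes the nonzero elements of the field; comparing their product
  before and after gives \<open>x ^ (N - 1) = 1\<close>.
\<close>

lemma finite_field_power_card:
  fixes x :: "'a::{finite,field}"
  shows "x ^ card (UNIV :: 'a set) = x"
proof (cases "x = 0")
  case False
  let ?N = "card (UNIV - {0 :: 'a})"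
  have N: "card (UNIV :: 'a set) = Suc ?N"
    using card_Suc_Diff1[of "UNIV :: 'a set" 0] by simp
  have "x ^ ?N * \<Prod>(UNIV - {0}) = (\<Prod>y\<in>UNIV - {0}. x * y)"
    by (simp add: prod.distrib)
  also have "\<dots> = \<Prod>(UNIV - {0})"
    by (rule prod.reindex_bij_witness[of _ "\<lambda>y. y / x" "\<lambda>y. x * y"]) (use False in auto)
  finally have "x ^ ?N = 1"
    by simp
  then show ?thesis unfolding N by simp
qed (simp add: card_gt_0_iff)

text \<open>
  Since \<open>q\<^sup>2\<close> is divisible by the characteristic, \<open>q\<close> is a power of it, which makes
  \<open>x \<mapsto> x ^ q\<close> additive. Its square is \<open>x \<mapsto> x ^ N\<close> for the number \<open>N\<close> of elements of the field.
\<close>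

lemma frobenius_square_field:
  fixes x y :: "'a::{finite,field}"
  assumes q: "primepow q" and card: "card (UNIV :: 'a set) = q\<^sup>2"
  shows "(x + y) ^ q = x ^ q + y ^ q" and "(x ^ q) ^ q = x"
proof -
  obtain p k where p: "prime p" "q = p ^ k"
    using q by (auto simp: primepow_def)
  have "CHAR('a) > 0"
    by (rule finite_imp_CHAR_pos) simp
  then have C: "prime CHAR('a)"
    by (rule prime_CHAR_semidom)
  have "CHAR('a) dvd p ^ (k * 2)"
    using CHAR_dvd_CARD[where 'a = 'a] by (simp add: card p power_mult)
  then have "CHAR('a) = p"
    using C p prime_dvd_power primes_dvd_imp_eq by blast
  then show "(x + y) ^ q = x ^ q + y ^ q"
    using C p by (intro freshmans_dream') auto
  show "(x ^ q) ^ q = x"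
    using finite_field_power_card[of x] by (simp add: card power_mult power2_eq_square)
qed

section \<open>Windows of block upper triangular matrices\<close>

text \<open>
  \<open>upper_at t M\<close> says that \<open>M\<close> preserves the span of the first \<open>t\<close> basis vectors. Block upper
  triangularity is the conjunction of these conditions over the block boundaries \<open>t\<close>; treating the
  boundaries one at a time makes it easy to refine a flag.
\<close>

definition upper_at :: "nat \<Rightarrow> 'a::zero mat \<Rightarrow> bool" where
  "upper_at t M \<longleftrightarrow> (\<forall>r<dim_row M. \<forall>s<dim_col M. s < t \<and> t \<le> r \<longrightarrow> M $$ (r, s) = 0)"

definition window :: "nat \<Rightarrow> nat \<Rightarrow> 'a mat \<Rightarrow> 'a mat" where
  "window l m M = mat m m (\<lambda>(r, s). M $$ (l + r, l + s))"

lemma window_carrier [simp]: "window l m M \<in> carrier_mat m m"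
  by (simp add: window_def)

lemma window_dim [simp]: "dim_row (window l m M) = m" "dim_col (window l m M) = m"
  by (simp_all add: window_def)

lemma window_index [simp]:
  "r < m \<Longrightarrow> s < m \<Longrightarrow> window l m M $$ (r, s) = M $$ (l + r, l + s)"
  by (simp add: window_def)

lemma window_window: "a + b \<le> m \<Longrightarrow> window a b (window l m M) = window (l + a) b M"
  by (rule eq_matI) (auto simp: add.assoc)

lemma window_full: "M \<in> carrier_mat n n \<Longrightarrow> window 0 n M = M"
  by (rule eq_matI) auto

lemma window_one [simp]: "l + m \<le> n \<Longrightarrow> window l m (1\<^sub>m n) = 1\<^sub>m m"
  by (rule eq_matI) auto

lemma window_add:
  "X \<in> carrier_mat n n \<Longrightarrow> Y \<in> carrier_mat n n \<Longrightarrow> l + m \<le> n \<Longrightarrow>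
    window l m (X + Y) = window l m X + window l m Y"
  by (rule eq_matI) auto

lemma window_uminus:
  "X \<in> carrier_mat n n \<Longrightarrow> l + m \<le> n \<Longrightarrow> window l m (- X) = - window l m X"
  by (rule eq_matI) auto

lemma mult_mat_index:
  assumes "X \<in> carrier_mat n k" "Y \<in> carrier_mat k m" "r < n" "s < m"
  shows "(X * Y) $$ (r, s) = (\<Sum>t<k. X $$ (r, t) * Y $$ (t, s))"
  using assms by (simp add: scalar_prod_def lessThan_atLeast0)

text \<open>
  In an entry of the product whose row and column lie in the window, the intermediate indices to the
  left of the window are killed by \<open>X\<close> and those to its right by \<open>Y\<close>. Hence the passage to a
  diagonal block is multiplicative on block upper triangular matrices.
\<close>

lemma window_mult:
  fixes X Y :: "'a::semiring_0 mat"
  assumes X: "X \<in> carrier_mat n n" "upper_at l X" and Y: "Y \<in> carrier_mat n n" "upper_at (l + m) Y"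
    and le: "l + m \<le> n"
  shows "window l m (X * Y) = window l m X * window l m Y"
proof (rule eq_matI)
  fix r s assume "r < dim_row (window l m X * window l m Y)" "s < dim_col (window l m X * window l m Y)"
  then have rs: "r < m" "s < m" by auto
  have z: "X $$ (l + r, t) * Y $$ (t, l + s) = 0" if "t < n" "t \<notin> {l..<l + m}" for t
  proof (cases "t < l")
    case True
    then have "X $$ (l + r, t) = 0" using X le rs that by (auto simp: upper_at_def)
    then show ?thesis by simp
  next
    case False
    then have "Y $$ (t, l + s) = 0" using Y le rs that by (auto simp: upper_at_def)
    then show ?thesis by simp
  qed
  have "(X * Y) $$ (l + r, l + s) = (\<Sum>t<n. X $$ (l + r, t) * Y $$ (t, l + s))"
    using X Y rs le by (intro mult_mat_index) auto
  also have "\<dots> = (\<Sum>t\<in>{l..<l + m}. X $$ (l + r, t) * Y $$ (t, l + s))"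
    using le z by (intro sum.mono_neutral_right) auto
  also have "\<dots> = (\<Sum>t<m. X $$ (l + r, l + t) * Y $$ (l + t, l + s))"
    by (rule sum.reindex_bij_witness[of _ "\<lambda>t. l + t" "\<lambda>t. t - l"]) auto
  also have "\<dots> = (\<Sum>t<m. window l m X $$ (r, t) * window l m Y $$ (t, s))"
    using rs by (intro sum.cong) auto
  also have "\<dots> = (window l m X * window l m Y) $$ (r, s)"
    using rs by (intro mult_mat_index[symmetric]) auto
  finally show "window l m (X * Y) $$ (r, s) = (window l m X * window l m Y) $$ (r, s)"
    using rs by simp
qed auto

lemma upper_at_mult:
  fixes X Y :: "'a::semiring_0 mat"
  assumes X: "X \<in> carrier_mat n n" "upper_at t X" and Y: "Y \<in> carrier_mat n n" "upper_at t Y"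
  shows "upper_at t (X * Y)"
  unfolding upper_at_def
proof safe
  fix r s assume "r < dim_row (X * Y)" "s < dim_col (X * Y)" and st: "s < t" "t \<le> r"
  then have rs: "r < n" "s < n" using X Y by auto
  have "(X * Y) $$ (r, s) = (\<Sum>k<n. X $$ (r, k) * Y $$ (k, s))"
    using X Y rs by (intro mult_mat_index) auto
  also have "\<dots> = 0"
  proof (rule sum.neutral, safe)
    fix k assume "k < n"
    show "X $$ (r, k) * Y $$ (k, s) = 0"
    proof (cases "k < t")
      case True then show ?thesis using X st rs \<open>k < n\<close> by (auto simp: upper_at_def)
    next
      case False then show ?thesis using Y st rs \<open>k < n\<close> by (auto simp: upper_at_def)
    qed
  qed
  finally show "(X * Y) $$ (r, s) = 0" .
qed

lemma upper_at_one: "upper_at t (1\<^sub>m n)"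
  by (auto simp: upper_at_def)

lemma upper_at_0 [simp]: "upper_at 0 M"
  by (auto simp: upper_at_def)

lemma upper_at_full: "M \<in> carrier_mat n m \<Longrightarrow> upper_at n M"
  by (auto simp: upper_at_def)

lemma upper_at_add:
  "X \<in> carrier_mat n n \<Longrightarrow> Y \<in> carrier_mat n n \<Longrightarrow> upper_at t X \<Longrightarrow> upper_at t Y \<Longrightarrow>
    upper_at t (X + Y :: 'a::monoid_add mat)"
  by (auto simp: upper_at_def)

lemma upper_at_window:
  assumes M: "M \<in> carrier_mat n n" "upper_at l M" "upper_at (l + m) M" and le: "l + m \<le> n" "t \<le> m"
  shows "upper_at t (window l m M) \<longleftrightarrow> upper_at (l + t) M"
proof
  assume *: "upper_at t (window l m M)"
  show "upper_at (l + t) M"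
    unfolding upper_at_def
  proof safe
    fix r s assume rs: "r < dim_row M" "s < dim_col M" "s < l + t" "l + t \<le> r"
    show "M $$ (r, s) = 0"
    proof (cases "s < l \<or> l + m \<le> r")
      case True
      then show ?thesis using M rs le by (auto simp: upper_at_def)
    next
      case False
      then obtain r' s' where rs': "r = l + r'" "s = l + s'"
        by (metis le_Suc_ex le_trans le_add1 not_less rs(4))
      then have "r' < m" "s' < m" "s' < t" "t \<le> r'"
        using rs le False by auto
      then have "window l m M $$ (r', s') = 0"
        using * unfolding upper_at_def by simp
      then show ?thesis using rs' \<open>r' < m\<close> \<open>s' < m\<close> by simp
    qed
  qed
next
  assume "upper_at (l + t) M"
  then show "upper_at t (window l m M)"
    using M le by (auto simp: upper_at_def)
qed

lemma block_upper_2: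
  "M \<in> carrier_mat (i + j) (i + j) \<Longrightarrow> block_upper [i, j] M \<longleftrightarrow> upper_at i M"
  by (auto simp: block_upper_def upper_at_def)

lemma block_upper_3:
  "M \<in> carrier_mat (i + j + k) (i + j + k) \<Longrightarrow>
    block_upper [i, j, k] M \<longleftrightarrow> upper_at i M \<and> upper_at (i + j) M"
proof -
  assume M: "M \<in> carrier_mat (i + j + k) (i + j + k)"
  have "block_index [i, j, k] s < block_index [i, j, k] r \<longleftrightarrow>
      s < i \<and> i \<le> r \<or> s < i + j \<and> i + j \<le> r"
    if "r < i + j + k" for r s
    using that by auto
  then show ?thesis
    using M unfolding block_upper_def upper_at_def by (simp del: block_index.simps) blast
qed

section \<open>Finite matrix groups\<close>

abbreviation minv :: "'a::field mat \<Rightarrow> 'a mat" where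
  "minv g \<equiv> the (mat_inverse g)"

lemma GL_carrier: "g \<in> GL n \<Longrightarrow> g \<in> carrier_mat n n"
  by (simp add: GL_def)

lemma GL_I:
  assumes "A \<in> carrier_mat n n" "B \<in> carrier_mat n n" "A * B = 1\<^sub>m n"
  shows "A \<in> GL n"
proof -
  have "B * A = 1\<^sub>m n" by (rule mat_mult_left_right_inverse[OF assms])
  then show ?thesis using assms by (auto simp: GL_def invertible_mat_def inverts_mat_def)
qed

text \<open>
  Translates between invertibility and the result of Gauss-Jordan elimination, by which
  conjugation is defined.
\<close>

lemma minv_props:
  assumes g: "g \<in> GL n"
  shows "minv g \<in> carrier_mat n n" "g * minv g = 1\<^sub>m n" "minv g * g = 1\<^sub>m n"
proof -
  obtain B where B: "g * B = 1\<^sub>m n" "B * g = 1\<^sub>m (dim_row B)"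
    using g by (auto simp: GL_def invertible_mat_def inverts_mat_def)
  have c: "g \<in> carrier_mat n n" using g by (rule GL_carrier)
  have "dim_col (B * g) = n" using c by simp
  then have "dim_row B = n" using B(2) by (metis index_one_mat(3))
  moreover have "dim_col B = n" using B(1) by (metis index_mult_mat(3) index_one_mat(3))
  ultimately have Bc: "B \<in> carrier_mat n n" by auto
  have "g \<in> Units (ring_mat TYPE('a) n ())"
    using c Bc B by (auto simp: Units_def ring_mat_def)
  then obtain B' where "mat_inverse g = Some B'"
    using mat_inverse(1)[OF c, of "()"] by (cases "mat_inverse g") auto
  then show "minv g \<in> carrier_mat n n" "g * minv g = 1\<^sub>m n" "minv g * g = 1\<^sub>m n"
    using mat_inverse(2)[OF c] by auto
qed

lemma minv_eq:
  assumes g: "g \<in> carrier_mat n n" and B: "B \<in> carrier_mat n n" "g * B = 1\<^sub>m n"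
  shows "minv g = B"
proof -
  have G: "g \<in> GL n" using assms by (rule GL_I)
  note m = minv_props[OF G]
  have "minv g = minv g * (g * B)" using B m by simp
  also have "\<dots> = minv g * g * B" using m g B by (intro assoc_mult_mat[symmetric]) auto
  also have "\<dots> = B" using m B by simp
  finally show ?thesis .
qed

lemma minv_GL: "g \<in> GL n \<Longrightarrow> minv g \<in> GL n"
  using minv_props[of g n] GL_carrier[of g n] by (intro GL_I[of "minv g" n g]) auto

lemma one_GL: "1\<^sub>m n \<in> GL n"
  by (rule GL_I[of _ _ "1\<^sub>m n"]) auto

lemma minv_one: "minv (1\<^sub>m n) = 1\<^sub>m n"
  by (rule minv_eq) auto

lemma minv_minv: "g \<in> GL n \<Longrightarrow> minv (minv g) = g"
  by (rule minv_eq[of _ n]) (auto simp: minv_props GL_carrier)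

lemma mult_minv_cancel:
  assumes "g \<in> GL n" "h \<in> GL n"
  shows "(g * h) * (minv h * minv g) = 1\<^sub>m n"
proof -
  note c = GL_carrier[OF assms(1)] GL_carrier[OF assms(2)]
  note g = minv_props[OF assms(1)] and h = minv_props[OF assms(2)]
  have "(g * h) * (minv h * minv g) = g * (h * (minv h * minv g))"
    using c g h by (intro assoc_mult_mat) auto
  also have "h * (minv h * minv g) = h * minv h * minv g"
    using c g h by (intro assoc_mult_mat[symmetric]) auto
  finally show ?thesis using c g h by simp
qed

lemma mult_GL:
  assumes "g \<in> GL n" "h \<in> GL n"
  shows "g * h \<in> GL n"
  using assms minv_props(1)[of g n] minv_props(1)[of h n] GL_carrier[of g n] GL_carrier[of h n]
  by (intro GL_I[OF _ _ mult_minv_cancel[of g n h]]) auto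

lemma minv_mult: "g \<in> GL n \<Longrightarrow> h \<in> GL n \<Longrightarrow> minv (g * h) = minv h * minv g"
  by (rule minv_eq[OF _ _ mult_minv_cancel])
    (auto intro!: mult_carrier_mat dest: minv_props(1) GL_carrier)

lemma conjugate_by_carrier:
  "g \<in> GL n \<Longrightarrow> X \<in> carrier_mat n n \<Longrightarrow> conjugate_by g X \<in> carrier_mat n n"
  unfolding conjugate_by_def using minv_props(1)[of g n] GL_carrier[of g n] by auto

lemma conjugate_by_one: "X \<in> carrier_mat n n \<Longrightarrow> conjugate_by (1\<^sub>m n) X = X"
  by (simp add: conjugate_by_def minv_one)

lemma conjugate_by_mult:
  assumes "g \<in> GL n" "h \<in> GL n" "X \<in> carrier_mat n n"
  shows "conjugate_by (g * h) X = conjugate_by h (conjugate_by g X)"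
proof -
  note c = GL_carrier[OF assms(1)] GL_carrier[OF assms(2)] assms(3)
    minv_props(1)[OF assms(1)] minv_props(1)[OF assms(2)]
  then show ?thesis
    by (simp add: conjugate_by_def minv_mult[OF assms(1,2)] assoc_mult_mat[of _ n n _ n _ n]
        mult_carrier_mat[of _ n n _ n])
qed

lemma conjugate_by_minv_cancel:
  assumes "g \<in> GL n" "X \<in> carrier_mat n n"
  shows "conjugate_by (minv g) (conjugate_by g X) = X" "conjugate_by g (conjugate_by (minv g) X) = X"
  using conjugate_by_mult[of g n "minv g" X] conjugate_by_mult[of "minv g" n g X]
    minv_GL[OF assms(1)] assms minv_props[OF assms(1)] conjugate_by_one[of X n] by auto

lemma finite_carrier_mat: "finite (carrier_mat m n :: 'a::finite mat set)"
proof -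
  have "carrier_mat m n \<subseteq> (\<lambda>f. mat m n f) ` (({..<m} \<times> {..<n}) \<rightarrow>\<^sub>E (UNIV :: 'a set))"
  proof
    fix A :: "'a mat" assume A: "A \<in> carrier_mat m n"
    have "A = mat m n (restrict (($$) A) ({..<m} \<times> {..<n}))"
      by (rule eq_matI) (use A in auto)
    then show "A \<in> (\<lambda>f. mat m n f) ` (({..<m} \<times> {..<n}) \<rightarrow>\<^sub>E (UNIV :: 'a set))"
      by (auto intro!: image_eqI)
  qed
  moreover have "finite (({..<m} \<times> {..<n}) \<rightarrow>\<^sub>E (UNIV :: 'a set))"
    by (intro finite_PiE) auto
  ultimately show ?thesis by (meson finite_imageI finite_subset)
qed

text \<open>
  In a finite set of invertible matrices closure under inverses follows from closure under products
  (lemma \<open>minv_mem\<close>).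
\<close>

locale matrix_group =
  fixes n :: nat and G :: "'a::{finite,field} mat set"
  assumes GL: "G \<subseteq> GL n"
    and one_mem: "1\<^sub>m n \<in> G"
    and mult_mem: "g \<in> G \<Longrightarrow> h \<in> G \<Longrightarrow> g * h \<in> G"
begin

lemma finite_G: "finite G"
  by (rule finite_subset[OF _ finite_carrier_mat[of n n]]) (use GL GL_carrier in auto)

lemma card_pos: "card G > 0"
  using finite_G one_mem by (auto simp: card_gt_0_iff)

lemma mem_GL: "g \<in> G \<Longrightarrow> g \<in> GL n" and mem_carrier: "g \<in> G \<Longrightarrow> g \<in> carrier_mat n n"
  using GL GL_carrier by auto

lemma cancel_left: "g \<in> GL n \<Longrightarrow> X \<in> carrier_mat n n \<Longrightarrow> minv g * (g * X) = X"
  using minv_props[of g n] GL_carrier[of g n] by (simp add: assoc_mult_mat[symmetric, of _ n n _ n _ n])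

text \<open>
  Left multiplication by \<open>g\<close> is an injective map from the finite set \<open>G\<close> to itself, hence it hits
  the identity matrix.
\<close>

lemma minv_mem: assumes g: "g \<in> G" shows "minv g \<in> G"
proof -
  have inj: "inj_on ((*) g) G"
    by (rule inj_on_inverseI[of _ "(*) (minv g)"]) (use g mem_GL mem_carrier cancel_left in auto)
  have "(*) g ` G \<subseteq> G" using g mult_mem by auto
  then have "(*) g ` G = G" using endo_inj_surj[OF finite_G] inj by blast
  then obtain h where h: "h \<in> G" "1\<^sub>m n = g * h" using one_mem by auto
  then have "minv g = h" by (intro minv_eq[of _ n]) (use g mem_carrier in auto)
  then show ?thesis using h by simp
qed

lemma sum_translate_left:
  assumes h: "h \<in> G" shows "(\<Sum>g\<in>G. f (h * g)) = (\<Sum>g\<in>G. f g)"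
  using mem_GL[OF h] mem_carrier minv_mem[OF h] h mult_mem mem_GL[OF minv_mem[OF h]]
    cancel_left[of "minv h"] minv_minv[of h n]
  by (intro sum.reindex_bij_witness[of _ "\<lambda>g. minv h * g" "\<lambda>g. h * g"])
     (auto simp: cancel_left)

lemma sum_translate_right:
  assumes h: "h \<in> G" shows "(\<Sum>g\<in>G. f (g * h)) = (\<Sum>g\<in>G. f g)"
proof (rule sum.reindex_bij_witness[of _ "\<lambda>g. g * minv h" "\<lambda>g. g * h"])
  fix g assume g: "g \<in> G"
  note c = mem_carrier[OF h] mem_carrier[OF g] mem_carrier[OF minv_mem[OF h]]
  note m = minv_props[OF mem_GL[OF h]]
  show "g * h * minv h = g" "g * minv h * h = g"
    using c m by (simp_all add: assoc_mult_mat[of _ n n _ n _ n])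
qed (use h minv_mem mult_mem in auto)

end

section \<open>Class functions and averaging\<close>

lemma sum_fun_apply: "(\<Sum>i\<in>I. f i) x = (\<Sum>i\<in>I. f i x :: real)"
  by (induction I rule: infinite_finite_induct) auto

lemma subspace_class_functions: "subspace (class_functions G \<G>)"
  by (auto simp: subspace_def class_functions_def scaleR_fun_def)

locale adjoint_pair = matrix_group n G for n and G :: "'a::{finite,field} mat set" +
  fixes \<G> :: "'a mat set"
  assumes lie: "\<G> \<subseteq> carrier_mat n n"
    and conj_mem: "g \<in> G \<Longrightarrow> X \<in> \<G> \<Longrightarrow> conjugate_by g X \<in> \<G>"
begin

lemma finite_lie: "finite \<G>"
  by (rule finite_subset[OF lie finite_carrier_mat])

text \<open>
  Replacing \<open>X\<close> by a conjugate only translates the summation variable.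
\<close>

lemma average_class_function:
  "(\<lambda>X. if X \<in> \<G> then c * (\<Sum>g\<in>G. F (conjugate_by g X)) else 0) \<in> class_functions G \<G>"
proof -
  have "(\<Sum>g\<in>G. F (conjugate_by g (conjugate_by h X))) = (\<Sum>g\<in>G. F (conjugate_by g X))"
    if "h \<in> G" "X \<in> \<G>" for h X
  proof -
    have "(\<Sum>g\<in>G. F (conjugate_by g (conjugate_by h X))) = (\<Sum>g\<in>G. F (conjugate_by (h * g) X))"
      using that lie mem_GL by (intro sum.cong refl) (auto simp: conjugate_by_mult[of h n])
    then show ?thesis using sum_translate_left[OF \<open>h \<in> G\<close>, of "\<lambda>g. F (conjugate_by g X)"] by simp
  qed
  then show ?thesis by (auto simp: class_functions_def conj_mem)
qed

text \<open>
  A multiple of the indicator function of the orbit of \<open>A\<close>. These functions span the class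
  functions, and no orbit representatives have to be chosen.
\<close>

definition orbit_average :: "'a mat \<Rightarrow> 'a mat \<Rightarrow> real" where
  "orbit_average A X =
     (if X \<in> \<G> then 1 / real (card G) * (\<Sum>g\<in>G. of_bool (conjugate_by g X = A)) else 0)"

lemma orbit_average_class_function: "orbit_average A \<in> class_functions G \<G>"
  unfolding orbit_average_def[abs_def] by (rule average_class_function)

text \<open>
  A class function is its own mean over the group; sorting the terms of the mean by the value of
  the conjugated matrix gives the expansion.
\<close>

lemma class_function_expansion:
  assumes f: "f \<in> class_functions G \<G>"
  shows "f X = (\<Sum>A\<in>\<G>. f A * orbit_average A X)"
proof (cases "X \<in> \<G>")
  case True
  have "(\<Sum>A\<in>\<G>. f A * orbit_average A X)
      = 1 / real (card G) * (\<Sum>A\<in>\<G>. \<Sum>g\<in>G. f A * of_bool (conjugate_by g X = A))"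
    using True by (simp add: orbit_average_def sum_distrib_left mult.left_commute)
  also have "(\<Sum>A\<in>\<G>. \<Sum>g\<in>G. f A * of_bool (conjugate_by g X = A))
      = (\<Sum>g\<in>G. \<Sum>A\<in>\<G>. f A * of_bool (conjugate_by g X = A))"
    by (rule sum.swap)
  also have "\<dots> = (\<Sum>g\<in>G. f X)"
  proof (rule sum.cong[OF refl])
    fix g assume g: "g \<in> G"
    have "(\<Sum>A\<in>\<G>. f A * of_bool (conjugate_by g X = A))
        = (\<Sum>A\<in>\<G>. if A = conjugate_by g X then f (conjugate_by g X) else 0)"
      by (intro sum.cong) auto
    also have "\<dots> = f (conjugate_by g X)"
      using conj_mem[OF g True] finite_lie by simp
    also have "\<dots> = f X"
      using f g True by (simp add: class_functions_def)
    finally show "(\<Sum>A\<in>\<G>. f A * of_bool (conjugate_by g X = A)) = f X" .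
  qed
  finally show ?thesis using card_pos by simp
next
  case False
  then show ?thesis using f by (simp add: orbit_average_def class_functions_def)
qed

text \<open>
  The summand is constant on each coset \<open>g P\<close>, so summing over the whole group instead of over
  representatives multiplies the result by the order of \<open>P\<close>. This removes the choice of
  representatives from parabolic induction.
\<close>

lemma coset_sum_average:
  assumes P: "matrix_group n P" and PG: "P \<subseteq> G"
    and inv: "\<And>p X. p \<in> P \<Longrightarrow> X \<in> \<G> \<Longrightarrow> \<Phi> (conjugate_by p X) = \<Phi> X"
    and X: "X \<in> \<G>"
  shows "(\<Sum>C\<in>left_cosets G P. \<Phi> (conjugate_by (SOME g. g \<in> C) X))
    = (\<Sum>g\<in>G. \<Phi> (conjugate_by g X)) / real (card P)"
proof -
  interpret P: matrix_group n P by fact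
  let ?coset = "\<lambda>g. (\<lambda>p. g * p) ` P"
  have self: "g \<in> ?coset g" if "g \<in> G" for g
  proof (rule image_eqI[OF _ P.one_mem])
    show "g = g * 1\<^sub>m n" using mem_carrier[OF that] by simp
  qed
  have coset_sub: "?coset g \<subseteq> G" if "g \<in> G" for g
    using that mult_mem PG by auto
  have coset_eq: "?coset (g * p) = ?coset g" if g: "g \<in> G" and p: "p \<in> P" for g p
  proof
    note c = mem_carrier[OF g] P.mem_carrier[OF p] P.mem_carrier[OF P.minv_mem[OF p]]
    show "?coset (g * p) \<subseteq> ?coset g"
    proof safe
      fix p' assume p': "p' \<in> P"
      show "g * p * p' \<in> ?coset g"
        by (rule image_eqI[OF _ P.mult_mem[OF p p']])
          (use c P.mem_carrier[OF p'] in \<open>simp add: assoc_mult_mat[of _ n n _ n _ n]\<close>)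
    qed
    show "?coset g \<subseteq> ?coset (g * p)"
    proof safe
      fix p' assume p': "p' \<in> P"
      have "p * (minv p * p') = p'"
        using P.cancel_left[OF P.mem_GL[OF P.minv_mem[OF p]] P.mem_carrier[OF p']]
        by (simp add: minv_minv[OF P.mem_GL[OF p]])
      then show "g * p' \<in> ?coset (g * p)"
        by (intro image_eqI[OF _ P.mult_mem[OF P.minv_mem[OF p] p']])
          (use c P.mem_carrier[OF p'] in \<open>simp add: assoc_mult_mat[of _ n n _ n _ n]
            mult_carrier_mat[of _ n n _ n]\<close>)
    qed
  qed
  have fibre: "{g' \<in> G. ?coset g' = ?coset g} = ?coset g" if "g \<in> G" for g
  proof (rule Set.set_eqI, rule iffI)
    fix g' assume "g' \<in> {g' \<in> G. ?coset g' = ?coset g}"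
    then show "g' \<in> ?coset g" using self[of g'] by simp
  next
    fix g' assume "g' \<in> ?coset g"
    then obtain p where "p \<in> P" "g' = g * p" by blast
    then show "g' \<in> {g' \<in> G. ?coset g' = ?coset g}"
      using coset_eq[OF that] mult_mem[OF that] PG by auto
  qed
  have "(\<Sum>g\<in>G. \<Phi> (conjugate_by g X))
      = (\<Sum>C\<in>left_cosets G P. \<Sum>g\<in>{g \<in> G. ?coset g = C}. \<Phi> (conjugate_by g X))"
    unfolding left_cosets_def by (rule sum.image_gen[OF finite_G])
  also have "\<dots> = (\<Sum>C\<in>left_cosets G P. real (card P) * \<Phi> (conjugate_by (SOME g. g \<in> C) X))"
  proof (rule sum.cong[OF refl])
    fix C assume "C \<in> left_cosets G P"
    then obtain g where g: "g \<in> G" "C = ?coset g" by (auto simp: left_cosets_def)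
    define h where "h = (SOME g. g \<in> C)"
    have "h \<in> C" unfolding h_def using self[OF g(1)] g(2) by (auto intro: someI)
    then have "h \<in> {g' \<in> G. ?coset g' = ?coset g}"
      unfolding fibre[OF g(1)] g(2) .
    then have h: "h \<in> G" "C = ?coset h"
      using g(2) by simp_all
    have inj: "inj_on (\<lambda>p. h * p) P"
      by (rule inj_on_inverseI[of _ "\<lambda>x. minv h * x"])
        (use cancel_left mem_GL[OF h(1)] P.mem_carrier in auto)
    have "(\<Sum>g\<in>{g \<in> G. ?coset g = C}. \<Phi> (conjugate_by g X)) = (\<Sum>p\<in>P. \<Phi> (conjugate_by (h * p) X))"
      unfolding h(2) fibre[OF h(1)] by (subst sum.reindex[OF inj]) simp
    also have "\<dots> = (\<Sum>p\<in>P. \<Phi> (conjugate_by h X))"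
      using X lie h(1) mem_GL P.mem_GL inv conj_mem
      by (intro sum.cong refl) (auto simp: conjugate_by_mult[of h n])
    finally show "(\<Sum>g\<in>{g \<in> G. ?coset g = C}. \<Phi> (conjugate_by g X))
        = real (card P) * \<Phi> (conjugate_by (SOME g. g \<in> C) X)"
      by (simp add: h_def)
  qed
  finally show ?thesis using P.card_pos by (simp add: sum_distrib_left[symmetric])
qed

end

section \<open>Class functions of two variables as tensors\<close>

lemma graded_part_homogeneous:
  assumes "f \<in> V i" "\<And>j. subspace (V j)"
  shows "(\<lambda>(m, X). if m = i then f X else 0) \<in> graded_part V i"
proof -
  have "(\<lambda>x. if m = i then f x else 0) \<in> V m" for m
    using assms(1) subspace_0[OF assms(2)[of m]] by (cases "m = i") (auto simp: zero_fun_def)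
  moreover have "finite {m. m = i \<and> (\<exists>x. f x \<noteq> 0)}"
    by (rule finite_subset[of _ "{i}"]) auto
  ultimately show ?thesis by (auto simp: graded_part_def direct_sum_def)
qed

text \<open>
  Criterion for membership in the algebraic tensor product: expand in orbit averages in the second
  variable, and then expand the coefficients, which are class functions of the first variable.
\<close>

lemma graded_tensor_expansion:
  fixes d d' :: "nat \<Rightarrow> nat" and G H :: "nat \<Rightarrow> 'a::{finite,field} mat set"
  assumes pG: "\<And>i. adjoint_pair (d i) (G i) (\<G> i)" and pH: "\<And>j. adjoint_pair (d' j) (H j) (\<H> j)"
    and S: "finite S" "\<And>i A j B. (i, j) \<notin> S \<Longrightarrow> T ((i, A), (j, B)) = 0"
    and left: "\<And>i j B. (\<lambda>A. T ((i, A), (j, B))) \<in> class_functions (G i) (\<G> i)"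
    and right: "\<And>i j A. (\<lambda>B. T ((i, A), (j, B))) \<in> class_functions (H j) (\<H> j)"
  shows "T \<in> span (\<Union>(i, j)\<in>S. tensor (graded_part (\<lambda>i. class_functions (G i) (\<G> i)) i)
                                     (graded_part (\<lambda>j. class_functions (H j) (\<H> j)) j))"
proof -
  (* The orbit averages, placed in a single degree. *)
  define e where "e i A = (\<lambda>(m, X). if m = i then adjoint_pair.orbit_average (G i) (\<G> i) A X else 0)"
    for i A
  define f where "f j B = (\<lambda>(m, X). if m = j then adjoint_pair.orbit_average (H j) (\<H> j) B X else 0)"
    for j B
  have e: "e i A \<in> graded_part (\<lambda>i. class_functions (G i) (\<G> i)) i" for i A
    unfolding e_def by (rule graded_part_homogeneous)
      (rule adjoint_pair.orbit_average_class_function[OF pG], rule subspace_class_functions)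
  have f: "f j B \<in> graded_part (\<lambda>j. class_functions (H j) (\<H> j)) j" for j B
    unfolding f_def by (rule graded_part_homogeneous)
      (rule adjoint_pair.orbit_average_class_function[OF pH], rule subspace_class_functions)
  let ?R = "\<Sum>(i, j)\<in>S. \<Sum>A\<in>\<G> i. \<Sum>B\<in>\<H> j. T ((i, A), (j, B)) *\<^sub>R pure_tensor (e i A) (f j B)"
  have "T = ?R"
  proof (rule ext, clarsimp simp: sum_fun_apply split_beta)
    fix m X l Y
    have inner: "(\<Sum>A\<in>\<G> i. \<Sum>B\<in>\<H> j. (T ((i, A), (j, B)) *\<^sub>R pure_tensor (e i A) (f j B)) ((m, X), (l, Y)))
       = (if (i, j) = (m, l) then T ((m, X), (l, Y)) else 0)" for i j
    proof (cases "(i, j) = (m, l)")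
      case True
      have "(\<Sum>A\<in>\<G> m. \<Sum>B\<in>\<H> l. T ((m, A), (l, B)) * (e m A (m, X) * f l B (l, Y)))
         = (\<Sum>A\<in>\<G> m. (\<Sum>B\<in>\<H> l. T ((m, A), (l, B)) * f l B (l, Y)) * e m A (m, X))"
        by (simp add: sum_distrib_right sum_distrib_left mult_ac)
      also have "\<dots> = (\<Sum>A\<in>\<G> m. T ((m, A), (l, Y)) * e m A (m, X))"
        using adjoint_pair.class_function_expansion[OF pH[of l] right[where i = m and j
          = l], where X = Y]
        by (simp add: f_def)
      also have "\<dots> = T ((m, X), (l, Y))"
        using adjoint_pair.class_function_expansion[OF pG[of m] left[where i = m and j = l and B
          = Y], where X = X]
        by (simp add: e_def)
      finally show ?thesis using True by (simp add: scaleR_fun_def pure_tensor_def)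
    next
      case False
      then show ?thesis
        by (intro trans[OF sum.neutral]) (auto simp: scaleR_fun_def pure_tensor_def e_def f_def)
    qed
    show "T ((m, X), (l, Y)) = (\<Sum>p\<in>S. \<Sum>A\<in>\<G> (fst p). \<Sum>B\<in>\<H> (snd p).
       (T ((fst p, A), (snd p, B)) *\<^sub>R pure_tensor (e (fst p) A) (f (snd p) B)) ((m, X), (l, Y)))"
      unfolding inner using S by (auto simp: sum.delta)
  qed
  moreover have "?R \<in> span (\<Union>(i, j)\<in>S. tensor (graded_part (\<lambda>i. class_functions (G i) (\<G> i)) i)
                                     (graded_part (\<lambda>j. class_functions (H j) (\<H> j)) j))"
  proof (intro span_sum, clarify, intro span_sum span_scale span_base)
    fix i j A B assume "(i, j) \<in> S"
    moreover have "pure_tensor (e i A) (f j B) \<in> tensor (graded_part (\<lambda>i. class_functions (G i) (\<G>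
      i)) i)
                                     (graded_part (\<lambda>j. class_functions (H j) (\<H> j)) j)"
      unfolding tensor_def using e f by (intro span_base) blast
    ultimately show "pure_tensor (e i A) (f j B) \<in> (\<Union>(i, j)\<in>S. tensor (graded_part (\<lambda>i.
      class_functions (G i) (\<G> i)) i)
                                     (graded_part (\<lambda>j. class_functions (H j) (\<H> j)) j))"
      by blast
  qed
  ultimately show ?thesis by simp
qed

section \<open>Block diagonal matrices\<close>

lemma diag3_carrier:
  "A \<in> carrier_mat i i \<Longrightarrow> B \<in> carrier_mat m m \<Longrightarrow> C \<in> carrier_mat k k \<Longrightarrow>
    diag_block_mat [A, B, C] \<in> carrier_mat (i + m + k) (i + m + k)"
  by (auto simp: Let_def)

lemma diag3_index:
  assumes "A \<in> carrier_mat i i" "B \<in> carrier_mat m m" "C \<in> carrier_mat k k"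
    and "r < i + m + k" "s < i + m + k"
  shows "diag_block_mat [A, B, C] $$ (r, s) =
    (if r < i \<and> s < i then A $$ (r, s)
     else if i \<le> r \<and> r < i + m \<and> i \<le> s \<and> s < i + m then B $$ (r - i, s - i)
     else if i + m \<le> r \<and> i + m \<le> s then C $$ (r - i - m, s - i - m) else 0)"
  using assms by (auto simp: Let_def)

lemma diag_block_mat_Cons_mult:
  fixes A A' :: "'a::semiring_0 mat"
  assumes "A \<in> carrier_mat i i" "A' \<in> carrier_mat i i"
    and "diag_block_mat As \<in> carrier_mat m m" "diag_block_mat As' \<in> carrier_mat m m"
    and "diag_block_mat As * diag_block_mat As' = diag_block_mat As''"
  shows "diag_block_mat (A # As) * diag_block_mat (A' # As') = diag_block_mat (A * A' # As'')"
proof -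
  have "diag_block_mat As'' \<in> carrier_mat m m"
    using assms(3-5) by (metis mult_carrier_mat)
  then show ?thesis
    unfolding diag_block_mat.simps(2) Let_def
    by (subst mult_four_block_mat[of _ i i _ m _ m _ _ i _ m]) (use assms in auto)
qed

lemma diag3_mult:
  fixes A B C :: "'a::semiring_0 mat"
  assumes "A \<in> carrier_mat i i" "B \<in> carrier_mat m m" "C \<in> carrier_mat k k"
    "A' \<in> carrier_mat i i" "B' \<in> carrier_mat m m" "C' \<in> carrier_mat k k"
  shows "diag_block_mat [A, B, C] * diag_block_mat [A', B', C'] = diag_block_mat [A * A', B * B', C
    * C']"
proof -
  have "diag_block_mat [B, C] * diag_block_mat [B', C'] = diag_block_mat [B * B', C * C']"
    by (rule diag_block_mat_Cons_mult[of _ m _ _ k])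
      (use assms in \<open>auto simp only: diag_block_mat_singleton\<close>)
  then show ?thesis
    by (rule diag_block_mat_Cons_mult[of _ i _ _ "m + k", rotated 4])
      (use assms in \<open>auto simp: Let_def\<close>)
qed

lemma diag3_one: "diag_block_mat [1\<^sub>m i, 1\<^sub>m m, 1\<^sub>m k] = 1\<^sub>m (i + m + k)"
  using diag_block_one_mat[of "[1\<^sub>m i, 1\<^sub>m m, 1\<^sub>m k]"] by
    (simp add: add.assoc del: diag_block_mat.simps)

lemma diag3_upper:
  assumes "A \<in> carrier_mat i i" "B \<in> carrier_mat m m" "C \<in> carrier_mat k k"
  shows "upper_at i (diag_block_mat [A, B, C])" "upper_at (i + m) (diag_block_mat [A, B, C])"
  using diag3_carrier[OF assms] unfolding upper_at_def
  by (auto simp: diag3_index[OF assms] simp del: diag_block_mat.simps)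

lemma diag3_windows:
  assumes c: "A \<in> carrier_mat i i" "B \<in> carrier_mat m m" "C \<in> carrier_mat k k"
  shows "window 0 i (diag_block_mat [A, B, C]) = A" "window i m (diag_block_mat [A, B, C]) = B"
    "window (i + m) k (diag_block_mat [A, B, C]) = C"
proof -
  show "window 0 i (diag_block_mat [A, B, C]) = A"
    by (rule eq_matI) (use c in \<open>auto simp: diag3_index[OF c] simp del: diag_block_mat.simps\<close>)
  show "window i m (diag_block_mat [A, B, C]) = B"
    by (rule eq_matI) (use c in \<open>auto simp: diag3_index[OF c] simp del: diag_block_mat.simps\<close>)
  show "window (i + m) k (diag_block_mat [A, B, C]) = C"
    by (rule eq_matI) (use c in \<open>auto simp: diag3_index[OF c] simp del: diag_block_mat.simps\<close>)
qed

section \<open>The adjoint of the Hermitian form\<close>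

text \<open>
  The adjoint \<open>J M\<^sup>* J\<close> of \<open>M\<close> for the Hermitian form with Gram matrix \<open>J\<close> (lemma \<open>J_adj_J\<close>), in
  terms of entries: reflect in the antidiagonal and apply Frobenius.
\<close>

definition dagger :: "nat \<Rightarrow> 'a::field mat \<Rightarrow> 'a mat" where
  "dagger q M = mat (dim_col M) (dim_row M)
     (\<lambda>(r, s). (M $$ (dim_row M - 1 - s, dim_col M - 1 - r)) ^ q)"

lemma dagger_carrier [simp]: "M \<in> carrier_mat n m \<Longrightarrow> dagger q M \<in> carrier_mat m n"
  by (auto simp: dagger_def)

lemma dagger_index:
  "M \<in> carrier_mat n n \<Longrightarrow> r < n \<Longrightarrow> s < n \<Longrightarrow> dagger q M $$ (r, s) = (M $$ (n - 1 - s, n - 1 - r)) ^ q"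
  by (auto simp: dagger_def)

lemma J_carrier [simp]: "J n \<in> carrier_mat n n"
  by (simp add: J_def)

lemma dim_dagger_J_adj [simp]:
  "dim_row (dagger q M) = dim_col M" "dim_col (dagger q M) = dim_row M"
  "dim_row (J n) = n" "dim_col (J n) = n"
  "dim_row (adj q M) = dim_col M" "dim_col (adj q M) = dim_row M"
  by (simp_all add: dagger_def J_def adj_def)

lemma adj_carrier [simp]: "M \<in> carrier_mat n m \<Longrightarrow> adj q M \<in> carrier_mat m n"
  by (auto simp: adj_def)

lemma J_mult_index:
  assumes "X \<in> carrier_mat n n" "r < n" "s < n"
  shows "(J n * X) $$ (r, s) = X $$ (n - 1 - r, s)"
proof -
  have "(J n * X) $$ (r, s) = (\<Sum>t<n. J n $$ (r, t) * X $$ (t, s))"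
    using assms by (intro mult_mat_index) auto
  also have "\<dots> = (\<Sum>t<n. if t = n - 1 - r then X $$ (n - 1 - r, s) else 0)"
    using assms by (intro sum.cong) (auto simp: J_def)
  finally show ?thesis using assms by simp
qed

lemma mult_J_index:
  assumes "X \<in> carrier_mat n n" "r < n" "s < n"
  shows "(X * J n) $$ (r, s) = X $$ (r, n - 1 - s)"
proof -
  have "(X * J n) $$ (r, s) = (\<Sum>t<n. X $$ (r, t) * J n $$ (t, s))"
    using assms by (intro mult_mat_index) auto
  also have "\<dots> = (\<Sum>t<n. if t = n - 1 - s then X $$ (r, n - 1 - s) else 0)"
    using assms by (intro sum.cong) (auto simp: J_def)
  finally show ?thesis using assms by simp
qed

lemma J_adj_J: "M \<in> carrier_mat n n \<Longrightarrow> J n * adj q M * J n = dagger q M"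
  by (rule eq_matI)
    (auto simp: mult_J_index[OF mult_carrier_mat[of _ n n]] J_mult_index dagger_index[of _ n]
      simp del: index_mult_mat(1), auto simp: adj_def)

lemma J_J: "J n * J n = 1\<^sub>m n"
  by (rule eq_matI) (auto simp: J_mult_index simp del: index_mult_mat(1), auto simp: J_def)

lemma J_J_cancel: "X \<in> carrier_mat n n \<Longrightarrow> J n * (J n * X) = X"
  by (simp add: J_J assoc_mult_mat[of "J n" n n "J n" n X n, symmetric])

lemma mem_U_iff:
  "g \<in> U q n \<longleftrightarrow> g \<in> carrier_mat n n \<and> dagger q g * g = 1\<^sub>m n"
proof -
  have *: "adj q g * J n * g = J n \<longleftrightarrow> dagger q g * g = 1\<^sub>m n" if g: "g \<in> carrier_mat n n"
  proof -
    have d: "dagger q g * g = J n * (adj q g * J n * g)"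
      using g by (simp add: J_adj_J[OF g, symmetric] assoc_mult_mat[of _ n n _ n _ n]
        mult_carrier_mat[of _ n n _ n])
    show ?thesis
    proof
      assume "dagger q g * g = 1\<^sub>m n"
      then have "J n * (J n * (adj q g * J n * g)) = J n * 1\<^sub>m n" using d by simp
      then have "J n * (J n * (adj q g * J n * g)) = J n" by (simp add: right_mult_one_mat[of _ n n])
      then show "adj q g * J n * g = J n"
        using g by (simp add: J_J_cancel mult_carrier_mat[of _ n n _ n])
    qed (use d in \<open>simp add: J_J\<close>)
  qed
  show ?thesis
  proof
    assume "g \<in> U q n"
    then show "g \<in> carrier_mat n n \<and> dagger q g * g = 1\<^sub>m n"
      using * by (auto simp: U_def GL_def)
  next
    assume g: "g \<in> carrier_mat n n \<and> dagger q g * g = 1\<^sub>m n"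
    then have "g * dagger q g = 1\<^sub>m n"
      using mat_mult_left_right_inverse[of "dagger q g" n g] by simp
    then have "g \<in> GL n" using g by (intro GL_I[of g n "dagger q g"]) auto
    then show "g \<in> U q n" using g * by (auto simp: U_def)
  qed
qed

lemma minv_U: "g \<in> U q n \<Longrightarrow> minv g = dagger q g"
  using mat_mult_left_right_inverse[of "dagger q g" n g]
  by (intro minv_eq[of g n]) (auto simp: mem_U_iff)

lemma mem_u_iff:
  "X \<in> \<uu> q n \<longleftrightarrow> X \<in> carrier_mat n n \<and> dagger q X = - X"
proof -
  have "adj q X * J n + J n * X = 0\<^sub>m n n \<longleftrightarrow> dagger q X = - X" if X: "X \<in> carrier_mat n n"
  proof
    assume a: "adj q X * J n + J n * X = 0\<^sub>m n n"
    show "dagger q X = - X"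
    proof (rule eq_matI)
      fix r s assume "r < dim_row (- X)" "s < dim_col (- X)"
      then have rs: "r < n" "s < n" using X by auto
      have "(adj q X * J n + J n * X) $$ (n - 1 - r, s) = 0" using a rs by simp
      then have "adj q X $$ (n - 1 - r, n - 1 - s) + X $$ (r, s) = 0"
        using X rs
        by (simp add: mult_J_index[of _ n] J_mult_index[of _ n] del: index_mult_mat(1))
      then show "dagger q X $$ (r, s) = (- X) $$ (r, s)"
        using X rs by (simp add: dagger_index adj_def eq_neg_iff_add_eq_0)
    qed (use X in \<open>auto simp: dagger_def\<close>)
  next
    assume d: "dagger q X = - X"
    show "adj q X * J n + J n * X = 0\<^sub>m n n"
    proof (rule eq_matI)
      fix r s assume "r < dim_row (0\<^sub>m n n :: 'a mat)" "s < dim_col (0\<^sub>m n n :: 'a mat)"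
      then have rs: "r < n" "s < n" by auto
      have "dagger q X $$ (n - 1 - r, s) = (- X) $$ (n - 1 - r, s)" using d by simp
      then have "(X $$ (n - 1 - s, r)) ^ q = - X $$ (n - 1 - r, s)"
        using X rs by (simp add: dagger_index)
      then show "(adj q X * J n + J n * X) $$ (r, s) = 0\<^sub>m n n $$ (r, s)"
        using X rs by (simp add: mult_J_index J_mult_index adj_def del: index_mult_mat(1))
    qed (use X in auto)
  qed
  then show ?thesis by (auto simp: \<uu>_def gl_def)
qed

lemma u_carrier: "X \<in> \<uu> q n \<Longrightarrow> X \<in> carrier_mat n n"
  by (simp add: mem_u_iff)

lemma dagger_window:
  assumes X: "X \<in> carrier_mat n n" and le: "l + m \<le> n"
  shows "dagger q (window l m X) = window (n - l - m) m (dagger q X)"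
proof (rule eq_matI)
  fix r s assume "r < dim_row (window (n - l - m) m (dagger q X))"
    "s < dim_col (window (n - l - m) m (dagger q X))"
  then have rs: "r < m" "s < m" by auto
  have "n - 1 - (n - l - m + r) = l + (m - 1 - r)" "n - 1 - (n - l - m + s) = l + (m - 1 - s)"
    using rs le by auto
  then show "dagger q (window l m X) $$ (r, s) = window (n - l - m) m (dagger q X) $$ (r, s)"
    using rs le X by (simp add: dagger_index[of _ m] dagger_index[of _ n])
qed (auto simp: dagger_def)

text \<open>
  A field with \<open>q\<^sup>2\<close> elements enters through the involution \<open>x \<mapsto> x ^ q\<close>, for which the Hermitian
  form is sesquilinear.
\<close>

locale frobenius_field =
  fixes q :: nat and ty :: "'a::{finite,field} itself"
  assumes frob_add: "(x + y :: 'a) ^ q = x ^ q + y ^ q"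
    and frob_frob: "((x :: 'a) ^ q) ^ q = x"
begin

lemma q_pos: "q > 0"
  using frob_frob[of 0] by (cases "q = 0") auto

lemma frob_0: "(0 :: 'a) ^ q = 0"
  using q_pos by simp

lemma frob_uminus: "(- x :: 'a) ^ q = - (x ^ q)"
  using frob_add[of x "- x"] frob_0 by (simp add: eq_neg_iff_add_eq_0 add.commute)

lemma frob_sum: "(\<Sum>i\<in>I. f i :: 'a) ^ q = (\<Sum>i\<in>I. f i ^ q)"
  by (induction I rule: infinite_finite_induct) (auto simp: frob_0 frob_add)

lemma dagger_dagger: "M \<in> carrier_mat n n \<Longrightarrow> dagger q (dagger q M) = (M :: 'a mat)"
  by (rule eq_matI) (auto simp: dagger_index[of _ n] frob_frob)

lemma dagger_uminus: "M \<in> carrier_mat n n \<Longrightarrow> dagger q (- M) = - dagger q (M :: 'a mat)"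
  by (rule eq_matI) (auto simp: dagger_index[of _ n] frob_uminus)

lemma dagger_one: "dagger q (1\<^sub>m n) = (1\<^sub>m n :: 'a mat)"
  by (rule eq_matI) (use q_pos in \<open>auto simp: dagger_index[of _ n]\<close>)

lemma dagger_add:
  "M \<in> carrier_mat n n \<Longrightarrow> N \<in> carrier_mat n n \<Longrightarrow> dagger q (M + N) = dagger q M + dagger q (N :: 'a mat)"
  by (rule eq_matI) (auto simp: dagger_index[of _ n] frob_add)

lemma dagger_mult:
  assumes X: "X \<in> carrier_mat n n" and Y: "(Y :: 'a mat) \<in> carrier_mat n n"
  shows "dagger q (X * Y) = dagger q Y * dagger q X"
proof (rule eq_matI)
  fix r s assume "r < dim_row (dagger q Y * dagger q X)" "s < dim_col (dagger q Y * dagger q X)"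
  then have rs: "r < n" "s < n" using X Y by (auto simp: dagger_def)
  have "dagger q (X * Y) $$ (r, s) = ((X * Y) $$ (n - 1 - s, n - 1 - r)) ^ q"
    using X Y rs by (intro dagger_index) auto
  also have "(X * Y) $$ (n - 1 - s, n - 1 - r) = (\<Sum>t<n. X $$ (n - 1 - s, t) * Y $$ (t, n - 1 - r))"
    using X Y rs by (intro mult_mat_index) auto
  also have "\<dots> ^ q = (\<Sum>t<n. (X $$ (n - 1 - s, t)) ^ q * (Y $$ (t, n - 1 - r)) ^ q)"
    by (simp add: frob_sum power_mult_distrib)
  also have "\<dots> = (\<Sum>t<n. dagger q Y $$ (r, t) * dagger q X $$ (t, s))"
    using X Y rs
    by (intro sum.reindex_bij_witness[of _ "\<lambda>t. n - 1 - t" "\<lambda>t. n - 1 - t"])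
      (auto simp: dagger_index[of _ n] mult.commute)
  also have "\<dots> = (dagger q Y * dagger q X) $$ (r, s)"
    using X Y rs by (intro mult_mat_index[symmetric, of _ n n]) auto
  finally show "dagger q (X * Y) $$ (r, s) = (dagger q Y * dagger q X) $$ (r, s)" .
qed (use X Y in \<open>auto simp: dagger_def\<close>)

text \<open>
  The reflection in the antidiagonal exchanges the block boundaries \<open>t\<close> and \<open>n - t\<close>.
\<close>

lemma dagger_upper_at:
  assumes "upper_at t (X :: 'a mat)" "X \<in> carrier_mat n n" "t \<le> n"
  shows "upper_at (n - t) (dagger q X)"
  unfolding upper_at_def
proof safe
  fix r s assume "r < dim_row (dagger q X)" "s < dim_col (dagger q X)" "s < n - t" "n - t \<le> r"
  moreover from this have "r < n" "s < n" using assms(2) by auto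
  ultimately have "n - 1 - s < n" "n - 1 - r < n" "n - 1 - r < t" "t \<le> n - 1 - s"
    using assms(3) by auto
  then have "X $$ (n - 1 - s, n - 1 - r) = 0"
    using assms unfolding upper_at_def by auto
  then show "dagger q X $$ (r, s) = 0"
    using \<open>r < n\<close> \<open>s < n\<close> assms(2) by (simp add: dagger_index frob_0)
qed

lemma dagger_diag3:
  assumes c: "(A :: 'a mat) \<in> carrier_mat i i" "B \<in> carrier_mat m m" "C \<in> carrier_mat k k"
  shows "dagger q (diag_block_mat [A, B, C]) = diag_block_mat [dagger q C, dagger q B, dagger q A]"
proof (rule eq_matI)
  note d = diag3_carrier[OF c]
  note cd = dagger_carrier[OF c(3), of q] dagger_carrier[OF c(2), of q] dagger_carrier[OF c(1), of q]
  note d' = diag3_carrier[OF cd]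
  fix r s assume "r < dim_row (diag_block_mat [dagger q C, dagger q B, dagger q A])"
    "s < dim_col (diag_block_mat [dagger q C, dagger q B, dagger q A])"
  then have rs: "r < k + m + i" "s < k + m + i" using d' by auto
  have "dagger q (diag_block_mat [A, B, C]) $$ (r, s)
      = (diag_block_mat [A, B, C] $$ (i + m + k - 1 - s, i + m + k - 1 - r)) ^ q"
    using d rs by (intro dagger_index) auto
  also have "\<dots> = diag_block_mat [dagger q C, dagger q B, dagger q A] $$ (r, s)"
  proof -
    (* The reflected indices lie in the blocks in reverse order. *)
    define r' where "r' = i + m + k - 1 - r"
    define s' where "s' = i + m + k - 1 - s"
    have r': "r' < i + m + k" "i + m \<le> r' \<longleftrightarrow> r < k" "i \<le> r' \<longleftrightarrow> r < k + m" "r' < i \<longleftrightarrow> \<not> r < k + m"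
        "r' < i + m \<longleftrightarrow> \<not> r < k"
        "r < k \<Longrightarrow> r' - i - m = k - 1 - r" "\<not> r < k \<Longrightarrow> r < k + m \<Longrightarrow> r' - i = m - 1 - (r - k)"
        "\<not> r < k + m \<Longrightarrow> r' = i - 1 - (r - k - m)"
      using rs by (auto simp: r'_def)
    have s': "s' < i + m + k" "i + m \<le> s' \<longleftrightarrow> s < k" "i \<le> s' \<longleftrightarrow> s < k + m" "s' < i \<longleftrightarrow> \<not> s < k + m"
        "s' < i + m \<longleftrightarrow> \<not> s < k"
        "s < k \<Longrightarrow> s' - i - m = k - 1 - s" "\<not> s < k \<Longrightarrow> s < k + m \<Longrightarrow> s' - i = m - 1 - (s - k)"
        "\<not> s < k + m \<Longrightarrow> s' = i - 1 - (s - k - m)"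
      using rs by (auto simp: s'_def)
    have "r < k + m + i" "s < k + m + i" "r < k \<Longrightarrow> r < k + m" "s < k \<Longrightarrow> s < k + m"
      using rs by auto
    then show ?thesis
      unfolding diag3_index[OF cd rs] r'_def[symmetric] s'_def[symmetric] diag3_index[OF c s'(1) r'(1)]
        r'(2-5) s'(2-5)
      using c r'(6-8) s'(6-8) frob_0
      by (cases "r < k"; cases "r < k + m"; cases "s < k"; cases "s < k + m")
        (simp_all add: not_less dagger_index[of A i] dagger_index[of B m] dagger_index[of C k])
  qed
  finally show "dagger q (diag_block_mat [A, B, C]) $$ (r, s)
     = diag_block_mat [dagger q C, dagger q B, dagger q A] $$ (r, s)" .
qed (use diag3_carrier[OF c] diag3_carrier[OF dagger_carrier[OF c(3), of q] dagger_carrier[OF c(2),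
  of q] dagger_carrier[OF c(1), of q]]
    in \<open>auto simp: dagger_def simp del: diag_block_mat.simps\<close>)

end

section \<open>Parabolic subgroups with two Levi factors\<close>

text \<open>
  The matrices in \<open>\<G>\<close> that are block upper triangular for the boundary \<open>i\<close> and have prescribed
  diagonal blocks. For the zero blocks in a Lie algebra this is the nilradical of the parabolic
  subalgebra.
\<close>

definition block_fibre :: "'a::field mat set \<Rightarrow> nat \<Rightarrow> nat \<Rightarrow> 'a mat \<Rightarrow> 'a mat \<Rightarrow> 'a mat set" where
  "block_fibre \<G> i m A B = {X \<in> \<G>. upper_at i X \<and> window 0 i X = A \<and> window i m X = B}"

lemma matrix_group_upper_at: "matrix_group n G \<Longrightarrow> matrix_group n {g \<in> G. upper_at t g}"
  unfolding matrix_group_def using upper_at_mult[of _ n t] by (auto simp: upper_at_one GL_def)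

lemma window_minv:
  assumes "g \<in> GL n" "upper_at l g" "upper_at l (minv g)" "upper_at (l + m) g"
    "upper_at (l + m) (minv g)"
    and le: "l + m \<le> n"
  shows "window l m g \<in> GL m" "minv (window l m g) = window l m (minv g)"
proof -
  note p = minv_props[OF assms(1)]
  have "window l m g * window l m (minv g) = 1\<^sub>m m"
    using assms p GL_carrier[OF assms(1)] by (subst window_mult[of _ n, symmetric]) auto
  then show "window l m g \<in> GL m" "minv (window l m g) = window l m (minv g)"
    by (auto intro!: GL_I[of _ m "window l m (minv g)"] minv_eq[of _ m])
qed

lemma window_conjugate_by:
  assumes "g \<in> GL n" "upper_at l g" "upper_at l (minv g)" "upper_at (l + m) g"
    "upper_at (l + m) (minv g)"
    and le: "l + m \<le> n" and X: "X \<in> carrier_mat n n" "upper_at l X" "upper_at (l + m) X"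
  shows "window l m (conjugate_by g X) = conjugate_by (window l m g) (window l m X)"
proof -
  note c = minv_props(1)[OF assms(1)] GL_carrier[OF assms(1)]
  have "window l m (minv g * X * g) = window l m (minv g * X) * window l m g"
    using assms c by (intro window_mult[of _ n]) (auto intro!: upper_at_mult[of _ n] mult_carrier_mat)
  also have "window l m (minv g * X) = window l m (minv g) * window l m X"
    using assms c by (intro window_mult[of _ n]) auto
  finally show ?thesis
    unfolding conjugate_by_def window_minv(2)[OF assms(1-6)] .
qed

text \<open>
  As the fibres are equally large, the proportion of points of \<open>P\<close> over \<open>S\<close> is the proportion of
  \<open>S\<close> in \<open>H\<close>.
\<close>

lemma card_preimage_hom:
  assumes fin: "finite P" "finite H" and hom: "\<phi> ` P \<subseteq> H"
    and fibres: "\<And>h h'. h \<in> H \<Longrightarrow> h' \<in> H \<Longrightarrow>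
      card {p \<in> P. \<phi> p = h} = card {p \<in> P. \<phi> p = h'}"
    and S: "S \<subseteq> H"
  shows "card {p \<in> P. \<phi> p \<in> S} * card H = card P * card S"
proof (cases "H = {}")
  case True
  then show ?thesis using S by auto
next
  case False
  then obtain h where h: "h \<in> H" by blast
  have *: "card {p \<in> P. \<phi> p \<in> S} = card S * card {p \<in> P. \<phi> p = h}" if "S \<subseteq> H" for S
  proof -
    have "card {p \<in> P. \<phi> p \<in> S} = card (\<Union>s\<in>S. {p \<in> P. \<phi> p = s})"
      by (rule arg_cong[where f = card]) auto
    also have "\<dots> = (\<Sum>s\<in>S. card {p \<in> P. \<phi> p = s})"
      using fin finite_subset[OF that fin(2)] by (intro card_UN_disjoint) auto
    also have "\<dots> = (\<Sum>s\<in>S. card {p \<in> P. \<phi> p = h})"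
      using that h by (intro sum.cong refl fibres) auto
    finally show ?thesis by simp
  qed
  have "{p \<in> P. \<phi> p \<in> H} = P" using hom by auto
  then show ?thesis using *[of H] *[OF S] by simp
qed

text \<open>
  The common setting of the two kinds of parabolic subgroups. The subgroup of \<open>G\<close> given by the
  boundary \<open>i\<close> has the Levi factors \<open>GL i\<close> and \<open>H\<close>, which are seen in the windows at \<open>0\<close> and \<open>i\<close>.
  For unitary groups there is a third diagonal block, but it is determined by the first one. The
  maps \<open>embed\<close> and \<open>lift\<close> are sections of the projections to the Levi algebra and the Levi
  subgroup.
\<close>

locale parabolic = G: adjoint_pair n G \<G> + H: adjoint_pair m H \<H>
  for n m :: nat and G \<G> H \<H> :: "'a::{finite,field} mat set" +
  fixes i :: nat and embed lift :: "'a mat \<times> 'a mat \<Rightarrow> 'a mat"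
  assumes le: "i + m \<le> n"
    and lie_add: "X \<in> \<G> \<Longrightarrow> Y \<in> \<G> \<Longrightarrow> X + Y \<in> \<G>"
    and lie_uminus: "X \<in> \<G> \<Longrightarrow> - X \<in> \<G>"
    and lie_upper: "X \<in> \<G> \<Longrightarrow> upper_at i X \<Longrightarrow> upper_at (i + m) X"
    and lie_window: "X \<in> \<G> \<Longrightarrow> upper_at i X \<Longrightarrow> window i m X \<in> \<H>"
    and group_upper: "g \<in> G \<Longrightarrow> upper_at i g \<Longrightarrow> upper_at (i + m) g"
    and group_window: "g \<in> G \<Longrightarrow> upper_at i g \<Longrightarrow> window i m g \<in> H"
    and embed: "A \<in> gl i \<Longrightarrow> B \<in> \<H> \<Longrightarrow> embed (A, B) \<in> block_fibre \<G> i m A B"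
    and lift: "h \<in> GL i \<Longrightarrow> k \<in> H \<Longrightarrow> lift (h, k) \<in> block_fibre G i m h k"
begin

definition P :: "'a mat set" where "P = {g \<in> G. upper_at i g}"

sublocale P: matrix_group n P
  unfolding P_def by (rule matrix_group_upper_at) (rule G.matrix_group_axioms)

lemma P_G: "P \<subseteq> G" by (auto simp: P_def)

lemma P_props:
  assumes "g \<in> P"
  shows "g \<in> GL n" "upper_at i g" "upper_at i (minv g)" "upper_at (i + m) g" "upper_at (i + m) (minv g)"
  using assms P.minv_mem[OF assms] G.mem_GL group_upper by (auto simp: P_def)

lemma P_windows: "g \<in> P \<Longrightarrow> window 0 i g \<in> GL i" "g \<in> P \<Longrightarrow> window i m g \<in> H"
proof -
  assume g: "g \<in> P"
  show "window 0 i g \<in> GL i"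
    using P_props[OF g] le by (intro window_minv(1)[of _ n]) auto
  show "window i m g \<in> H" using g group_window by (auto simp: P_def)
qed

lemma windows_mult:
  assumes "g \<in> P" "h \<in> P"
  shows "window 0 i (g * h) = window 0 i g * window 0 i h"
    "window i m (g * h) = window i m g * window i m h"
  using P_props[OF assms(1)] P_props[OF assms(2)] le P.mem_carrier assms
  by (auto intro!: window_mult[of _ n])

lemma windows_minv:
  assumes "g \<in> P"
  shows "window 0 i (minv g) = minv (window 0 i g)" "window i m (minv g) = minv (window i m g)"
  using P_props[OF assms] le by (auto intro!: window_minv(2)[of _ n, symmetric])

lemma upper_conjugate:
  assumes "g \<in> P" "X \<in> \<G>"
  shows "upper_at i (conjugate_by g X) \<longleftrightarrow> upper_at i X"
proof -
  have *: "upper_at i (conjugate_by g X)" if "g \<in> P" "X \<in> \<G>" "upper_at i X" for g X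
    unfolding conjugate_by_def using P_props[OF that(1)] that G.lie P.mem_carrier
      P.mem_carrier[OF P.minv_mem]
    by (auto intro!: upper_at_mult[of _ n] mult_carrier_mat[of _ n n])
  have "upper_at i X" if "upper_at i (conjugate_by g X)"
  proof -
    have "conjugate_by (minv g) (conjugate_by g X) = X"
      using assms G.lie P.mem_GL by (intro conjugate_by_minv_cancel[of _ n]) auto
    then show ?thesis
      using *[OF P.minv_mem[OF assms(1)] G.conj_mem that] assms P_G by auto
  qed
  then show ?thesis using * assms by blast
qed

lemma windows_conjugate:
  assumes "g \<in> P" "X \<in> \<G>" "upper_at i X"
  shows "window 0 i (conjugate_by g X) = conjugate_by (window 0 i g) (window 0 i X)"
    "window i m (conjugate_by g X) = conjugate_by (window i m g) (window i m X)"
  using P_props[OF assms(1)] le assms G.lie lie_upper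
  by (auto intro!: window_conjugate_by[of _ n])

lemma lift_props:
  assumes "h \<in> GL i" "k \<in> H"
  shows "lift (h, k) \<in> P" "window 0 i (lift (h, k)) = h" "window i m (lift (h, k)) = k"
  using lift[OF assms] by (auto simp: block_fibre_def P_def)

lemma one_window [simp]: "window 0 i (1\<^sub>m n) = 1\<^sub>m i" "window i m (1\<^sub>m n) = 1\<^sub>m m"
  using le by auto

text \<open>
  Multiplication by an element of \<open>P\<close> that lies over \<open>h' h\<^sup>-\<^sup>1\<close> carries the fibre over \<open>h\<close> to the
  fibre over \<open>h'\<close>.
\<close>

lemma card_fibre_hom:
  assumes "\<psi> ` P \<subseteq> K" "\<And>g h. g \<in> P \<Longrightarrow> h \<in> P \<Longrightarrow> \<psi> (g * h) = \<psi> g * \<psi> h"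
    and "\<And>h. h \<in> K \<Longrightarrow> \<exists>p\<in>P. \<psi> p = h"
    and K: "matrix_group d K" and "\<And>p. p \<in> P \<Longrightarrow> \<psi> (minv p) = minv (\<psi> p)"
    and h: "h \<in> K" "h' \<in> K"
  shows "card {p \<in> P. \<psi> p = h} = card {p \<in> P. \<psi> p = h'}"
proof -
  interpret K: matrix_group d K by fact
  (* An element of P that moves the fibre over h to the fibre over h'. *)
  obtain p0 where p0: "p0 \<in> P" "\<psi> p0 = h' * minv h"
    using assms(3) h K.mult_mem K.minv_mem by metis
  have cK: "h \<in> carrier_mat d d" "h' \<in> carrier_mat d d" "minv h \<in> carrier_mat d d"
    "minv h' \<in> carrier_mat d d"
    using h K.minv_mem K.mem_carrier by auto
  note mK = minv_props[OF K.mem_GL[OF h(1)]] minv_props[OF K.mem_GL[OF h(2)]]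
  have 1: "h' * minv h * h = h'"
    using cK mK by (simp add: assoc_mult_mat[of _ d d _ d _ d])
  have 2: "minv (h' * minv h) * h' = h"
    using cK mK h K.mem_GL K.minv_mem minv_minv[of h d] minv_mult[of h' d "minv h"]
    by (simp add: assoc_mult_mat[of _ d d _ d _ d])
  have "bij_betw (\<lambda>p. p0 * p) {p \<in> P. \<psi> p = h} {p \<in> P. \<psi> p = h'}"
  proof (rule bij_betwI[where g = "\<lambda>p. minv p0 * p"])
    show "(\<lambda>p. p0 * p) \<in> {p \<in> P. \<psi> p = h} \<rightarrow> {p \<in> P. \<psi> p = h'}"
      using p0 assms(2) P.mult_mem 1 by auto
    show "(\<lambda>p. minv p0 * p) \<in> {p \<in> P. \<psi> p = h'} \<rightarrow> {p \<in> P. \<psi> p = h}"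
      using p0 assms(2) assms(5)[OF p0(1)] P.mult_mem P.minv_mem[OF p0(1)] 2 by auto
  qed (use p0 P.cancel_left[of p0] P.cancel_left[of "minv p0"] P.mem_GL P.minv_mem P.mem_carrier
      minv_minv[OF P.mem_GL[OF p0(1)]] in auto)
  then show ?thesis by (rule bij_betw_same_card)
qed

lemma GL_group: "matrix_group i (GL i :: 'a mat set)"
  by (auto simp: matrix_group_def one_GL mult_GL)

lemma card_window_0:
  assumes "S \<subseteq> GL i"
  shows "card {p \<in> P. window 0 i p \<in> S} * card (GL i :: 'a mat set) = card P * card S"
proof (rule card_preimage_hom[OF P.finite_G _ _ _ assms])
  interpret I: matrix_group i "GL i :: 'a mat set" by (rule GL_group)
  show "finite (GL i :: 'a mat set)" by (rule I.finite_G)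
  show "window 0 i ` P \<subseteq> GL i" using P_windows by auto
  have onto: "\<exists>p\<in>P. window 0 i p = h" if "h \<in> GL i" for h
    using lift_props[OF that H.one_mem] by blast
  show "card {p \<in> P. window 0 i p = h} = card {p \<in> P. window 0 i p = h'}"
    if "h \<in> GL i" "h' \<in> GL i" for h h'
    by (rule card_fibre_hom[OF _ _ _ GL_group _ that])
      (use P_windows windows_mult windows_minv onto in auto)
qed

lemma card_window_i:
  assumes "S \<subseteq> H"
  shows "card {p \<in> P. window i m p \<in> S} * card H = card P * card S"
proof (rule card_preimage_hom[OF P.finite_G H.finite_G _ _ assms])
  show "window i m ` P \<subseteq> H" using P_windows by auto
  have onto: "\<exists>p\<in>P. window i m p = h" if "h \<in> H" for h
    using lift_props[OF one_GL that] by blast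
  show "card {p \<in> P. window i m p = h} = card {p \<in> P. window i m p = h'}"
    if "h \<in> H" "h' \<in> H" for h h'
    by (rule card_fibre_hom[OF _ _ _ H.matrix_group_axioms _ that])
      (use P_windows windows_mult windows_minv onto in auto)
qed

section \<open>Fibres of the projection to the Levi algebra\<close>

abbreviation nil :: "'a mat set" where "nil \<equiv> block_fibre \<G> i m (0\<^sub>m i i) (0\<^sub>m m m)"

lemma lie_carrier: "X \<in> \<G> \<Longrightarrow> X \<in> carrier_mat n n" using G.lie by auto

lemma window_add_lie:
  "X \<in> \<G> \<Longrightarrow> Y \<in> \<G> \<Longrightarrow> window 0 i (X + Y) = window 0 i X + window 0 i Y"
  "X \<in> \<G> \<Longrightarrow> Y \<in> \<G> \<Longrightarrow> window i m (X + Y) = window i m X + window i m Y"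
  using le lie_carrier by (auto intro!: window_add[of _ n])

lemma fibre_empty: "\<not> (A \<in> gl i \<and> B \<in> \<H>) \<Longrightarrow> block_fibre \<G> i m A B = {}"
  using lie_window by (auto simp: block_fibre_def gl_def)

lemma upper_uminus: "upper_at t (- X :: 'a mat) \<longleftrightarrow> upper_at t X"
  by (auto simp: upper_at_def)

text \<open>
  The windows are additive, so a fibre is a coset of the nilradical.
\<close>

lemma fibre_translate:
  assumes AB: "A \<in> gl i" "B \<in> \<H>"
  shows "bij_betw (\<lambda>Z. embed (A, B) + Z) nil (block_fibre \<G> i m A B)"
proof (rule bij_betwI[where g = "\<lambda>X. - embed (A, B) + X"])
  let ?E = "embed (A, B)"
  have E: "?E \<in> \<G>" "upper_at i ?E" "window 0 i ?E = A" "window i m ?E = B"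
    using embed[OF AB] by (auto simp: block_fibre_def)
  have c: "A \<in> carrier_mat i i" "B \<in> carrier_mat m m"
    using AB H.lie by (auto simp: gl_def)
  have mE: "- ?E \<in> \<G>" "upper_at i (- ?E)" "window 0 i (- ?E) = - A" "window i m (- ?E) = - B"
    using E lie_uminus upper_uminus le window_uminus[OF lie_carrier[OF E(1)]] by auto
  show "(\<lambda>Z. ?E + Z) \<in> nil \<rightarrow> block_fibre \<G> i m A B"
    using E c lie_add lie_carrier upper_at_add[of ?E n] by (auto simp: block_fibre_def window_add_lie)
  show "(\<lambda>X. - ?E + X) \<in> block_fibre \<G> i m A B \<rightarrow> nil"
    using mE c lie_add lie_carrier upper_at_add[of "- ?E" n, OF lie_carrier[OF mE(1)]]
      uminus_l_inv_mat[OF c(1)] uminus_l_inv_mat[OF c(2)]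
    by (auto simp: block_fibre_def window_add_lie)
  have Ec: "?E \<in> carrier_mat n n" using E lie_carrier by blast
  fix Z :: "'a mat"
  assume "Z \<in> nil"
  then have Z: "Z \<in> carrier_mat n n" using lie_carrier by (auto simp: block_fibre_def)
  show "- ?E + (?E + Z) = Z"
    using Z Ec by (intro eq_matI) auto
next
  let ?E = "embed (A, B)"
  have Ec: "?E \<in> carrier_mat n n"
    using embed[OF AB] lie_carrier by (auto simp: block_fibre_def)
  fix X :: "'a mat"
  assume "X \<in> block_fibre \<G> i m A B"
  then have "X \<in> carrier_mat n n" using lie_carrier by (auto simp: block_fibre_def)
  then show "?E + (- ?E + X) = X" using Ec by (intro eq_matI) auto
qed

lemma card_fibre: "A \<in> gl i \<Longrightarrow> B \<in> \<H> \<Longrightarrow> card (block_fibre \<G> i m A B) = card nil"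
  using bij_betw_same_card[OF fibre_translate] by simp

lemma embed_inj: "inj_on embed (gl i \<times> \<H>)"
  by (rule inj_on_inverseI[of _ "\<lambda>X. (window 0 i X, window i m X)"])
    (use embed in \<open>auto simp: block_fibre_def\<close>)

text \<open>
  Restriction is a sum over a fibre. This also holds outside of the Levi algebra, where the fibre
  is empty and restriction is zero by convention.
\<close>

lemma restriction_eq:
  "pull (gl i \<times> \<H>) embed (par_res (embed ` (gl i \<times> \<H>)) nil \<Psi>) (A, B)
    = (\<Sum>X\<in>block_fibre \<G> i m A B. \<Psi> X) / real (card nil)"
proof (cases "A \<in> gl i \<and> B \<in> \<H>")
  case True
  then show ?thesis
    using sum.reindex_bij_betw[OF fibre_translate, of A B \<Psi>]
    by (auto simp: pull_def par_res_def)
next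
  case False
  then show ?thesis using fibre_empty[OF False] by (auto simp: pull_def)
qed

text \<open>
  The Levi part of a matrix in the parabolic subalgebra is determined by its windows.
\<close>

lemma inflate_eq:
  assumes X: "X \<in> \<G>"
  shows "inflate (embed ` (gl i \<times> \<H>)) nil (push (gl i \<times> \<H>) embed T) X
    = (if upper_at i X then T (window 0 i X, window i m X) else 0)"
proof -
  let ?L = "embed ` (gl i \<times> \<H>)"
  have decomp: "Y = embed (window 0 i X, window i m X) \<and> upper_at i X"
    if Y: "Y \<in> ?L" and Z: "Z \<in> nil" and XYZ: "X = Y + Z" for Y Z
  proof -
    obtain A B where AB: "A \<in> gl i" "B \<in> \<H>" "Y = embed (A, B)" using Y by auto
    have "X \<in> block_fibre \<G> i m A B"
      using bij_betwE[OF fibre_translate[OF AB(1,2)]] Z XYZ AB(3) by blast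
    then show ?thesis using AB by (auto simp: block_fibre_def)
  qed
  show ?thesis
  proof (cases "upper_at i X")
    case True
    let ?A = "window 0 i X" and ?B = "window i m X"
    have AB: "?A \<in> gl i" "?B \<in> \<H>" using lie_window[OF X True] by (auto simp: gl_def)
    have "X \<in> block_fibre \<G> i m ?A ?B" using X True by (simp add: block_fibre_def)
    then obtain Z where Z: "Z \<in> nil" "X = embed (?A, ?B) + Z"
      using fibre_translate[OF AB] unfolding bij_betw_def by (metis (no_types, lifting) image_iff)
    have L: "embed (?A, ?B) \<in> ?L" using AB by auto
    have "(THE Y. Y \<in> ?L \<and> (\<exists>Z\<in>nil. X = Y + Z)) = embed (?A, ?B)"
      by (rule the_equality) (use L Z decomp in blast)+
    moreover have "push (gl i \<times> \<H>) embed T (embed (?A, ?B)) = T (?A, ?B)"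
      using L AB the_inv_into_f_f[OF embed_inj] by (simp add: push_def)
    ultimately show ?thesis using True L Z unfolding inflate_def by auto
  next
    case False
    then show ?thesis using decomp unfolding inflate_def by auto
  qed
qed

end

section \<open>Induction as a sum over the whole group\<close>

context parabolic
begin

definition biinvariant :: "('a mat \<times> 'a mat \<Rightarrow> real) \<Rightarrow> bool" where
  "biinvariant T \<longleftrightarrow> (\<forall>A\<in>gl i. \<forall>B\<in>\<H>. \<forall>h\<in>GL i. \<forall>k\<in>H.
     T (conjugate_by h A, conjugate_by k B) = T (A, B))"

text \<open>
  The extension of \<open>T\<close> from the Levi algebra to the parabolic subalgebra, and by zero to everything
  else.
\<close>

definition spread :: "('a mat \<times> 'a mat \<Rightarrow> real) \<Rightarrow> 'a mat \<Rightarrow> real" where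
  "spread T X = (if upper_at i X then T (window 0 i X, window i m X) else 0)"

definition ind :: "('a mat \<times> 'a mat \<Rightarrow> real) \<Rightarrow> 'a mat \<Rightarrow> real" where
  "ind T = par_ind G P \<G> (embed ` (gl i \<times> \<H>)) nil (push (gl i \<times> \<H>) embed T)"

lemma biinvariant_pure:
  assumes "a \<in> class_functions (GL i) (gl i)" "b \<in> class_functions H \<H>"
  shows "biinvariant (\<lambda>(A, B). a A * b B)"
  using assms by (auto simp: biinvariant_def class_functions_def)

lemma spread_conjugate:
  assumes T: "biinvariant T" and g: "g \<in> P" and X: "X \<in> \<G>"
  shows "spread T (conjugate_by g X) = spread T X"
  using T P_windows[OF g] lie_window[OF X] upper_conjugate[OF g X] windows_conjugate[OF g X]
  by (auto simp: spread_def biinvariant_def gl_def)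

text \<open>
  For an invariant \<open>T\<close> the extension of \<open>T\<close> is invariant under \<open>P\<close>, and the sum over cosets becomes
  a normalised sum over the whole group.
\<close>

lemma ind_eq:
  assumes T: "biinvariant T"
  shows "ind T = (\<lambda>X. if X \<in> \<G> then 1 / real (card P) * (\<Sum>g\<in>G. spread T (conjugate_by g X)) else 0)"
proof (rule ext)
  fix X
  let ?I = "inflate (embed ` (gl i \<times> \<H>)) nil (push (gl i \<times> \<H>) embed T)"
  have I: "?I X = spread T X" if "X \<in> \<G>" for X
    using inflate_eq[OF that] by (simp add: spread_def)
  have "(\<Sum>C\<in>left_cosets G P. ?I (conjugate_by (SOME g. g \<in> C) X))
      = (\<Sum>g\<in>G. spread T (conjugate_by g X)) / real (card P)" if X: "X \<in> \<G>"
  proof -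
    have "(\<Sum>C\<in>left_cosets G P. ?I (conjugate_by (SOME g. g \<in> C) X))
      = (\<Sum>g\<in>G. ?I (conjugate_by g X)) / real (card P)"
      using I G.conj_mem P_G spread_conjugate[OF T] X
      by (intro G.coset_sum_average P.matrix_group_axioms) auto
    also have "(\<Sum>g\<in>G. ?I (conjugate_by g X)) = (\<Sum>g\<in>G. spread T (conjugate_by g X))"
      using I G.conj_mem X by (intro sum.cong) auto
    finally show ?thesis .
  qed
  then show "ind T X = (if X \<in> \<G> then 1 / real (card P) * (\<Sum>g\<in>G. spread T (conjugate_by g X)) else 0)"
    by (simp add: ind_def par_ind_def)
qed

lemma ind_class_function: "biinvariant T \<Longrightarrow> ind T \<in> class_functions G \<G>"
  unfolding ind_eq by (rule G.average_class_function)

text \<open>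
  Conjugating both windows by those of \<open>p \<in> P\<close> amounts to replacing \<open>g\<close> by \<open>g p\<close>.
\<close>

lemma sum_spread_conjugate:
  assumes X: "X \<in> \<G>" and p: "p \<in> P"
  shows "(\<Sum>g\<in>G. spread (\<lambda>(A, B). T (conjugate_by (window 0 i p) A, conjugate_by (window i m p) B))
    (conjugate_by g X))
    = (\<Sum>g\<in>G. spread T (conjugate_by g X))"
proof -
  have "(\<Sum>g\<in>G. spread T (conjugate_by g X)) = (\<Sum>g\<in>G. spread T (conjugate_by (g * p) X))"
    using G.sum_translate_right[of p "\<lambda>g. spread T (conjugate_by g X)"] p P_G by auto
  also have "\<dots> = (\<Sum>g\<in>G. spread (\<lambda>(A, B). T (conjugate_by (window 0 i p) A, conjugate_by (window i m
    p) B)) (conjugate_by g X))"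
  proof (rule sum.cong[OF refl])
    fix g assume g: "g \<in> G"
    have "conjugate_by (g * p) X = conjugate_by p (conjugate_by g X)"
      using g p X G.mem_GL P.mem_GL lie_carrier by (intro conjugate_by_mult) auto
    then show "spread T (conjugate_by (g * p) X)
        = spread (\<lambda>(A, B). T (conjugate_by (window 0 i p) A, conjugate_by (window i m p) B))
          (conjugate_by g X)"
      using upper_conjugate[OF p G.conj_mem[OF g X]] windows_conjugate[OF p G.conj_mem[OF g X]]
      by (auto simp: spread_def)
  qed
  finally show ?thesis by simp
qed

lemma spread_cong:
  assumes "\<And>A B. A \<in> gl i \<Longrightarrow> B \<in> \<H> \<Longrightarrow> T (A, B) = T' (A, B)" "X \<in> \<G>"
  shows "spread T X = spread T' X"
  using assms lie_window by (auto simp: spread_def gl_def)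

text \<open>
  This is what makes induction transitive: an inner sum over the first Levi factor can be lifted to
  \<open>P\<close> and absorbed into the outer sum over \<open>G\<close>.
\<close>

lemma sum_spread_average_left:
  assumes X: "X \<in> \<G>"
  shows "(\<Sum>g\<in>G. spread (\<lambda>(A, B). \<Sum>h\<in>GL i. T (conjugate_by h A, B)) (conjugate_by g X))
    = real (card (GL i :: 'a mat set)) * (\<Sum>g\<in>G. spread T (conjugate_by g X))"
proof -
  have "(\<Sum>g\<in>G. spread (\<lambda>(A, B). \<Sum>h\<in>GL i. T (conjugate_by h A, B)) (conjugate_by g X))
     = (\<Sum>g\<in>G. \<Sum>h\<in>GL i. spread (\<lambda>(A, B). T (conjugate_by h A, B)) (conjugate_by g X))"
    by (intro sum.cong refl) (simp add: spread_def)
  also have "\<dots> = (\<Sum>h\<in>GL i. \<Sum>g\<in>G. spread (\<lambda>(A, B). T (conjugate_by h A, B)) (conjugate_by g X))"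
    by (rule sum.swap)
  also have "\<dots> = (\<Sum>h\<in>(GL i :: 'a mat set). \<Sum>g\<in>G. spread T (conjugate_by g X))"
  proof (rule sum.cong[OF refl])
    fix h :: "'a mat" assume h: "h \<in> GL i"
    note l = lift_props[OF h H.one_mem]
    have "(\<Sum>g\<in>G. spread (\<lambda>(A, B). T (conjugate_by h A, B)) (conjugate_by g X))
        = (\<Sum>g\<in>G. spread (\<lambda>(A, B). T (conjugate_by h A, conjugate_by (1\<^sub>m m) B)) (conjugate_by g X))"
      using G.conj_mem X H.lie
      by (intro sum.cong refl spread_cong) (auto simp: subset_iff conjugate_by_one[of _ m])
    also have "\<dots> = (\<Sum>g\<in>G. spread T (conjugate_by g X))"
      using sum_spread_conjugate[OF X l(1), of T] by (simp add: l)
    finally show "(\<Sum>g\<in>G. spread (\<lambda>(A, B). T (conjugate_by h A, B)) (conjugate_by g X))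
        = (\<Sum>g\<in>G. spread T (conjugate_by g X))" .
  qed
  finally show ?thesis by simp
qed

text \<open>
  The same absorption for the second Levi factor.
\<close>

lemma sum_spread_average_right:
  assumes X: "X \<in> \<G>"
  shows "(\<Sum>g\<in>G. spread (\<lambda>(A, B). \<Sum>k\<in>H. T (A, conjugate_by k B)) (conjugate_by g X))
    = real (card H) * (\<Sum>g\<in>G. spread T (conjugate_by g X))"
proof -
  have "(\<Sum>g\<in>G. spread (\<lambda>(A, B). \<Sum>k\<in>H. T (A, conjugate_by k B)) (conjugate_by g X))
     = (\<Sum>g\<in>G. \<Sum>k\<in>H. spread (\<lambda>(A, B). T (A, conjugate_by k B)) (conjugate_by g X))"
    by (intro sum.cong refl) (simp add: spread_def)
  also have "\<dots> = (\<Sum>k\<in>H. \<Sum>g\<in>G. spread (\<lambda>(A, B). T (A, conjugate_by k B)) (conjugate_by g X))"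
    by (rule sum.swap)
  also have "\<dots> = (\<Sum>k\<in>H. \<Sum>g\<in>G. spread T (conjugate_by g X))"
  proof (rule sum.cong[OF refl])
    fix k assume k: "k \<in> H"
    note l = lift_props[OF one_GL k]
    have "(\<Sum>g\<in>G. spread (\<lambda>(A, B). T (A, conjugate_by k B)) (conjugate_by g X))
        = (\<Sum>g\<in>G. spread (\<lambda>(A, B). T (conjugate_by (1\<^sub>m i) A, conjugate_by k B)) (conjugate_by g X))"
      using G.conj_mem X
      by (intro sum.cong refl spread_cong) (auto simp: gl_def conjugate_by_one[of _ i])
    also have "\<dots> = (\<Sum>g\<in>G. spread T (conjugate_by g X))"
      using sum_spread_conjugate[OF X l(1), of T] by (simp add: l)
    finally show "(\<Sum>g\<in>G. spread (\<lambda>(A, B). T (A, conjugate_by k B)) (conjugate_by g X))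
        = (\<Sum>g\<in>G. spread T (conjugate_by g X))" .
  qed
  finally show ?thesis by simp
qed

section \<open>Restriction as a mean over a fibre\<close>

definition res :: "('a mat \<Rightarrow> real) \<Rightarrow> 'a mat \<times> 'a mat \<Rightarrow> real" where
  "res \<Psi> = pull (gl i \<times> \<H>) embed (par_res (embed ` (gl i \<times> \<H>)) nil \<Psi>)"

lemma res_eq: "res \<Psi> (A, B) = (\<Sum>X\<in>block_fibre \<G> i m A B. \<Psi> X) / real (card nil)"
  unfolding res_def by (rule restriction_eq)

text \<open>
  Conjugation by a lift of \<open>(h, k)\<close> maps the fibre over \<open>(A, B)\<close> bijectively to the fibre over the
  conjugated pair.
\<close>

lemma res_conjugate:
  assumes f: "f \<in> class_functions G \<G>" and h: "h \<in> GL i" and k: "k \<in> H"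
    and A: "A \<in> gl i" and B: "B \<in> \<H>"
  shows "res f (conjugate_by h A, conjugate_by k B) = res f (A, B)"
proof -
  let ?p = "lift (h, k)"
  note p = lift_props[OF h k]
  have m: "minv ?p \<in> P" "window 0 i (minv ?p) = minv h" "window i m (minv ?p) = minv k"
    using P.minv_mem windows_minv p by auto
  have cancel: "conjugate_by (minv h) (conjugate_by h A) = A"
    "conjugate_by (minv k) (conjugate_by k B) = B"
    using conjugate_by_minv_cancel(1)[OF h] A conjugate_by_minv_cancel(1)[OF H.mem_GL[OF k]] B H.lie
    by (auto simp: gl_def)
  have pG: "?p \<in> G" "minv ?p \<in> G" using p m P_G by auto
  have "(\<Sum>X\<in>block_fibre \<G> i m (conjugate_by h A) (conjugate_by k B). f X)
      = (\<Sum>X\<in>block_fibre \<G> i m A B. f X)"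
  proof (rule sum.reindex_bij_witness[of _ "conjugate_by ?p" "conjugate_by (minv ?p)"])
    fix X assume X: "X \<in> block_fibre \<G> i m A B"
    then have XG: "X \<in> \<G>" "upper_at i X" by (auto simp: block_fibre_def)
    then show "conjugate_by (minv ?p) (conjugate_by ?p X) = X"
      using lie_carrier P.mem_GL[OF p(1)] by (auto intro!: conjugate_by_minv_cancel)
    show "conjugate_by ?p X \<in> block_fibre \<G> i m (conjugate_by h A) (conjugate_by k B)"
      using X XG p pG G.conj_mem upper_conjugate windows_conjugate by (auto simp: block_fibre_def)
  next
    fix X assume X: "X \<in> block_fibre \<G> i m (conjugate_by h A) (conjugate_by k B)"
    then have XG: "X \<in> \<G>" "upper_at i X" by (auto simp: block_fibre_def)
    then show "conjugate_by ?p (conjugate_by (minv ?p) X) = X"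
      using lie_carrier P.mem_GL[OF p(1)] by (auto intro!: conjugate_by_minv_cancel)
    show "conjugate_by (minv ?p) X \<in> block_fibre \<G> i m A B"
      using X XG m pG G.conj_mem upper_conjugate windows_conjugate[OF m(1)] cancel
      by (auto simp: block_fibre_def)
    show "f (conjugate_by (minv ?p) X) = f X"
      using f pG XG by (simp add: class_functions_def)
  qed
  then show ?thesis by (simp add: res_eq)
qed

lemma res_outside: "\<not> (A \<in> gl i \<and> B \<in> \<H>) \<Longrightarrow> res f (A, B) = 0"
  using fibre_empty by (simp add: res_eq)

lemma res_class_function:
  assumes f: "f \<in> class_functions G \<G>"
  shows "(\<lambda>A. res f (A, B)) \<in> class_functions (GL i) (gl i)"
    "(\<lambda>B. res f (A, B)) \<in> class_functions H \<H>"
proof -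
  show "(\<lambda>A. res f (A, B)) \<in> class_functions (GL i) (gl i)"
  proof (cases "B \<in> \<H>")
    case True
    then have "conjugate_by (1\<^sub>m m) B = B" using H.lie by (intro conjugate_by_one) auto
    then show ?thesis
      using res_conjugate[OF f _ H.one_mem _ True] res_outside by (auto simp: class_functions_def)
  qed (simp add: class_functions_def res_outside)
  show "(\<lambda>B. res f (A, B)) \<in> class_functions H \<H>"
  proof (cases "A \<in> gl i")
    case True
    then have "conjugate_by (1\<^sub>m i) A = A" by (intro conjugate_by_one) (auto simp: gl_def)
    then show ?thesis
      using res_conjugate[OF f one_GL _ True] res_outside by (auto simp: class_functions_def)
  qed (simp add: class_functions_def res_outside)
qed

end

section \<open>The parabolic subgroups of the general linear and unitary groups\<close>

lemma adjoint_pair_GL: "adjoint_pair n (GL n) (gl n :: 'a::{finite,field} mat set)"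
  by unfold_locales (auto simp: one_GL mult_GL gl_def conjugate_by_carrier)

lemma strictly_block_upper_2:
  "M \<in> carrier_mat (i + j) (i + j) \<Longrightarrow> strictly_block_upper [i, j] M \<longleftrightarrow>
    upper_at i M \<and> window 0 i M = 0\<^sub>m i i \<and> window i j M = 0\<^sub>m j j"
proof
  assume M: "M \<in> carrier_mat (i + j) (i + j)" and *: "strictly_block_upper [i, j] M"
  show "upper_at i M \<and> window 0 i M = 0\<^sub>m i i \<and> window i j M = 0\<^sub>m j j"
    using M * unfolding upper_at_def strictly_block_upper_def by (auto intro!: eq_matI)
next
  assume M: "M \<in> carrier_mat (i + j) (i + j)"
    and *: "upper_at i M \<and> window 0 i M = 0\<^sub>m i i \<and> window i j M = 0\<^sub>m j j"
  show "strictly_block_upper [i, j] M"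
    unfolding strictly_block_upper_def
  proof safe
    fix r s assume rs: "r < dim_row M" "s < dim_col M" "block_index [i, j] s \<le> block_index [i, j] r"
    consider "r < i" "s < i" | "i \<le> r" "s < i" | "i \<le> r" "i \<le> s"
      using rs(3) by (auto split: if_splits)
    then show "M $$ (r, s) = 0"
    proof cases
      case 1
      then have "window 0 i M $$ (r, s) = 0" using * by simp
      then show ?thesis using 1 by simp
    next
      case 2
      then show ?thesis using * rs by (simp add: upper_at_def)
    next
      case 3
      then have "window i j M $$ (r - i, s - i) = 0" using * M rs by simp
      then show ?thesis using 3 M rs by simp
    qed
  qed
qed

lemma strictly_block_upper_3:
  assumes M: "M \<in> carrier_mat (i + j + k) (i + j + k)"
  shows "strictly_block_upper [i, j, k] M \<longleftrightarrow>
    upper_at i M \<and> upper_at (i + j) M \<and>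
    window 0 i M = 0\<^sub>m i i \<and> window i j M = 0\<^sub>m j j \<and> window (i + j) k M = 0\<^sub>m k k"
proof
  assume *: "strictly_block_upper [i, j, k] M"
  have z: "M $$ (r, s) = 0" if "r < i + j + k" "s < i + j + k"
    "s < i \<or> (s < i + j \<and> i \<le> r) \<or> i + j \<le> r" for r s
  proof -
    have "block_index [i, j, k] s \<le> block_index [i, j, k] r" using that by auto
    then show ?thesis using * M that unfolding strictly_block_upper_def by auto
  qed
  show "upper_at i M \<and> upper_at (i + j) M \<and>
    window 0 i M = 0\<^sub>m i i \<and> window i j M = 0\<^sub>m j j \<and> window (i + j) k M = 0\<^sub>m k k"
    using M z unfolding upper_at_def by (auto intro!: eq_matI)
next
  assume *: "upper_at i M \<and> upper_at (i + j) M \<and>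
    window 0 i M = 0\<^sub>m i i \<and> window i j M = 0\<^sub>m j j \<and> window (i + j) k M = 0\<^sub>m k k"
  show "strictly_block_upper [i, j, k] M"
    unfolding strictly_block_upper_def
  proof safe
    fix r s assume rs: "r < dim_row M" "s < dim_col M"
      "block_index [i, j, k] s \<le> block_index [i, j, k] r"
    consider "r < i" "s < i" | "i \<le> r" "s < i" | "i + j \<le> r" "s < i + j"
      | "i \<le> r" "r < i + j" "i \<le> s" "s < i + j" | "i + j \<le> r" "i + j \<le> s"
      using rs(3) by (simp split: if_splits)
    then show "M $$ (r, s) = 0"
    proof cases
      case 1
      then have "window 0 i M $$ (r, s) = 0" using * by simp
      then show ?thesis using 1 by simp
    next
      case 4
      then have "window i j M $$ (r - i, s - i) = 0" using * M rs by simp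
      then show ?thesis using 4 M rs by simp
    next
      case 5
      then have "window (i + j) k M $$ (r - (i + j), s - (i + j)) = 0" using * M rs by simp
      then show ?thesis using 5 M rs by simp
    qed (use * rs in \<open>simp_all add: upper_at_def\<close>)
  qed
qed

lemma nil_gl_eq: "nil_gl i j = block_fibre (gl (i + j)) i j (0\<^sub>m i i) (0\<^sub>m j j)"
  by (auto simp: nil_gl_def block_fibre_def gl_def strictly_block_upper_2)

lemma P_gl_eq: "P_gl i j = {g \<in> GL (i + j). upper_at i g}"
  by (auto simp: P_gl_def block_upper_2 GL_carrier)

lemma embed_gl_diag3: "embed_gl (A, B) = diag_block_mat [A, B, 0\<^sub>m 0 0]"
  by (simp add: embed_gl_def Let_def)

lemma embed_gl_fibre:
  assumes "A \<in> carrier_mat i i" "B \<in> carrier_mat j j"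
  shows "embed_gl (A, B) \<in> block_fibre (carrier_mat (i + j) (i + j)) i j A B"
  using diag3_carrier[OF assms, of "0\<^sub>m 0 0" 0] diag3_upper[OF assms, of "0\<^sub>m 0 0" 0]
    diag3_windows[OF assms, of "0\<^sub>m 0 0" 0]
  by (simp add: block_fibre_def embed_gl_diag3 del: diag_block_mat.simps)

lemma embed_gl_GL:
  assumes h: "h \<in> GL i" and k: "k \<in> GL j"
  shows "embed_gl (h, k) \<in> GL (i + j)"
proof -
  note c = GL_carrier[OF h] GL_carrier[OF k] and p = minv_props[OF h] minv_props[OF k]
  have "diag_block_mat [h, k, 0\<^sub>m 0 0] * diag_block_mat [minv h, minv k, 0\<^sub>m 0 0]
      = diag_block_mat [h * minv h, k * minv k, 0\<^sub>m 0 0 * 0\<^sub>m 0 0]"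
    using c p by (intro diag3_mult[of _ i _ j _ 0]) auto
  also have "\<dots> = diag_block_mat [1\<^sub>m i, 1\<^sub>m j, 1\<^sub>m 0]"
  proof -
    have "0\<^sub>m 0 0 * 0\<^sub>m 0 0 = (1\<^sub>m 0 :: 'a mat)" by (rule eq_matI) auto
    then show ?thesis using p by simp
  qed
  also have "\<dots> = 1\<^sub>m (i + j)" using diag3_one[of i j 0] by simp
  finally show ?thesis
    unfolding embed_gl_diag3
    using diag3_carrier[of h i k j "0\<^sub>m 0 0" 0] diag3_carrier[of "minv h" i "minv k" j "0\<^sub>m 0 0" 0] c p
    by (intro GL_I[of _ "i + j" "diag_block_mat [minv h, minv k, 0\<^sub>m 0 0]"])
      (simp_all del: diag_block_mat.simps)
qed

lemma parabolic_gl: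
  "parabolic (i + j) j (GL (i + j)) (gl (i + j) :: 'a::{finite,field} mat set) (GL j) (gl j) i
    embed_gl embed_gl"
proof -
  interpret G: adjoint_pair "i + j" "GL (i + j)" "gl (i + j) :: 'a mat set" by (rule adjoint_pair_GL)
  interpret H: adjoint_pair j "GL j" "gl j :: 'a mat set" by (rule adjoint_pair_GL)
  interpret P: matrix_group "i + j" "{g \<in> GL (i + j). upper_at i (g :: 'a mat)}"
    by (rule matrix_group_upper_at) (rule G.matrix_group_axioms)
  show ?thesis
  proof unfold_locales
    fix g :: "'a mat" assume g: "g \<in> GL (i + j)" "upper_at i g"
    show "upper_at (i + j) g" using GL_carrier[OF g(1)] by (rule upper_at_full)
    show "window i j g \<in> GL j"
      using g P.minv_mem[of g] upper_at_full[OF GL_carrier[OF g(1)]]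
        upper_at_full[OF minv_props(1)[OF g(1)]]
      by (intro window_minv(1)[of g "i + j"]) auto
  next
    fix h k :: "'a mat" assume "h \<in> GL i" "k \<in> GL j"
    then show "embed_gl (h, k) \<in> block_fibre (GL (i + j)) i j h k"
      using embed_gl_fibre[of h i k j] embed_gl_GL[of h i k j] GL_carrier by
        (auto simp: block_fibre_def)
  qed (auto simp: gl_def upper_at_full embed_gl_fibre)
qed

context frobenius_field
begin

lemma U_GL: "g \<in> U q n \<Longrightarrow> (g :: 'a mat) \<in> GL n"
  by (simp add: U_def)

lemma adjoint_pair_U: "adjoint_pair n (U q n) (\<uu> q n :: 'a mat set)"
proof
  show "U q n \<subseteq> (GL n :: 'a mat set)" using U_GL by auto
  show "1\<^sub>m n \<in> (U q n :: 'a mat set)" by (simp add: mem_U_iff dagger_one)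
  show "g * h \<in> U q n" if gh: "g \<in> U q n" "h \<in> U q n" for g h :: "'a mat"
  proof -
    have c: "g \<in> carrier_mat n n" "h \<in> carrier_mat n n" "dagger q g * g = 1\<^sub>m n" "dagger q h * h
      = 1\<^sub>m n"
      using gh by (auto simp: mem_U_iff)
    have "dagger q (g * h) * (g * h) = dagger q h * (dagger q g * g) * h"
      using c(1,2) by (simp add: dagger_mult[of _ n] assoc_mult_mat[of _ n n _ n _ n]
        mult_carrier_mat[of _ n n _ n])
    then show ?thesis using c by (simp add: mem_U_iff)
  qed
  show "\<uu> q n \<subseteq> (carrier_mat n n :: 'a mat set)" by (auto simp: mem_u_iff)
  show "conjugate_by g X \<in> \<uu> q n" if g: "g \<in> U q n" and X: "X \<in> \<uu> q n" for g X :: "'a mat"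
  proof -
    have c: "g \<in> carrier_mat n n" "X \<in> carrier_mat n n" "dagger q X = - X"
      using g X by (auto simp: mem_U_iff mem_u_iff)
    have "dagger q (dagger q g * X * g) = dagger q g * (- X) * g"
      using c by (simp add: dagger_mult[of _ n] dagger_dagger[of _ n] assoc_mult_mat[of _ n n _ n _ n]
          mult_carrier_mat[of _ n n _ n])
    also have "\<dots> = - (dagger q g * X * g)"
      using c by simp
    finally show ?thesis using c by (simp add: mem_u_iff conjugate_by_def minv_U[OF g]
      mult_carrier_mat[of _ n n _ n])
  qed
qed

lemma u_upper:
  assumes X: "X \<in> \<uu> q n" "upper_at t (X :: 'a mat)" "t \<le> n"
  shows "upper_at (n - t) X"
proof -
  have "upper_at (n - t) (- X)"
    using dagger_upper_at[OF X(2) _ X(3)] X(1) by (auto simp: mem_u_iff)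
  then show ?thesis by (auto simp: upper_at_def)
qed

text \<open>
  If \<open>g\<close> is block upper triangular then so is its inverse, which is the adjoint of \<open>g\<close> and thus has
  the block boundaries of \<open>g\<close> reflected.
\<close>

lemma U_upper:
  assumes g: "g \<in> U q n" "upper_at t (g :: 'a mat)" "t \<le> n"
  shows "upper_at (n - t) g"
proof -
  interpret adjoint_pair n "U q n" "\<uu> q n :: 'a mat set" by (rule adjoint_pair_U)
  interpret P: matrix_group n "{g \<in> U q n. upper_at t (g :: 'a mat)}"
    by (rule matrix_group_upper_at) (rule matrix_group_axioms)
  have "upper_at t (dagger q g)" using P.minv_mem[of g] g minv_U[OF g(1)] by auto
  then have "upper_at (n - t) (dagger q (dagger q g))"
    using g by (intro dagger_upper_at) (auto simp: mem_U_iff)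
  then show ?thesis using g by (auto simp: mem_U_iff dagger_dagger)
qed

lemma u_add: "X \<in> \<uu> q n \<Longrightarrow> Y \<in> \<uu> q n \<Longrightarrow> X + Y \<in> (\<uu> q n :: 'a mat set)"
  by (auto simp: mem_u_iff dagger_add[of _ n] intro!: eq_matI)

lemma u_uminus: "X \<in> \<uu> q n \<Longrightarrow> - X \<in> (\<uu> q n :: 'a mat set)"
  by (auto simp: mem_u_iff dagger_uminus[of _ n])

lemma block_upper_u:
  assumes "X \<in> carrier_mat (2 * (i + j)) (2 * (i + j))" "upper_at i X \<Longrightarrow> upper_at (2 * (i + j) - i) X"
  shows "block_upper [i, 2 * j, i] (X :: 'a mat) \<longleftrightarrow> upper_at i X"
proof -
  have "2 * (i + j) = i + 2 * j + i" "2 * (i + j) - i = i + 2 * j" by auto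
  then show ?thesis using assms block_upper_3[of X i "2 * j" i] by auto
qed

lemma P_u_eq: "P_u q i j = {g \<in> U q (2 * (i + j)). upper_at i (g :: 'a mat)}"
  using U_upper[of _ "2 * (i + j)" i]
  by (auto simp: P_u_def mem_U_iff block_upper_u)

text \<open>
  The third diagonal block of a matrix in \<open>\<uu>\<close> is minus the adjoint of the first one, so that it
  vanishes with it.
\<close>

lemma nil_u_eq:
  "nil_u q i j = (block_fibre (\<uu> q (2 * (i + j))) i (2 * j) (0\<^sub>m i i) (0\<^sub>m (2 * j) (2
    * j)) :: 'a mat set)"
proof -
  have eq: "2 * (i + j) = i + 2 * j + i" "2 * (i + j) - i = i + 2 * j" by auto
  have "strictly_block_upper [i, 2 * j, i] X \<longleftrightarrow>
      upper_at i X \<and> window 0 i X = 0\<^sub>m i i \<and> window i (2 * j) X = 0\<^sub>m (2 * j) (2 * j)"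
    if X: "X \<in> \<uu> q (2 * (i + j))" for X :: "'a mat"
  proof -
    have c: "X \<in> carrier_mat (2 * (i + j)) (2 * (i + j))" "dagger q X = - X"
      using X by (auto simp: mem_u_iff)
    have "dagger q (window 0 i X) = window (i + 2 * j) i (- X)"
      using dagger_window[OF c(1), of 0 i q] c(2) eq by simp
    then have "dagger q (window 0 i X) = - window (i + 2 * j) i X"
      using window_uminus[OF c(1), of "i + 2 * j" i] by simp
    moreover have "dagger q (0\<^sub>m i i) = (0\<^sub>m i i :: 'a mat)"
      using q_pos by (intro eq_matI) (auto simp: dagger_index[of _ i])
    ultimately have "- window (i + 2 * j) i X = 0\<^sub>m i i" if "window 0 i X = 0\<^sub>m i i"
      using that by simp
    moreover have "window (i + 2 * j) i X = - (- window (i + 2 * j) i X)"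
      by (rule eq_matI) auto
    moreover have "- 0\<^sub>m i i = (0\<^sub>m i i :: 'a mat)"
      by (rule eq_matI) auto
    ultimately have "window (i + 2 * j) i X = 0\<^sub>m i i" if "window 0 i X = 0\<^sub>m i i"
      using that by metis
    then show ?thesis
      using strictly_block_upper_3[of X i "2 * j" i] c(1) u_upper[OF X, of i] eq by auto
  qed
  then show ?thesis by (auto simp: nil_u_def block_fibre_def)
qed

definition lift_u :: "'a mat \<times> 'a mat \<Rightarrow> 'a mat" where
  "lift_u = (\<lambda>(h, k). diag_block_mat [h, k, dagger q (minv h)])"

text \<open>
  The third block of \<open>lift_u\<close> is the only one for which a block diagonal matrix is unitary.
\<close>

lemma lift_u_fibre:
  assumes h: "h \<in> GL i" and k: "k \<in> U q (2 * j)"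
  shows "lift_u (h, k) \<in> block_fibre (U q (2 * (i + j))) i (2 * j) h k"
proof -
  have c: "h \<in> carrier_mat i i" "k \<in> carrier_mat (2 * j) (2 * j)" "dagger q (minv h) \<in> carrier_mat i i"
    and p: "minv h \<in> carrier_mat i i" "h * minv h = 1\<^sub>m i" "minv h * h = 1\<^sub>m i"
    using h k minv_props[OF h] by (auto simp: mem_U_iff GL_carrier)
  have eq: "2 * (i + j) = i + 2 * j + i" by simp
  let ?D = "diag_block_mat [h, k, dagger q (minv h)]"
  have "dagger q ?D * ?D = diag_block_mat [minv h, dagger q k, dagger q h] * ?D"
    using dagger_diag3[OF c] p by (simp add: dagger_dagger[of _ i] del: diag_block_mat.simps)
  also have "\<dots> = diag_block_mat [minv h * h, dagger q k * k, dagger q h * dagger q (minv h)]"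
    using c p by (intro diag3_mult[of _ i _ "2 * j" _ i]) auto
  also have "\<dots> = diag_block_mat [1\<^sub>m i, 1\<^sub>m (2 * j), 1\<^sub>m i]"
    using k p c dagger_mult[OF p(1) c(1)] by (simp add: mem_U_iff dagger_one del: diag_block_mat.simps)
  finally have "dagger q ?D * ?D = 1\<^sub>m (2 * (i + j))"
    unfolding eq diag3_one .
  then have "?D \<in> U q (2 * (i + j))"
    using diag3_carrier[OF c] by (simp add: mem_U_iff eq del: diag_block_mat.simps)
  then show ?thesis
    using diag3_upper(1)[OF c] diag3_windows(1,2)[OF c]
    by (simp add: block_fibre_def lift_u_def del: diag_block_mat.simps)
qed

lemma embed_u_fibre:
  assumes A: "(A :: 'a mat) \<in> gl i" and B: "B \<in> \<uu> q (2 * j)"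
  shows "embed_u q i (A, B) \<in> block_fibre (\<uu> q (2 * (i + j))) i (2 * j) A B"
proof -
  have c: "A \<in> carrier_mat i i" "B \<in> carrier_mat (2 * j) (2 * j)" "- dagger q A \<in> carrier_mat i i"
    and dB: "dagger q B = - B"
    using A B by (auto simp: mem_u_iff gl_def)
  have eq: "2 * (i + j) = i + 2 * j + i" by simp
  let ?D = "diag_block_mat [A, B, - dagger q A]"
  have "dagger q ?D = diag_block_mat [- A, - B, dagger q A]"
    using dagger_diag3[OF c] c dB
    by (simp add: dagger_dagger[of _ i] dagger_uminus[of _ i] del: diag_block_mat.simps)
  also have "\<dots> = - ?D"
  proof -
    have c': "- A \<in> carrier_mat i i" "- B \<in> carrier_mat (2 * j) (2 * j)" "dagger q A \<in> carrier_mat i i"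
      using c by auto
    show ?thesis
      by (rule eq_matI) (use diag3_carrier[OF c] diag3_carrier[OF c'] c in
        \<open>auto simp: diag3_index[OF c] diag3_index[OF c'] simp del: diag_block_mat.simps\<close>)
  qed
  finally have "?D \<in> \<uu> q (2 * (i + j))"
    using diag3_carrier[OF c] by (simp add: mem_u_iff eq del: diag_block_mat.simps)
  then show ?thesis
    using diag3_upper(1)[OF c] diag3_windows(1,2)[OF c] J_adj_J[OF c(1)]
    by (simp add: block_fibre_def embed_u_def del: diag_block_mat.simps)
qed

lemma parabolic_u:
  "parabolic (2 * (i + j)) (2 * j) (U q (2 * (i + j))) (\<uu> q (2 * (i + j)) :: 'a mat set)
     (U q (2 * j)) (\<uu> q (2 * j)) i (embed_u q i) lift_u"
proof -
  let ?n = "2 * (i + j)"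
  interpret G: adjoint_pair ?n "U q ?n" "\<uu> q ?n :: 'a mat set" by (rule adjoint_pair_U)
  interpret H: adjoint_pair "2 * j" "U q (2 * j)" "\<uu> q (2 * j) :: 'a mat set" by (rule adjoint_pair_U)
  have eq: "?n - i = i + 2 * j" "?n - i - 2 * j = i" by auto
  show ?thesis
  proof unfold_locales
    fix X :: "'a mat" assume X: "X \<in> \<uu> q ?n" "upper_at i X"
    show "upper_at (i + 2 * j) X" using u_upper[OF X] eq by simp
    show "window i (2 * j) X \<in> \<uu> q (2 * j)"
      using X(1) dagger_window[of X ?n i "2 * j" q] window_uminus[of X ?n i "2 * j"] eq
      by (auto simp: mem_u_iff)
  next
    fix g :: "'a mat" assume g: "g \<in> U q ?n" "upper_at i g"
    have c: "g \<in> carrier_mat ?n ?n" "dagger q g * g = 1\<^sub>m ?n" using g by (auto simp: mem_U_iff)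
    show u: "upper_at (i + 2 * j) g" using U_upper[OF g] eq by simp
    have "upper_at i (dagger q g)"
      using dagger_upper_at[OF u c(1)] eq by simp
    then have "window i (2 * j) (dagger q g * g) = window i (2 * j) (dagger q g) * window i (2 * j) g"
      using c u by (intro window_mult[of _ ?n]) auto
    then show "window i (2 * j) g \<in> U q (2 * j)"
      using c dagger_window[of g ?n i "2 * j" q] eq by (simp add: mem_U_iff)
  next
    show "embed_u q i (A, B) \<in> block_fibre (\<uu> q ?n) i (2 * j) A B"
      if "A \<in> gl i" "B \<in> \<uu> q (2 * j)" for A B :: "'a mat"
      using that by (rule embed_u_fibre)
    show "lift_u (h, k) \<in> block_fibre (U q ?n) i (2 * j) h k"
      if "h \<in> GL i" "k \<in> U q (2 * j)" for h k :: "'a mat"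
      using that by (rule lift_u_fibre)
  qed (auto simp: u_add u_uminus)
qed

end

(* Simplification must keep the sizes 2 * (i + j) in the form in which they index the spaces. *)
declare distrib_left_numeral [simp del]

section \<open>Linearity of induction\<close>

lemma par_ind_push_linear:
  "par_ind G P \<G> \<L> \<U> (push S \<iota> (\<lambda>x. \<Sum>s\<in>I. c s * T s x)) X
    = (\<Sum>s\<in>I. c s * par_ind G P \<G> \<L> \<U> (push S \<iota> (T s)) X)"
proof -
  have push: "push S \<iota> (\<lambda>x. \<Sum>s\<in>I. c s * T s x) y = (\<Sum>s\<in>I. c s * push S \<iota> (T s) y)" for y
    by (simp add: push_def)
  have infl: "inflate \<L> \<U> (push S \<iota> (\<lambda>x. \<Sum>s\<in>I. c s * T s x)) Y
      = (\<Sum>s\<in>I. c s * inflate \<L> \<U> (push S \<iota> (T s)) Y)" for Y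
    by (simp add: inflate_def push)
  have "(\<Sum>C\<in>left_cosets G P. \<Sum>s\<in>I. c s * inflate \<L> \<U> (push S \<iota> (T s)) (conjugate_by (SOME g. g \<in> C) X))
      = (\<Sum>s\<in>I. \<Sum>C\<in>left_cosets G P. c s * inflate \<L> \<U> (push S \<iota> (T s)) (conjugate_by (SOME g. g \<in> C) X))"
    by (rule sum.swap)
  then show ?thesis by (simp add: par_ind_def infl sum_distrib_left)
qed

lemma ind_gl_linear:
  "ind_gl i j (\<lambda>x. \<Sum>s\<in>I. c s * T s x) X = (\<Sum>s\<in>I. c s * ind_gl i j (T s) X)"
  unfolding ind_gl_def by (rule par_ind_push_linear)

lemma ind_u_linear:
  "ind_u q i j (\<lambda>x. \<Sum>s\<in>I. c s * T s x) X = (\<Sum>s\<in>I. c s * ind_u q i j (T s) X)"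
  unfolding ind_u_def by (rule par_ind_push_linear)

lemma ind_gl_scale: "ind_gl i j (\<lambda>x. T x * c) X = ind_gl i j T X * c"
  using ind_gl_linear[of i j "\<lambda>_. c" "\<lambda>_. T" "{()}" X] by (simp add: mult.commute)

lemma ind_u_scale: "ind_u q i j (\<lambda>x. c * T x) X = c * ind_u q i j T X"
  using ind_u_linear[of q i j "\<lambda>_. c" "\<lambda>_. T" "{()}" X] by simp

lemma ind_u_add: "ind_u q i j (\<lambda>x. T x + T' x) X = ind_u q i j T X + ind_u q i j T' X"
  using ind_u_linear[of q i j "\<lambda>_. 1" "\<lambda>b. if b then T else T'" "{True, False}" X] by simp

lemma ind_u_zero: "ind_u q i j (\<lambda>_. 0) X = 0"
  using ind_u_linear[of q i j _ _ "{}" X] by simp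

lemma ind_u_sum: "ind_u q i j (\<lambda>x. \<Sum>s\<in>I. T s x) X = (\<Sum>s\<in>I. ind_u q i j (T s) X)"
  using ind_u_linear[of q i j "\<lambda>_. 1" T I X] by simp

lemma nabla_u_add: "nabla_u q (T + T') = nabla_u q T + nabla_u q T'"
  by (auto simp: nabla_u_def ind_u_add split_def sum.distrib)

lemma nabla_u_scale: "nabla_u q (c *\<^sub>R T) = c *\<^sub>R nabla_u q T"
  by (auto simp: nabla_u_def ind_u_scale split_def sum_distrib_left scaleR_fun_def)

lemma nabla_u_scale': "nabla_u q (\<lambda>x. c * T x) y = c * nabla_u q T y"
  using fun_cong[OF nabla_u_scale[of q c T], of y] by (simp add: scaleR_fun_def)

lemma subspace_direct_sum: "(\<And>n. subspace (V n)) \<Longrightarrow> subspace (direct_sum V)"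
proof -
  assume V: "\<And>n. subspace (V n)"
  show ?thesis
  proof (rule subspaceI)
    show "0 \<in> direct_sum V"
      using subspace_0[OF V] by (simp add: direct_sum_def zero_fun_def)
  next
    fix a b assume ab: "a \<in> direct_sum V" "b \<in> direct_sum V"
    have "{n. \<exists>x. (a + b) (n, x) \<noteq> 0} \<subseteq> {n. \<exists>x. a (n, x) \<noteq> 0} \<union> {n. \<exists>x. b (n, x) \<noteq> 0}"
      by auto
    then have "finite {n. \<exists>x. (a + b) (n, x) \<noteq> 0}"
      by (rule finite_subset) (use ab in \<open>simp add: direct_sum_def\<close>)
    moreover have "(\<lambda>x. (a + b) (n, x)) \<in> V n" for n
      using subspace_add[OF V, of "\<lambda>x. a (n, x)" n "\<lambda>x. b (n, x)"] ab
      by (simp add: direct_sum_def plus_fun_def)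
    ultimately show "a + b \<in> direct_sum V" by (simp add: direct_sum_def)
  next
    fix c a assume a: "a \<in> direct_sum V"
    have "{n. \<exists>x. (c *\<^sub>R a) (n, x) \<noteq> 0} \<subseteq> {n. \<exists>x. a (n, x) \<noteq> 0}"
      by (auto simp: scaleR_fun_def)
    then have "finite {n. \<exists>x. (c *\<^sub>R a) (n, x) \<noteq> 0}"
      by (rule finite_subset) (use a in \<open>simp add: direct_sum_def\<close>)
    moreover have "(\<lambda>x. (c *\<^sub>R a) (n, x)) \<in> V n" for n
      using subspace_scale[OF V, of "\<lambda>x. a (n, x)" n c] a
      by (simp add: direct_sum_def scaleR_fun_def)
    ultimately show "c *\<^sub>R a \<in> direct_sum V" by (simp add: direct_sum_def)
  qed
qed

lemma subspace_graded_part: "(\<And>n. subspace (V n)) \<Longrightarrow> subspace (graded_part V n)"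
  using subspace_direct_sum[of V] unfolding graded_part_def subspace_def
  by (auto simp: scaleR_fun_def)

lemma graded_part_sub: "graded_part V n \<subseteq> direct_sum V"
  by (auto simp: graded_part_def)

lemma tensor_mono: "V \<subseteq> V' \<Longrightarrow> W \<subseteq> W' \<Longrightarrow> tensor V W \<subseteq> tensor V' W'"
  unfolding tensor_def by (intro span_mono) blast

lemma subspace_Agr: "subspace (Agr n)" and subspace_Bgr: "subspace (Bgr q n)"
  unfolding Agr_def Bgr_def by (rule subspace_class_functions)+

lemma window_gl: "window l m X \<in> gl m"
  by (simp add: gl_def)

lemma block_size_le:
  "i + j \<le> 2 * (i + j + k)" "i + 2 * (j + k) \<le> 2 * (i + (j + k))" "j \<le> 2 * (j + k)"
  "j + 2 * k \<le> 2 * (j + k)" for i j k :: nat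
  by (simp_all add: distrib_left_numeral)

context frobenius_field
begin

section \<open>Induction in stages\<close>

lemma unit_A_Agr: "(\<lambda>X. unit_A (0, X)) \<in> (Agr 0 :: ('a mat \<Rightarrow> real) set)"
  by (auto simp: unit_A_def Agr_def class_functions_def gl_def conjugate_by_carrier)

lemma ind_u_class_function:
  assumes a: "a \<in> Agr i" and b: "b \<in> (Bgr q j :: ('a mat \<Rightarrow> real) set)"
  shows "ind_u q i j (\<lambda>(A, B). a A * b B) \<in> Bgr q (i + j)"
proof -
  interpret M: parabolic "2 * (i + j)" "2 * j" "U q (2 * (i + j))" "\<uu> q (2 * (i + j)) :: 'a mat set"
     "U q (2 * j)" "\<uu> q (2 * j)" i "embed_u q i" lift_u by (rule parabolic_u)
  have "ind_u q i j T = M.ind T" for T :: "'a mat \<times> 'a mat \<Rightarrow> real"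
    unfolding ind_u_def M.ind_def levi_u_def nil_u_eq P_u_eq M.P_def ..
  moreover have "M.biinvariant (\<lambda>(A, B). a A * b B)"
    using a b unfolding Agr_def Bgr_def by (rule M.biinvariant_pure)
  ultimately show ?thesis
    unfolding Bgr_def using M.ind_class_function by simp
qed

text \<open>
  For \<open>i = 0\<close> the parabolic subgroup is the whole group, and the function being averaged is already
  invariant.
\<close>

lemma ind_u_unit:
  assumes b: "b \<in> (Bgr q j :: ('a mat \<Rightarrow> real) set)"
  shows "ind_u q 0 j (\<lambda>(A, B). unit_A (0, A) * b B) X = b X"
proof -
  interpret M: parabolic "2 * (0 + j)" "2 * j" "U q (2 * (0 + j))" "\<uu> q (2 * (0 + j)) :: 'a mat set"
     "U q (2 * j)" "\<uu> q (2 * j)" 0 "embed_u q 0" lift_u by (rule parabolic_u)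
  let ?T = "\<lambda>(A, B). unit_A (0, A) * b B"
  have eq: "ind_u q 0 j ?T = M.ind ?T"
    unfolding ind_u_def M.ind_def levi_u_def nil_u_eq P_u_eq M.P_def ..
  have bi: "M.biinvariant ?T"
    using unit_A_Agr b unfolding Agr_def Bgr_def by (rule M.biinvariant_pure)
  have P: "M.P = U q (2 * j)" unfolding M.P_def by simp
  have spread: "M.spread ?T Y = b Y" if "Y \<in> \<uu> q (2 * j)" for Y
    using that unfolding M.spread_def by (simp add: unit_A_def gl_def window_full u_carrier)
  show ?thesis
  proof (cases "X \<in> \<uu> q (2 * j)")
    case True
    then have "(\<Sum>g\<in>U q (2 * j). M.spread ?T (conjugate_by g X)) = (\<Sum>g\<in>(U q (2 * j) :: 'a mat set). b X)"
      using b M.H.conj_mem by (intro sum.cong) (auto simp: spread Bgr_def class_functions_def)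
    then show ?thesis
      using True M.H.card_pos unfolding eq M.ind_eq[OF bi] P by simp
  next
    case False
    then show ?thesis
      using b unfolding eq M.ind_eq[OF bi] by (simp add: Bgr_def class_functions_def)
  qed
qed

text \<open>
  The inflation of \<open>a \<otimes> a' \<otimes> b\<close> from the Levi algebra of the finer parabolic subalgebra with block
  sizes \<open>i, j, 2 * k, j, i\<close>; on \<open>\<uu>\<close> the last two boundaries follow from the first two by symmetry.
\<close>

definition flag_function ::
  "nat \<Rightarrow> nat \<Rightarrow> nat \<Rightarrow> ('a mat \<Rightarrow> real) \<Rightarrow> ('a mat \<Rightarrow> real) \<Rightarrow> ('a mat \<Rightarrow> real) \<Rightarrow> 'a mat \<Rightarrow> real" where
  "flag_function i j k a a' b Y = (if upper_at i Y \<and> upper_at (i + j) Y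
     then a (window 0 i Y) * a' (window i j Y) * b (window (i + j) (2 * k) Y) else 0)"

text \<open>
  Parabolic induction from the finer parabolic subalgebra in the form of lemma \<open>ind_eq\<close>: a sum over
  the whole group, divided by the order of the finer parabolic subgroup.
\<close>

definition flag_ind ::
  "nat \<Rightarrow> nat \<Rightarrow> nat \<Rightarrow> ('a mat \<Rightarrow> real) \<Rightarrow> ('a mat \<Rightarrow> real) \<Rightarrow> ('a mat \<Rightarrow> real) \<Rightarrow> 'a mat \<Rightarrow> real" where
  "flag_ind i j k a a' b X = (if X \<in> \<uu> q (2 * (i + j + k)) then
     (\<Sum>g\<in>U q (2 * (i + j + k)). flag_function i j k a a' b (conjugate_by g X))
       / real (card {g \<in> U q (2 * (i + j + k)). upper_at i g \<and> upper_at (i + j) (g :: 'a mat)}) else 0)"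

text \<open>
  The inner sum over \<open>GL (i + j)\<close> is absorbed by lemma \<open>sum_spread_average_left\<close>. The normalising
  factor is right because the finer parabolic subgroup is the preimage of \<open>P_gl i j\<close> under the
  projection of \<open>P_u q (i + j) k\<close> to \<open>GL (i + j)\<close>, and the orders of such preimages are known.
\<close>

lemma ind_left_eq_flag_ind:
  assumes a: "a \<in> Agr i" and a': "a' \<in> Agr j" and b: "b \<in> (Bgr q k :: ('a mat \<Rightarrow> real) set)"
  shows "ind_u q (i + j) k (\<lambda>(A, C). ind_gl i j (\<lambda>(A, B). a A * a' B) A * b C) X =
    flag_ind i j k a a' b X"
proof -
  interpret L: parabolic "2 * (i + j + k)" "2 * k" "U q (2 * (i + j + k))" "\<uu> q (2
    * (i + j + k)) :: 'a mat set"
     "U q (2 * k)" "\<uu> q (2 * k)" "i + j" "embed_u q (i + j)" lift_u by (rule parabolic_u)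
  interpret M: parabolic "i + j" j "GL (i + j)" "gl (i + j) :: 'a mat set" "GL j" "gl j" i
    embed_gl embed_gl
    by (rule parabolic_gl)
  let ?G = "U q (2 * (i + j + k)) :: 'a mat set" and ?T = "\<lambda>(A, B). a A * a' B"
  have M_ind: "ind_gl i j ?T = M.ind ?T"
    unfolding ind_gl_def M.ind_def levi_gl_def nil_gl_eq P_gl_eq M.P_def ..
  have M_bi: "M.biinvariant ?T"
    using a a' unfolding Agr_def by (rule M.biinvariant_pure)
  have L_ind: "ind_u q (i + j) k T = L.ind T" for T :: "'a mat \<times> 'a mat \<Rightarrow> real"
    unfolding ind_u_def L.ind_def levi_u_def nil_u_eq P_u_eq L.P_def ..
  have L_bi: "L.biinvariant (\<lambda>(A, C). M.ind ?T A * b C)"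
    using M.ind_class_function[OF M_bi] b unfolding Bgr_def by (rule L.biinvariant_pure)
  let ?S = "\<lambda>(A, C). M.spread ?T A * b C"
  have flag: "L.spread ?S Y = flag_function i j k a a' b Y" if Y: "Y \<in> \<uu> q (2 * (i + j + k))" for Y
  proof (cases "upper_at (i + j) Y")
    case True
    have "upper_at i (window 0 (i + j) Y) \<longleftrightarrow> upper_at i Y"
      using upper_at_window[of Y "2 * (i + j + k)" 0 "i + j" i] u_carrier[OF Y] True
      by (simp add: block_size_le)
    then show ?thesis
      using True by (simp add: L.spread_def M.spread_def flag_function_def window_window)
  qed (simp add: L.spread_def flag_function_def)
  have Q: "{p \<in> L.P. window 0 (i + j) p \<in> M.P} = {g \<in> ?G. upper_at i g \<and> upper_at (i + j) g}"
  proof -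
    have "window 0 (i + j) g \<in> M.P \<longleftrightarrow> upper_at i g" if "g \<in> L.P" for g
      using L.P_windows(1)[OF that] L.P.mem_carrier[OF that] L.P_props(2)[OF that]
        upper_at_window[of g "2 * (i + j + k)" 0 "i + j" i] by (simp add: M.P_def block_size_le)
    then show ?thesis by (auto simp: L.P_def)
  qed
  have count: "real (card {g \<in> ?G. upper_at i g \<and> upper_at (i + j) g})
    * real (card (GL (i + j) :: 'a mat set))
      = real (card L.P) * real (card M.P)"
    using L.card_window_0[OF M.P_G] unfolding Q by (simp only: of_nat_mult[symmetric] of_nat_eq_iff)
  show ?thesis
  proof (cases "X \<in> \<uu> q (2 * (i + j + k))")
    case X: True
    have "(\<Sum>g\<in>?G. L.spread (\<lambda>(A, C). M.ind ?T A * b C) (conjugate_by g X))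
        = (\<Sum>g\<in>?G. 1 / real (card M.P) * L.spread (\<lambda>(A, C). \<Sum>h\<in>GL (i + j). ?S (conjugate_by h A, C))
          (conjugate_by g X))"
      using L.G.conj_mem[OF _ X]
      by (intro sum.cong refl) (auto simp: L.spread_def M.ind_eq[OF M_bi] window_gl
        sum_distrib_right sum_divide_distrib)
    also have "\<dots> = 1 / real (card M.P) * (real (card (GL (i + j) :: 'a mat set)) *
      (\<Sum>g\<in>?G. L.spread ?S (conjugate_by g X)))"
      unfolding sum_distrib_left[symmetric] L.sum_spread_average_left[OF X] ..
    also have "(\<Sum>g\<in>?G. L.spread ?S (conjugate_by g X)) = (\<Sum>g\<in>?G. flag_function i j k a a' b
      (conjugate_by g X))"
      using L.G.conj_mem[OF _ X] flag by (intro sum.cong) auto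
    finally have "L.ind (\<lambda>(A, C). M.ind ?T A * b C) X
        = real (card (GL (i + j) :: 'a mat set)) / (real (card L.P) * real (card M.P))
          * (\<Sum>g\<in>?G. flag_function i j k a a' b (conjugate_by g X))"
      using X by (simp add: L.ind_eq[OF L_bi])
    then show ?thesis
      using X M.G.card_pos unfolding count[symmetric] L_ind M_ind flag_ind_def by simp
  next
    case False
    then show ?thesis unfolding L_ind M_ind L.ind_eq[OF L_bi] flag_ind_def by simp
  qed
qed

text \<open>
  The same argument with the second Levi factor \<open>U q (2 * (j + k))\<close>, where the finer parabolic
  subgroup is the preimage of \<open>P_u q j k\<close>.
\<close>

lemma ind_right_eq_flag_ind:
  assumes a: "a \<in> Agr i" and a': "a' \<in> Agr j" and b: "b \<in> (Bgr q k :: ('a mat \<Rightarrow> real) set)"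
  shows "ind_u q i (j + k) (\<lambda>(A, Y). a A * ind_u q j k (\<lambda>(B, C). a' B * b C) Y) X =
    flag_ind i j k a a' b X"
proof -
  have assoc: "i + j + k = i + (j + k)" by simp
  interpret L: parabolic "2 * (i + (j + k))" "2 * (j + k)" "U q (2 * (i + (j + k)))"
     "\<uu> q (2 * (i + (j + k))) :: 'a mat set" "U q (2 * (j + k))" "\<uu> q (2 * (j + k))" i
       "embed_u q i" lift_u
    by (rule parabolic_u)
  interpret M: parabolic "2 * (j + k)" "2 * k" "U q (2 * (j + k))" "\<uu> q (2 * (j + k)) :: 'a mat set"
     "U q (2 * k)" "\<uu> q (2 * k)" j "embed_u q j" lift_u by (rule parabolic_u)
  let ?n = "2 * (i + (j + k))"
  let ?G = "U q ?n :: 'a mat set" and ?H = "U q (2 * (j + k)) :: 'a mat set" and ?T = "\<lambda>(B, C). a' B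
    * b C"
  have M_ind: "ind_u q j k ?T = M.ind ?T"
    unfolding ind_u_def M.ind_def levi_u_def nil_u_eq P_u_eq M.P_def ..
  have M_bi: "M.biinvariant ?T"
    using a' b unfolding Agr_def Bgr_def by (rule M.biinvariant_pure)
  have L_ind: "ind_u q i (j + k) T = L.ind T" for T :: "'a mat \<times> 'a mat \<Rightarrow> real"
    unfolding ind_u_def L.ind_def levi_u_def nil_u_eq P_u_eq L.P_def ..
  have L_bi: "L.biinvariant (\<lambda>(A, Y). a A * M.ind ?T Y)"
    using a M.ind_class_function[OF M_bi] unfolding Agr_def by (rule L.biinvariant_pure)
  let ?S = "\<lambda>(A, Y). a A * M.spread ?T Y"
  have upper: "upper_at j (window i (2 * (j + k)) Y) \<longleftrightarrow> upper_at (i + j) Y"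
    if "Y \<in> carrier_mat ?n ?n" "upper_at i Y" "upper_at (i + 2 * (j + k)) Y" for Y :: "'a mat"
    using upper_at_window[of Y ?n i "2 * (j + k)" j] that by (simp add: block_size_le)
  have flag: "L.spread ?S Y = flag_function i j k a a' b Y" if Y: "Y \<in> \<uu> q ?n" for Y
  proof (cases "upper_at i Y")
    case True
    then show ?thesis
      using upper[OF u_carrier[OF Y] True L.lie_upper[OF Y True]]
      unfolding L.spread_def M.spread_def flag_function_def by (simp add: window_window block_size_le)
  qed (simp add: L.spread_def flag_function_def)
  have Q: "{p \<in> L.P. window i (2 * (j + k)) p \<in> M.P} = {g \<in> ?G. upper_at i g \<and> upper_at (i + j) g}"
  proof -
    have "window i (2 * (j + k)) g \<in> M.P \<longleftrightarrow> upper_at (i + j) g" if "g \<in> L.P" for g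
      using L.P_windows(2)[OF that] upper[OF L.P.mem_carrier[OF that] L.P_props(2,4)[OF that]]
      by (simp add: M.P_def)
    then show ?thesis by (auto simp: L.P_def)
  qed
  have count: "real (card {g \<in> ?G. upper_at i g \<and> upper_at (i + j) g}) * real (card ?H)
      = real (card L.P) * real (card M.P)"
    using L.card_window_i[OF M.P_G] unfolding Q by (simp only: of_nat_mult[symmetric] of_nat_eq_iff)
  show ?thesis
  proof (cases "X \<in> \<uu> q ?n")
    case X: True
    have "(\<Sum>g\<in>?G. L.spread (\<lambda>(A, Y). a A * M.ind ?T Y) (conjugate_by g X))
        = (\<Sum>g\<in>?G. 1 / real (card M.P) * L.spread (\<lambda>(A, Y). \<Sum>h\<in>?H. ?S (A, conjugate_by h Y))
          (conjugate_by g X))"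
      using L.G.conj_mem[OF _ X] L.lie_window
      by (intro sum.cong refl) (auto simp: L.spread_def M.ind_eq[OF M_bi] sum_distrib_left
        sum_divide_distrib)
    also have "\<dots> = 1 / real (card M.P) * (real (card ?H) * (\<Sum>g\<in>?G. L.spread ?S (conjugate_by g X)))"
      unfolding sum_distrib_left[symmetric] L.sum_spread_average_right[OF X] ..
    also have "(\<Sum>g\<in>?G. L.spread ?S (conjugate_by g X)) = (\<Sum>g\<in>?G. flag_function i j k a a' b
      (conjugate_by g X))"
      using L.G.conj_mem[OF _ X] flag by (intro sum.cong) auto
    finally have "L.ind (\<lambda>(A, Y). a A * M.ind ?T Y) X
        = real (card ?H) / (real (card L.P) * real (card M.P))
          * (\<Sum>g\<in>?G. flag_function i j k a a' b (conjugate_by g X))"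
      using X by (simp add: L.ind_eq[OF L_bi])
    then show ?thesis
      using X L.H.card_pos unfolding count[symmetric] L_ind M_ind flag_ind_def assoc by simp
  next
    case False
    then show ?thesis unfolding L_ind M_ind L.ind_eq[OF L_bi] flag_ind_def assoc by simp
  qed
qed

section \<open>Restriction in stages\<close>

lemma res_gl_eq:
  "res_gl i j \<Psi> (A, B :: 'a mat) = (\<Sum>X\<in>block_fibre (gl (i + j)) i j A B. \<Psi> X) / real (card (nil_gl i
    j :: 'a mat set))"
proof -
  interpret M: parabolic "i + j" j "GL (i + j)" "gl (i + j) :: 'a mat set" "GL j" "gl j" i
    embed_gl embed_gl
    by (rule parabolic_gl)
  show ?thesis unfolding res_gl_def levi_gl_def nil_gl_eq by (rule M.restriction_eq)
qed

lemma res_u_eq: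
  "res_u q i j \<Psi> (A, B :: 'a mat)
     = (\<Sum>X\<in>block_fibre (\<uu> q (2 * (i + j))) i (2
       * j) A B. \<Psi> X) / real (card (nil_u q i j :: 'a mat set))"
proof -
  interpret M: parabolic "2 * (i + j)" "2 * j" "U q (2 * (i + j))" "\<uu> q (2 * (i + j)) :: 'a mat set"
     "U q (2 * j)" "\<uu> q (2 * j)" i "embed_u q i" lift_u by (rule parabolic_u)
  show ?thesis unfolding res_u_def levi_u_def nil_u_eq by (rule M.restriction_eq)
qed

lemma res_u_class_function:
  assumes f: "f \<in> (Bgr q (i + j) :: ('a mat \<Rightarrow> real) set)"
  shows "(\<lambda>A. res_u q i j f (A, B)) \<in> Agr i" "(\<lambda>B. res_u q i j f (A, B)) \<in> Bgr q j"
proof -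
  interpret M: parabolic "2 * (i + j)" "2 * j" "U q (2 * (i + j))" "\<uu> q (2 * (i + j)) :: 'a mat set"
     "U q (2 * j)" "\<uu> q (2 * j)" i "embed_u q i" lift_u by (rule parabolic_u)
  have "res_u q i j f = M.res f"
    unfolding res_u_def M.res_def levi_u_def nil_u_eq ..
  then show "(\<lambda>A. res_u q i j f (A, B)) \<in> Agr i" "(\<lambda>B. res_u q i j f (A, B)) \<in> Bgr q j"
    using M.res_class_function[of f] f by (simp_all add: Agr_def Bgr_def)
qed

text \<open>
  The fibre of the finer parabolic subalgebra over a triple of diagonal blocks.
\<close>

definition flag_fibre :: "nat \<Rightarrow> nat \<Rightarrow> nat \<Rightarrow> 'a mat \<Rightarrow> 'a mat \<Rightarrow> 'a mat \<Rightarrow> 'a mat set" where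
  "flag_fibre i j k A B C = {X \<in> \<uu> q (2 * (i + j + k)). upper_at i X \<and> upper_at (i + j) X
     \<and> window 0 i X = A \<and> window i j X = B \<and> window (i + j) (2 * k) X = C}"

lemma finite_flag_fibre: "finite (flag_fibre i j k A B C)"
  by (rule finite_subset[OF _ finite_carrier_mat[of "2 * (i + j + k)" "2 * (i + j + k)"]])
    (auto simp: flag_fibre_def u_carrier)

lemma finite_block_fibre: "\<G> \<subseteq> carrier_mat n n \<Longrightarrow> finite (block_fibre \<G> i m A B :: 'a mat set)"
  by (rule finite_subset[OF _ finite_carrier_mat[of n n]]) (auto simp: block_fibre_def)

text \<open>
  Grouping the matrices in the fibre of the finer parabolic subalgebra by their leading block of
  size \<open>i + j\<close>.
\<close>

lemma sum_fibre_left: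
  "(\<Sum>Y\<in>block_fibre (gl (i + j)) i j A B. \<Sum>X\<in>block_fibre (\<uu> q (2 * (i + j + k))) (i + j) (2
    * k) Y C. f X)
    = (\<Sum>X\<in>flag_fibre i j k A B C. f X :: real)"
proof -
  have u: "upper_at i (window 0 (i + j) X) \<longleftrightarrow> upper_at i X"
    if "X \<in> \<uu> q (2 * (i + j + k))" "upper_at (i + j) X" for X :: "'a mat"
    using upper_at_window[of X "2 * (i + j + k)" 0 "i + j" i] that u_carrier[OF that(1)]
    by (simp add: block_size_le)
  have "(\<Sum>Y\<in>block_fibre (gl (i + j)) i j A B. \<Sum>X\<in>{X \<in> flag_fibre i j k A B C. window 0 (i + j) X
    = Y}. f X)
     = (\<Sum>X\<in>flag_fibre i j k A B C. f X)"
    by (rule sum.group[OF finite_flag_fibre finite_block_fibre[of _ "i + j"]])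
      (auto simp: flag_fibre_def block_fibre_def gl_def u window_window)
  moreover have "{X \<in> flag_fibre i j k A B C. window 0 (i + j) X = Y}
      = block_fibre (\<uu> q (2 * (i + j + k))) (i + j) (2 * k) Y C" if
        "Y \<in> block_fibre (gl (i + j)) i j A B" for Y
    using that u by (auto simp: flag_fibre_def block_fibre_def window_window)
  ultimately show ?thesis by simp
qed

text \<open>
  Grouping the same matrices by their middle block of size \<open>2 * (j + k)\<close>.
\<close>

lemma sum_fibre_right:
  "(\<Sum>Y\<in>block_fibre (\<uu> q (2 * (j + k))) j (2 * k) B C.
      \<Sum>X\<in>block_fibre (\<uu> q (2 * (i + (j + k)))) i (2 * (j + k)) A Y. f X)
    = (\<Sum>X\<in>flag_fibre i j k A B C. f X :: real)"
proof -
  have assoc: "i + j + k = i + (j + k)" by simp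
  let ?n = "2 * (i + (j + k))"
  interpret L: parabolic ?n "2 * (j + k)" "U q ?n" "\<uu> q ?n :: 'a mat set" "U q (2 * (j + k))"
    "\<uu> q (2 * (j + k))"
    i "embed_u q i" lift_u by (rule parabolic_u)
  have u: "upper_at j (window i (2 * (j + k)) X) \<longleftrightarrow> upper_at (i + j) X"
    if "X \<in> \<uu> q ?n" "upper_at i X" for X :: "'a mat"
    using upper_at_window[of X ?n i "2 * (j + k)" j] that u_carrier[OF that(1)] L.lie_upper
    by (simp add: block_size_le)
  have "(\<Sum>Y\<in>block_fibre (\<uu> q (2 * (j + k))) j (2 * k) B C.
      \<Sum>X\<in>{X \<in> flag_fibre i j k A B C. window i (2 * (j + k)) X = Y}. f X)
     = (\<Sum>X\<in>flag_fibre i j k A B C. f X)"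
    by (rule sum.group[OF finite_flag_fibre finite_block_fibre[OF L.H.lie]])
      (use u L.lie_window in \<open>auto simp: flag_fibre_def block_fibre_def window_window assoc
        block_size_le\<close>)
  moreover have "{X \<in> flag_fibre i j k A B C. window i (2 * (j + k)) X = Y}
      = block_fibre (\<uu> q ?n) i (2 * (j + k)) A Y" if "Y \<in> block_fibre (\<uu> q (2 * (j + k))) j (2
        * k) B C" for Y
    using that u unfolding assoc flag_fibre_def block_fibre_def by
      (auto simp: window_window block_size_le)
  ultimately show ?thesis by simp
qed

text \<open>
  Both sides count the nilradical of the finer parabolic subalgebra, as one sees by summing the
  constant function \<open>1\<close> over its fibre above zero in the two ways.
\<close>

lemma card_nil_mult:
  "card (nil_gl i j :: 'a mat set) * card (nil_u q (i + j) k :: 'a mat set)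
    = card (nil_u q j k :: 'a mat set) * card (nil_u q i (j + k) :: 'a mat set)"
proof -
  interpret L: parabolic "2 * (i + j + k)" "2 * k" "U q (2 * (i + j + k))" "\<uu> q (2
    * (i + j + k)) :: 'a mat set"
     "U q (2 * k)" "\<uu> q (2 * k)" "i + j" "embed_u q (i + j)" lift_u by (rule parabolic_u)
  interpret R: parabolic "2 * (i + (j + k))" "2 * (j + k)" "U q (2 * (i + (j + k)))"
     "\<uu> q (2 * (i + (j + k))) :: 'a mat set" "U q (2 * (j + k))" "\<uu> q (2 * (j + k))" i
       "embed_u q i" lift_u
    by (rule parabolic_u)
  have zero: "0\<^sub>m m m \<in> (\<uu> q m :: 'a mat set)" for m
    using q_pos by (auto simp: mem_u_iff dagger_index[of _ m] intro!: eq_matI)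
  let ?O = "\<lambda>m. 0\<^sub>m m m :: 'a mat"
  have "real (card (nil_gl i j :: 'a mat set) * card (nil_u q (i + j) k :: 'a mat set))
      = (\<Sum>Y\<in>block_fibre (gl (i + j)) i j (?O i) (?O j).
          \<Sum>X\<in>block_fibre (\<uu> q (2 * (i + j + k))) (i + j) (2 * k) Y (?O (2 * k)). 1)"
  proof -
    have "(\<Sum>Y\<in>block_fibre (gl (i + j)) i j (?O i) (?O j).
          \<Sum>X\<in>block_fibre (\<uu> q (2 * (i + j + k))) (i + j) (2 * k) Y (?O (2 * k)). 1)
       = (\<Sum>Y\<in>block_fibre (gl (i + j)) i j (?O i) (?O j). real (card (nil_u q (i + j) k :: 'a mat set)))"
      using L.card_fibre[OF _ zero] by (intro sum.cong refl) (auto simp: block_fibre_def nil_u_eq)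
    then show ?thesis by (simp add: nil_gl_eq)
  qed
  also have "\<dots> = (\<Sum>Y\<in>block_fibre (\<uu> q (2 * (j + k))) j (2 * k) (?O j) (?O (2 * k)).
      \<Sum>X\<in>block_fibre (\<uu> q (2 * (i + (j + k)))) i (2 * (j + k)) (?O i) Y. 1)"
    unfolding sum_fibre_left sum_fibre_right ..
  also have "\<dots> = real (card (nil_u q j k :: 'a mat set) * card (nil_u q i (j + k) :: 'a mat set))"
  proof -
    have "(\<Sum>Y\<in>block_fibre (\<uu> q (2 * (j + k))) j (2 * k) (?O j) (?O (2 * k)).
      \<Sum>X\<in>block_fibre (\<uu> q (2 * (i + (j + k)))) i (2 * (j + k)) (?O i) Y. 1)
       = (\<Sum>Y\<in>block_fibre (\<uu> q (2 * (j + k))) j (2 * k) (?O j) (?O (2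
         * k)). real (card (nil_u q i (j + k) :: 'a mat set)))"
      using R.card_fibre[of "?O i"] by (intro sum.cong refl)
        (auto simp: block_fibre_def nil_u_eq gl_def)
    then show ?thesis by (simp add: nil_u_eq)
  qed
  finally show ?thesis by (simp only: of_nat_eq_iff)
qed

text \<open>
  Both sides are the mean of \<open>f\<close> over the same fibre of the finer parabolic subalgebra.
\<close>

lemma res_coassociative:
  "res_gl i j (\<lambda>X. res_u q (i + j) k f (X, C)) (A, B)
    = res_u q j k (\<lambda>Y. res_u q i (j + k) f (A, Y)) (B, C :: 'a mat)"
proof -
  have "res_gl i j (\<lambda>X. res_u q (i + j) k f (X, C)) (A, B)
    = (\<Sum>X\<in>flag_fibre i j k A B C. f X)
        / real (card (nil_gl i j :: 'a mat set) * card (nil_u q (i + j) k :: 'a mat set))"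
    unfolding res_gl_eq res_u_eq sum_divide_distrib[symmetric] sum_fibre_left by
      (simp add: mult.commute)
  also have "\<dots> = res_u q j k (\<lambda>Y. res_u q i (j + k) f (A, Y)) (B, C)"
    unfolding res_u_eq sum_divide_distrib[symmetric] sum_fibre_right card_nil_mult by
      (simp add: mult.commute)
  finally show ?thesis .
qed

text \<open>
  For \<open>i = 0\<close> the fibre over \<open>B\<close> is \<open>{B}\<close>.
\<close>

lemma res_u_counit:
  assumes b: "b \<in> (Bgr q j :: ('a mat \<Rightarrow> real) set)"
  shows "res_u q 0 j b (0\<^sub>m 0 0, B) = b B"
proof -
  have fib: "block_fibre (\<uu> q (2 * (0 + j))) 0 (2 * j) (0\<^sub>m 0 0) B = (if B \<in> \<uu> q (2
    * j) then {B :: 'a mat} else {})" for B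
  proof -
    have "window 0 (2 * j) X = X" if "X \<in> \<uu> q (2 * j)" for X :: "'a mat"
      using that by (intro window_full u_carrier)
    moreover have "window 0 0 X = 0\<^sub>m 0 0" for X :: "'a mat"
      by (rule eq_matI) auto
    ultimately show ?thesis by (auto simp: block_fibre_def)
  qed
  have "0\<^sub>m m m \<in> (\<uu> q m :: 'a mat set)" for m
    using q_pos by (auto simp: mem_u_iff dagger_index[of _ m] intro!: eq_matI)
  then have "card (nil_u q 0 j :: 'a mat set) = 1" unfolding nil_u_eq fib by simp
  then show ?thesis
    using b unfolding res_u_eq fib by (simp add: Bgr_def class_functions_def)
qed

end

section \<open>The module structure\<close>

lemma finite_antidiagonal: "finite {(i, j). i + j = (n :: nat)}"
  by (rule finite_subset[of _ "{..n} \<times> {..n}"]) auto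

lemma sum_triples:
  fixes E :: "nat \<Rightarrow> nat \<Rightarrow> nat \<Rightarrow> real"
  shows "(\<Sum>(m, k)\<in>{(m, k). m + k = n}. \<Sum>(i, j)\<in>{(i, j). i + j = m}. E i j k)
    = (\<Sum>(i, m)\<in>{(i, m). i + m = n}. \<Sum>(j, k)\<in>{(j, k). j + k = m}. E i j k)"
proof -
  let ?D = "\<lambda>n. {(i, j). i + j = (n :: nat)}"
  have "(\<Sum>(m, k)\<in>?D n. \<Sum>(i, j)\<in>?D m. E i j k)
      = (\<Sum>(p, r)\<in>(SIGMA p:?D n. ?D (fst p)). E (fst r) (snd r) (snd p))"
    by (subst sum.Sigma[symmetric]) (auto simp: finite_antidiagonal[unfolded split_def] split_def)
  also have "\<dots> = (\<Sum>(p, r)\<in>(SIGMA p:?D n. ?D (snd p)). E (fst p) (fst r) (snd r))"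
    by (rule sum.reindex_bij_witness[of _ "\<lambda>((i, m), (j, k)). ((i + j, k), (i, j))"
          "\<lambda>((m, k), (i, j)). ((i, j + k), (j, k))"]) auto
  also have "\<dots> = (\<Sum>(i, m)\<in>?D n. \<Sum>(j, k)\<in>?D m. E i j k)"
    by (subst sum.Sigma[symmetric]) (auto simp: finite_antidiagonal[unfolded split_def] split_def)
  finally show ?thesis .
qed

lemma nabla_u_span:
  fixes W :: "(nat \<times> 'b::field mat \<Rightarrow> real) set"
  assumes "subspace W" "\<And>T. T \<in> S \<Longrightarrow> nabla_u q T \<in> W" "T \<in> span S"
  shows "nabla_u q T \<in> W"
proof -
  have "subspace {T. nabla_u q T \<in> W}"
  proof (rule subspaceI)
    have "nabla_u q (0 *\<^sub>R 0 :: (nat \<times> 'b::field mat) \<times> (nat \<times> 'b mat) \<Rightarrow> real) = 0 *\<^sub>R nabla_u q 0"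
      by (rule nabla_u_scale)
    then have "nabla_u q (0 :: (nat \<times> 'b mat) \<times> (nat \<times> 'b mat) \<Rightarrow> real) = 0" by simp
    then show "0 \<in> {T :: (nat \<times> 'b mat) \<times> (nat \<times> 'b mat) \<Rightarrow> real. nabla_u q T \<in> W}"
      using subspace_0[OF assms(1)] by simp
  qed (use assms(1) in \<open>auto simp: nabla_u_add nabla_u_scale subspace_add subspace_scale\<close>)
  then have "span S \<subseteq> {T. nabla_u q T \<in> W}"
    using assms(2) by (intro span_minimal) auto
  then show ?thesis using assms(3) by auto
qed

context frobenius_field
begin

lemma nabla_u_pure_component:
  "nabla_u q (pure_tensor a b) (n, X)
    = (\<Sum>(i, j)\<in>{(i, j). i + j = n}. ind_u q i j (\<lambda>(A, B). a (i, A) * b (j, B)) X)"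
  by (simp add: nabla_u_def pure_tensor_def)

lemma direct_sum_component: "a \<in> direct_sum V \<Longrightarrow> (\<lambda>x. a (n, x)) \<in> V n"
  by (simp add: direct_sum_def)

lemma nabla_u_pure:
  assumes a: "a \<in> direct_sum (Agr :: nat \<Rightarrow> ('a mat \<Rightarrow> real) set)" and b: "b \<in> direct_sum (Bgr q)"
  shows "nabla_u q (pure_tensor a b) \<in> direct_sum (Bgr q)"
proof -
  have "(\<lambda>X. nabla_u q (pure_tensor a b) (n, X)) \<in> Bgr q n" for n
  proof -
    have "(\<Sum>p\<in>{(i, j). i + j = n}. ind_u q (fst p) (snd p) (\<lambda>(A, B). a (fst p, A)
      * b (snd p, B))) \<in> Bgr q n"
      using ind_u_class_function[OF direct_sum_component[OF a] direct_sum_component[OF b]]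
      by (intro subspace_sum subspace_Bgr) auto
    moreover have "(\<lambda>X. nabla_u q (pure_tensor a b) (n, X))
      = (\<Sum>p\<in>{(i, j). i + j = n}. ind_u q (fst p) (snd p) (\<lambda>(A, B). a (fst p, A) * b (snd p, B)))"
      by (rule ext) (simp add: nabla_u_pure_component sum_fun_apply split_def)
    ultimately show ?thesis by simp
  qed
  moreover have "finite {n. \<exists>X. nabla_u q (pure_tensor a b) (n, X) \<noteq> 0}"
  proof (rule finite_subset)
    show "finite ((\<lambda>(i, j). i + j) ` ({i. \<exists>A. a (i, A) \<noteq> 0} \<times> {j. \<exists>B. b (j, B) \<noteq> 0}))"
      using a b by (auto simp: direct_sum_def)
    show "{n. \<exists>X. nabla_u q (pure_tensor a b) (n, X) \<noteq> 0}
        \<subseteq> (\<lambda>(i, j). i + j) ` ({i. \<exists>A. a (i, A) \<noteq> 0} \<times> {j. \<exists>B. b (j, B) \<noteq> 0})"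
    proof safe
      fix n X assume "nabla_u q (pure_tensor a b) (n, X) \<noteq> 0"
      then obtain i j where ij: "i + j = n" "ind_u q i j (\<lambda>(A, B). a (i, A) * b (j, B)) X \<noteq> 0"
        unfolding nabla_u_pure_component by (force elim: sum.not_neutral_contains_not_neutral)
      have "\<exists>A B. a (i, A) * b (j, B) \<noteq> 0"
      proof (rule ccontr)
        assume "\<nexists>A B. a (i, A) * b (j, B) \<noteq> 0"
        then have "(\<lambda>(A, B). a (i, A) * b (j, B)) = (\<lambda>_. 0)" by (auto simp: fun_eq_iff)
        then show False using ij(2) by (simp add: ind_u_zero)
      qed
      then show "n \<in> (\<lambda>(i, j). i + j) ` ({i. \<exists>A. a (i, A) \<noteq> 0} \<times> {j. \<exists>B. b (j, B) \<noteq> 0})"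
        using ij(1) by (intro image_eqI[of _ _ "(i, j)"]) auto
    qed
  qed
  ultimately show ?thesis by (simp add: direct_sum_def)
qed

lemma nabla_u_pure_graded:
  assumes a: "a \<in> graded_part (Agr :: nat \<Rightarrow> ('a mat \<Rightarrow> real) set) i" and b: "b \<in> graded_part (Bgr q) j"
  shows "nabla_u q (pure_tensor a b) \<in> graded_part (Bgr q) (i + j)"
proof -
  have "nabla_u q (pure_tensor a b) (m, X) = 0" if "m \<noteq> i + j" for m X
    unfolding nabla_u_pure_component
  proof (intro sum.neutral ballI, clarify)
    fix i' j' assume "m = i' + j'"
    then have "i' \<noteq> i \<or> j' \<noteq> j" using that by auto
    then have "(\<lambda>(A, B). a (i', A) * b (j', B)) = (\<lambda>_. 0)"
      using a b by (auto simp: graded_part_def fun_eq_iff)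
    then show "ind_u q i' j' (\<lambda>(A, B). a (i', A) * b (j', B)) X = 0" by (simp add: ind_u_zero)
  qed
  then show ?thesis
    using nabla_u_pure a b by (simp add: graded_part_def)
qed

lemma linear_map_nabla_u:
  "linear_map (tensor (direct_sum (Agr :: nat \<Rightarrow> ('a mat \<Rightarrow> real) set)) (direct_sum (Bgr q)))
     (direct_sum (Bgr q)) (nabla_u q)"
  unfolding linear_map_def
  using nabla_u_pure
  by (auto simp: nabla_u_add nabla_u_scale tensor_def intro!: subspace_direct_sum subspace_Bgr
    elim!: nabla_u_span[rotated 2])

lemma nabla_u_graded:
  assumes "T \<in> tensor_graded_part (Agr :: nat \<Rightarrow> ('a mat \<Rightarrow> real) set) (Bgr q) n"
  shows "nabla_u q T \<in> graded_part (Bgr q) n"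
proof (rule nabla_u_span[OF _ _ assms[unfolded tensor_graded_part_def]])
  show W: "subspace (graded_part (Bgr q :: nat \<Rightarrow> ('a mat \<Rightarrow> real) set) n)"
    by (intro subspace_graded_part subspace_Bgr)
  fix T :: "(nat \<times> 'a mat) \<times> (nat \<times> 'a mat) \<Rightarrow> real" assume "T \<in> (\<Union>(i, j)\<in>{(i, j). i + j
    = n}. tensor (graded_part (Agr :: nat \<Rightarrow> ('a mat \<Rightarrow> real) set) i) (graded_part (Bgr q) j))"
  then obtain i j where "i + j = n"
    "T \<in> tensor (graded_part (Agr :: nat \<Rightarrow> ('a mat \<Rightarrow> real) set) i) (graded_part (Bgr q) j)" by auto
  then show "nabla_u q T \<in> graded_part (Bgr q) n"
    unfolding tensor_def by (elim nabla_u_span[OF W, rotated]) (auto intro: nabla_u_pure_graded)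
qed

lemma nabla_u_associative:
  assumes a: "a \<in> direct_sum (Agr :: nat \<Rightarrow> ('a mat \<Rightarrow> real) set)"
    and a': "a' \<in> direct_sum Agr" and b: "b \<in> direct_sum (Bgr q)"
  shows "nabla_u q (tensor_map nabla id (pure_tensor (pure_tensor a a') b))
    = nabla_u q (tensor_map id (nabla_u q) (pure_tensor a (pure_tensor a' b)))"
proof (rule ext, clarify)
  fix n and X :: "'a mat"
  let ?E = "\<lambda>i j k. flag_ind i j k (\<lambda>A. a (i, A)) (\<lambda>A. a' (j, A)) (\<lambda>B. b (k, B)) X"
  have E_left: "ind_u q (i + j) k (\<lambda>(A, C). ind_gl i j (\<lambda>(A, B). a (i, A) * a' (j, B)) A
    * b (k, C)) X = ?E i j k"
    for i j k by (intro ind_left_eq_flag_ind direct_sum_component a a' b)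
  have E_right: "ind_u q i (j + k) (\<lambda>(A, Y). a (i, A) * ind_u q j k (\<lambda>(B, C). a' (j, B)
    * b (k, C)) Y) X = ?E i j k"
    for i j k by (intro ind_right_eq_flag_ind direct_sum_component a a' b)
  have "nabla_u q (tensor_map nabla id (pure_tensor (pure_tensor a a') b)) (n, X)
     = (\<Sum>(m, k)\<in>{(m, k). m + k = n}. ind_u q m k (\<lambda>x. \<Sum>p\<in>{(i, j). i + j = m}.
          (\<lambda>(A, C). ind_gl (fst p) (snd p) (\<lambda>(A, B). a (fst p, A) * a' (snd p, B)) A * b (k, C)) x) X)"
  proof -
    have "tensor_map nabla id (pure_tensor (pure_tensor a a') b) ((m, A), (k, C))
       = (\<Sum>p\<in>{(i, j). i + j = m}. ind_gl (fst p) (snd p) (\<lambda>(A, B). a (fst p, A) * a' (snd p, B)) A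
         * b (k, C))"
      for m A k C
      using ind_gl_scale[of _ _ "\<lambda>(A, B). a (_, A) * a' (_, B)" "b (k, C)"]
      by (simp add: tensor_map_def nabla_def pure_tensor_def split_def)
    then show ?thesis by (simp add: nabla_u_def split_def)
  qed
  also have "\<dots> = (\<Sum>(m, k)\<in>{(m, k). m + k = n}. \<Sum>(i, j)\<in>{(i, j). i + j = m}. ?E i j k)"
    unfolding ind_u_sum by (intro sum.cong refl) (auto intro!: sum.cong simp: E_left)
  also have "\<dots> = (\<Sum>(i, m)\<in>{(i, m). i + m = n}. \<Sum>(j, k)\<in>{(j, k). j + k = m}. ?E i j k)"
    by (rule sum_triples)
  also have "\<dots> = (\<Sum>(i, m)\<in>{(i, m). i + m = n}. ind_u q i m (\<lambda>x. \<Sum>p\<in>{(j, k). j + k = m}.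
       (\<lambda>(A, Y). a (i, A) * ind_u q (fst p) (snd p) (\<lambda>(B, C). a' (fst p, B) * b (snd p, C)) Y) x) X)"
    unfolding ind_u_sum by (intro sum.cong refl) (auto intro!: sum.cong simp: E_right)
  also have "\<dots> = nabla_u q (tensor_map id (nabla_u q) (pure_tensor a (pure_tensor a' b))) (n, X)"
  proof -
    have "tensor_map id (nabla_u q) (pure_tensor a (pure_tensor a' b)) ((i, A), (m, Y))
       = (\<Sum>p\<in>{(j, k). j + k = m}. a (i, A) * ind_u q (fst p) (snd p) (\<lambda>(B, C). a' (fst p, B)
         * b (snd p, C)) Y)"
      for i A m Y
    proof -
      have "tensor_map id (nabla_u q) (pure_tensor a (pure_tensor a' b)) ((i, A), (m, Y))
        = nabla_u q (\<lambda>y. a (i, A) * pure_tensor a' b y) (m, Y)"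
        by (simp add: tensor_map_def pure_tensor_def)
      also have "\<dots> = a (i, A) * nabla_u q (pure_tensor a' b) (m, Y)" by (rule nabla_u_scale')
      finally show ?thesis by (simp add: nabla_u_pure_component sum_distrib_left split_def)
    qed
    then show ?thesis by (simp add: nabla_u_def split_def)
  qed
  finally show "nabla_u q (tensor_map nabla id (pure_tensor (pure_tensor a a') b)) (n, X)
     = nabla_u q (tensor_map id (nabla_u q) (pure_tensor a (pure_tensor a' b))) (n, X)" .
qed

lemma nabla_u_unit:
  assumes b: "b \<in> direct_sum (Bgr q :: nat \<Rightarrow> ('a mat \<Rightarrow> real) set)"
  shows "nabla_u q (pure_tensor unit_A b) = b"
proof (rule ext, clarify)
  fix n and X :: "'a mat"
  have "ind_u q i j (\<lambda>(A, B). unit_A (i, A) * b (j, B)) X = 0" if "i \<noteq> 0" for i j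
  proof -
    have "(\<lambda>(A, B). unit_A (i, A) * b (j, B)) = (\<lambda>_ :: 'a mat \<times> 'a mat. 0 :: real)"
      using that by (auto simp: unit_A_def fun_eq_iff)
    then show ?thesis by (simp add: ind_u_zero)
  qed
  note zero = this
  have "nabla_u q (pure_tensor unit_A b) (n, X)
      = (\<Sum>(i, j)\<in>{(0, n)}. ind_u q i j (\<lambda>(A, B). unit_A (i, A) * b (j, B)) X)"
    unfolding nabla_u_pure_component
  proof (rule sum.mono_neutral_right[OF finite_antidiagonal], simp, rule ballI)
    fix p assume p: "p \<in> {(i, j). i + j = n} - {(0, n)}"
    obtain i j where ij: "p = (i, j)" by (cases p)
    then have "i \<noteq> 0" using p by auto
    then show "(case p of (i, j) \<Rightarrow> ind_u q i j (\<lambda>(A, B). unit_A (i, A) * b (j, B)) X) = 0"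
      unfolding ij prod.case by (rule zero)
  qed
  then show "nabla_u q (pure_tensor unit_A b) (n, X) = b (n, X)"
    using ind_u_unit[OF direct_sum_component[OF b]] by simp
qed

section \<open>The comodule structure\<close>

lemma Delta_u_component: "Delta_u q b ((i, A), (j, B)) = res_u q i j (\<lambda>X. b (i + j, X)) (A, B)"
  by (simp add: Delta_u_def)

text \<open>
  The coaction of \<open>b\<close> is a class function in each of its two variables, hence a combination of pure
  tensors.
\<close>

lemma Delta_u_span:
  assumes b: "b \<in> direct_sum (Bgr q :: nat \<Rightarrow> ('a mat \<Rightarrow> real) set)"
    and S: "finite S" "\<And>i j X. (i, j) \<notin> S \<Longrightarrow> b (i + j, X) = 0"
  shows "Delta_u q b \<in> span (\<Union>(i, j)\<in>S. tensor (graded_part Agr i) (graded_part (Bgr q) j))"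
proof -
  note comp = direct_sum_component[OF b]
  have zero: "Delta_u q b ((i, A), (j, B)) = 0" if "(i, j) \<notin> S" for i A j B
    using S(2)[OF that] by (simp add: Delta_u_component res_u_eq)
  have AB: "Agr = (\<lambda>i. class_functions (GL i) (gl i :: 'a mat set))"
    "Bgr q = (\<lambda>j. class_functions (U q (2 * j)) (\<uu> q (2 * j) :: 'a mat set))"
    by (auto simp: Agr_def Bgr_def fun_eq_iff)
  show ?thesis
    unfolding AB
    by (rule graded_tensor_expansion[where d = "\<lambda>i. i" and d' = "\<lambda>j. 2 * j"])
      (use S(1) zero adjoint_pair_GL adjoint_pair_U res_u_class_function[OF comp, unfolded AB] in
        \<open>auto simp: Delta_u_component\<close>)
qed

lemma Delta_u_graded:
  assumes b: "b \<in> graded_part (Bgr q :: nat \<Rightarrow> ('a mat \<Rightarrow> real) set) n"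
  shows "Delta_u q b \<in> tensor_graded_part Agr (Bgr q) n"
  unfolding tensor_graded_part_def
  using b by (intro Delta_u_span finite_antidiagonal) (auto simp: graded_part_def)

lemma Delta_u_tensor:
  assumes b: "b \<in> direct_sum (Bgr q :: nat \<Rightarrow> ('a mat \<Rightarrow> real) set)"
  shows "Delta_u q b \<in> tensor (direct_sum Agr) (direct_sum (Bgr q))"
proof -
  let ?N = "{n. \<exists>X. b (n, X) \<noteq> 0}"
  let ?S = "\<Union>n\<in>?N. {(i, j). i + j = n}"
  have "Delta_u q b \<in> span (\<Union>(i, j)\<in>?S. tensor (graded_part Agr i) (graded_part (Bgr q) j))"
  proof (rule Delta_u_span[OF b])
    show "finite ?S" using b finite_antidiagonal by (auto simp: direct_sum_def)
  qed auto
  also have "\<dots> \<subseteq> tensor (direct_sum Agr) (direct_sum (Bgr q))"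
  proof (rule span_minimal)
    show "subspace (tensor (direct_sum Agr) (direct_sum (Bgr q :: nat \<Rightarrow> ('a mat \<Rightarrow> real) set)))"
      unfolding tensor_def by (rule subspace_span)
    show "(\<Union>(i, j)\<in>?S. tensor (graded_part Agr i) (graded_part (Bgr q) j))
        \<subseteq> tensor (direct_sum Agr) (direct_sum (Bgr q :: nat \<Rightarrow> ('a mat \<Rightarrow> real) set))"
      using tensor_mono[OF graded_part_sub graded_part_sub] by blast
  qed
  finally show ?thesis .
qed

lemma linear_map_Delta_u:
  "linear_map (direct_sum (Bgr q :: nat \<Rightarrow> ('a mat \<Rightarrow> real) set))
     (tensor (direct_sum Agr) (direct_sum (Bgr q))) (Delta_u q)"
  unfolding linear_map_def using Delta_u_tensor
  by (auto simp: fun_eq_iff Delta_u_component res_u_eq scaleR_fun_def sum.distrib add_divide_distrib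
    sum_distrib_left)

lemma Delta_u_coassociative:
  "tensor_assoc (tensor_map Delta id (Delta_u q b))
    = tensor_map id (Delta_u q) (Delta_u q (b :: nat \<times> 'a mat \<Rightarrow> real))"
proof (rule ext, clarify)
  fix i j k and A B C :: "'a mat"
  show "tensor_assoc (tensor_map Delta id (Delta_u q b)) ((i, A), (j, B), (k, C))
    = tensor_map id (Delta_u q) (Delta_u q b) ((i, A), (j, B), (k, C))"
    using res_coassociative[of i j k "\<lambda>X. b (i + j + k, X)" C A B]
    by (simp add: tensor_assoc_def tensor_map_def Delta_def Delta_u_component add.assoc)
qed

lemma Delta_u_counit:
  assumes b: "b \<in> direct_sum (Bgr q :: nat \<Rightarrow> ('a mat \<Rightarrow> real) set)"
  shows "(\<lambda>y. counit_A (\<lambda>x. Delta_u q b (x, y))) = b"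
  using res_u_counit[OF direct_sum_component[OF b]]
  by (auto simp: counit_A_def Delta_u_component fun_eq_iff)

end

theorem theorem11:
  fixes q :: nat
  assumes "primepow q" and "odd q" and "card (UNIV :: 'a::{finite,field} set) = q\<^sup>2"
  shows "graded_module (Agr :: nat \<Rightarrow> ('a mat \<Rightarrow> real) set) nabla unit_A (Bgr q) (nabla_u q)
    \<and> graded_comodule (Agr :: nat \<Rightarrow> ('a mat \<Rightarrow> real) set) Delta counit_A (Bgr q) (Delta_u q)
    \<and> (\<forall>n. nabla_u q ` tensor_graded_part (Agr :: nat \<Rightarrow> ('a mat \<Rightarrow> real) set) (Bgr q) n
          \<subseteq> graded_part (Bgr q) n)
    \<and> (\<forall>n. Delta_u q ` graded_part (Bgr q) n
          \<subseteq> tensor_graded_part (Agr :: nat \<Rightarrow> ('a mat \<Rightarrow> real) set) (Bgr q) n)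
    \<and> (\<forall>a\<in>direct_sum (Agr :: nat \<Rightarrow> ('a mat \<Rightarrow> real) set).
         \<forall>a'\<in>direct_sum Agr. \<forall>b\<in>direct_sum (Bgr q).
           nabla_u q (tensor_map nabla id (pure_tensor (pure_tensor a a') b))
             = nabla_u q (tensor_map id (nabla_u q) (pure_tensor a (pure_tensor a' b))))
    \<and> (\<forall>b\<in>direct_sum (Bgr q :: nat \<Rightarrow> ('a mat \<Rightarrow> real) set).
         tensor_assoc (tensor_map Delta id (Delta_u q b))
           = tensor_map id (Delta_u q) (Delta_u q b))"
proof -
  interpret frobenius_field q "TYPE('a)"
    by unfold_locales (rule frobenius_square_field[OF assms(1,3)])+
  have grad: "\<forall>n. nabla_u q ` tensor_graded_part (Agr :: nat \<Rightarrow> ('a mat \<Rightarrow> real) set) (Bgr q) n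
      \<subseteq> graded_part (Bgr q) n"
    and cograd: "\<forall>n. Delta_u q ` graded_part (Bgr q) n
      \<subseteq> tensor_graded_part (Agr :: nat \<Rightarrow> ('a mat \<Rightarrow> real) set) (Bgr q) n"
    using nabla_u_graded Delta_u_graded by auto
  show ?thesis
    unfolding graded_module_def graded_comodule_def
    by (intro conjI ballI grad cograd linear_map_nabla_u linear_map_Delta_u nabla_u_associative
        nabla_u_unit Delta_u_coassociative Delta_u_counit)
qed

end
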